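(* Let $d=2$. The MWX element method: find $u_{h0}\in V_{h0}$ such that $$\varepsilon^2a_h(u_{h0},v_h)+b_h(u_{h0},v_h)=(f,P_hv_h)\qquad\forall\,v_h\in V_{h0},$$ can be decoupled into one Lagrange element method of Poisson equation, two Morley element methods of Poisson equation and one nonconforming $P_1$-$P_0$ element method of Brinkman problem. That is, it is equivalent to: find $w_h\in W_h$ such that $$(\nabla w_h,\nabla\chi_h)=(f,\chi_h)\qquad\forall\,\chi_h\in W_h,$$ and then find $(z_h,\phi_h,p_h,u_{h0})\in V_h\times V_{h0}^{CR}\times\mathcal Q_h\times V_h$ such that $$(\operatorname{curl}_hz_h,\operatorname{curl}_hv_h)=(\nabla w_h,\nabla_hv_h)\qquad\forall\,v_h\in V_h,$$ $$(\phi_h,\psi_h)+\varepsilon^2(\nabla_h\phi_h,\nabla_h\psi_h)+(\operatorname{div}_h\psi_h,p_h)=(\operatorname{curl}_hz_h,\psi_h)\qquad\forall\,\psi_h\in V_{h0}^{CR},$$ $$(\operatorname{div}_h\phi_h,q_h)=0\qquad\forall\,q_h\in\mathcal Q_h,$$ $$(\operatorname{curl}_hu_{h0},\operatorname{curl}_h\chi_h)=(\phi_h,\operatorname{curl}_h\chi_h)\qquad\forall\,\chi_h\in V_h.$$ (Equivalence means: $u_{h0}$ solves the MWX element method if and only if $u_{h0}$ is the last component of a solution of the decoupled system.)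
   Context: $\Omega\subset\mathbb R^2$ is a convex bounded polygon, $f\in L^2(\Omega)$, $\varepsilon>0$, and $\mathcal T_h$ is a (shape regular) triangulation of $\Omega$. $(\cdot,\cdot)$ is the $L^2(\Omega)$ inner product (scalar, vector or tensor valued); $n$ is the unit outward normal to $\partial\Omega$. $\nabla_h,\nabla_h^2,\operatorname{curl}_h,\operatorname{div}_h$ are the elementwise gradient, Hessian, curl and divergence, where for scalar $v$, $\operatorname{curl}v=(\partial_{2}v,-\partial_{1}v)^{T}$. Morley (MWX) spaces: $\widetilde V_h$ is the set of piecewise quadratic functions on $\mathcal T_h$ that are continuous at all vertices and whose normal derivatives are continuous at the midpoint of each edge; $V_h:=\{v\in\widetilde V_h: v=0$ at all vertices on $\partial\Omega\}$; $V_{h0}:=\{v\in V_h:\int_F\partial_nv\,ds=0$ for all edges $F\subset\partial\Omega\}$. Lagrange space: $W_h:=\{v\in H_0^1(\Omega):v|_K\in\mathbb P_\ell(K)\ \forall K\in\mathcal T_h\}$, $\ell\in\{1,2\}$ fixed. $V_h^{CR}$ is the set of $v\in L^2(\Omega;\mathbb R^2)$ with $v|_K\in\mathbb P_1(K;\mathbb R^2)$ for each $K$, such that the jump of $v$ has zero integral on each interior edge and $\int_Fv\cdot n\,ds=0$ on each boundary edge $F$; $V_{h0}^{CR}:=\{v\in V_h^{CR}:\int_Fv\,ds=0$ for each boundary edge $F\}$. $\mathcal Q_h$ is the space of piecewise constant functions on $\mathcal T_h$ with vanishing mean over $\Omega$. Forms: $a_h(w,v):=(\nabla_h^2w,\nabla_h^2v)$,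 $b_h(w,v):=(\nabla_hw,\nabla_hv)$; $P_h$ maps piecewise $H^1$ functions to $W_h$ by $(\nabla P_hv,\nabla\chi_h)=(\nabla_hv,\nabla\chi_h)$ for all $\chi_h\in W_h$. *)

theory Defs
  imports "HOL-Analysis.Analysis"
begin

(* Functions on Omega are total functions on R^2.  They stand for their class modulo equality
   almost everywhere: nothing below depends on values outside Omega, and membership in the
   discrete spaces does not depend on values on the mesh skeleton (the element boundaries). *)

section \<open>Domain and mesh\<close>

definition convex_polygon :: "(real^2) set \<Rightarrow> bool" where
  "convex_polygon \<Omega> \<longleftrightarrow>
     \<Omega> \<noteq> {} \<and> open \<Omega> \<and> convex \<Omega> \<and> bounded \<Omega> \<and> polytope (closure \<Omega>)"

(* The library's triangulation allows cells of any dimension and gives conformity: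
   two cells meet in a common (possibly empty) face.  Cells are closed triangles. *)
definition mesh :: "(real^2) set \<Rightarrow> (real^2) set set \<Rightarrow> bool" where
  "mesh \<Omega> \<T> \<longleftrightarrow> triangulation \<T> \<and> (\<forall>K\<in>\<T>. 2 simplex K) \<and> \<Union>\<T> = closure \<Omega>"

(* h_K <= sigma * rho_K, with rho_K the diameter of the largest disc contained in K. *)
definition shape_regular :: "real \<Rightarrow> (real^2) set set \<Rightarrow> bool" where
  "shape_regular \<sigma> \<T> \<longleftrightarrow>
     (\<forall>K\<in>\<T>. \<exists>c r. 0 < r \<and> cball c r \<subseteq> K \<and> diameter K \<le> \<sigma> * (2 * r))"

definition unit_normal :: "(real^2) set \<Rightarrow> real^2 \<Rightarrow> bool" where
  "unit_normal F n \<longleftrightarrow> norm n = 1 \<and> (\<forall>x\<in>F. \<forall>y\<in>F. n \<bullet> (y - x) = 0)"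

(* For convex Omega and a nondegenerate segment F in the boundary, this determines n uniquely. *)
definition outward_unit_normal :: "(real^2) set \<Rightarrow> (real^2) set \<Rightarrow> real^2 \<Rightarrow> bool" where
  "outward_unit_normal \<Omega> F n \<longleftrightarrow> norm n = 1 \<and> (\<forall>x\<in>F. \<forall>y\<in>\<Omega>. n \<bullet> (y - x) \<le> 0)"

section \<open>The space L2 and its inner product\<close>

definition L2 :: "(real^2) set \<Rightarrow> (real^2 \<Rightarrow> 'b::euclidean_space) set" where
  "L2 \<Omega> = {v. v \<in> borel_measurable (lebesgue_on \<Omega>) \<and>
              integrable (lebesgue_on \<Omega>) (\<lambda>x. (norm (v x))\<^sup>2)}"

(* For tensors (type real^2^2) the pointwise inner product is the Frobenius product. *)
definition L2_inner ::
    "(real^2) set \<Rightarrow> (real^2 \<Rightarrow> 'b::euclidean_space) \<Rightarrow> (real^2 \<Rightarrow> 'b) \<Rightarrow> real" where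
  "L2_inner \<Omega> v w = (LINT x|lebesgue_on \<Omega>. v x \<bullet> w x)"

section \<open>Classical, weak and elementwise derivatives\<close>

definition partial :: "2 \<Rightarrow> (real^2 \<Rightarrow> 'b::real_normed_vector) \<Rightarrow> real^2 \<Rightarrow> 'b" where
  "partial i v x = frechet_derivative v (at x) (axis i 1)"

definition grad :: "(real^2 \<Rightarrow> 'b::real_normed_vector) \<Rightarrow> real^2 \<Rightarrow> 'b^2" where
  "grad v x = (\<chi> i. partial i v x)"

(* Every iterated partial derivative exists and is differentiable, i.e. v is C-infinity. *)
definition smooth :: "(real^2 \<Rightarrow> real) \<Rightarrow> bool" where
  "smooth v \<longleftrightarrow> (\<forall>is. fold partial is v differentiable_on UNIV)"

definition test_functions :: "(real^2) set \<Rightarrow> (real^2 \<Rightarrow> real) set" where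
  "test_functions \<Omega> =
     {\<theta>. smooth \<theta> \<and> compact (closure {x. \<theta> x \<noteq> 0}) \<and> closure {x. \<theta> x \<noteq> 0} \<subseteq> \<Omega>}"

definition is_weak_grad ::
    "(real^2) set \<Rightarrow> (real^2 \<Rightarrow> real) \<Rightarrow> (real^2 \<Rightarrow> real^2) \<Rightarrow> bool" where
  "is_weak_grad \<Omega> v g \<longleftrightarrow> g \<in> L2 \<Omega> \<and>
     (\<forall>\<theta>\<in>test_functions \<Omega>. \<forall>i.
        L2_inner \<Omega> v (partial i \<theta>) = - L2_inner \<Omega> (\<lambda>x. g x $ i) \<theta>)"

definition H1 :: "(real^2) set \<Rightarrow> (real^2 \<Rightarrow> real) set" where
  "H1 \<Omega> = {v \<in> L2 \<Omega>. \<exists>g. is_weak_grad \<Omega> v g}"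

(* Unique almost everywhere for v in H1. *)
definition weak_grad :: "(real^2) set \<Rightarrow> (real^2 \<Rightarrow> real) \<Rightarrow> real^2 \<Rightarrow> real^2" where
  "weak_grad \<Omega> v = (SOME g. is_weak_grad \<Omega> v g)"

(* The closure of the test functions with respect to the H1 norm. *)
definition H10 :: "(real^2) set \<Rightarrow> (real^2 \<Rightarrow> real) set" where
  "H10 \<Omega> = {v \<in> H1 \<Omega>. \<exists>\<theta>. (\<forall>n. \<theta> n \<in> test_functions \<Omega>) \<and>
     (\<lambda>n. L2_inner \<Omega> (\<lambda>x. v x - \<theta> n x) (\<lambda>x. v x - \<theta> n x) +
          L2_inner \<Omega> (\<lambda>x. weak_grad \<Omega> v x - grad (\<theta> n) x)
                     (\<lambda>x. weak_grad \<Omega> v x - grad (\<theta> n) x)) \<longlonglongrightarrow> (0::real)}"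

(* Derivative of the restriction of v to each open element; the value 0 on the skeleton, a null
   set, is immaterial. *)
definition partial_h ::
    "(real^2) set set \<Rightarrow> 2 \<Rightarrow> (real^2 \<Rightarrow> 'b::real_normed_vector) \<Rightarrow> real^2 \<Rightarrow> 'b" where
  "partial_h \<T> i v x = (if \<exists>K\<in>\<T>. x \<in> interior K then partial i v x else 0)"

(* For vector valued v this is the transposed Jacobian; only Frobenius products of two such
   gradients occur, so the index order plays no role. *)
definition grad_h ::
    "(real^2) set set \<Rightarrow> (real^2 \<Rightarrow> 'b::real_normed_vector) \<Rightarrow> real^2 \<Rightarrow> 'b^2" where
  "grad_h \<T> v x = (\<chi> i. partial_h \<T> i v x)"

definition hess_h :: "(real^2) set set \<Rightarrow> (real^2 \<Rightarrow> real) \<Rightarrow> real^2 \<Rightarrow> real^2^2" where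
  "hess_h \<T> v = grad_h \<T> (grad_h \<T> v)"

definition curl_h :: "(real^2) set set \<Rightarrow> (real^2 \<Rightarrow> real) \<Rightarrow> real^2 \<Rightarrow> real^2" where
  "curl_h \<T> v x = vector [partial_h \<T> 2 v x, - partial_h \<T> 1 v x]"

definition div_h :: "(real^2) set set \<Rightarrow> (real^2 \<Rightarrow> real^2) \<Rightarrow> real^2 \<Rightarrow> real" where
  "div_h \<T> \<psi> x =
     partial_h \<T> 1 (\<lambda>y. \<psi> y $ 1) x + partial_h \<T> 2 (\<lambda>y. \<psi> y $ 2) x"

section \<open>Piecewise polynomials, traces and edge integrals\<close>

definition polys :: "nat \<Rightarrow> (real^2 \<Rightarrow> 'b::real_vector) set" where
  "polys k = {p. \<exists>c. \<forall>x. p x = (\<Sum>i\<le>k. \<Sum>j\<le>k - i. ((x $ 1) ^ i * (x $ 2) ^ j) *\<^sub>R c i j)}"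

definition pw_polys :: "(real^2) set set \<Rightarrow> nat \<Rightarrow> (real^2 \<Rightarrow> 'b::real_vector) set" where
  "pw_polys \<T> k = {v. \<forall>K\<in>\<T>. \<exists>p\<in>polys k. \<forall>x\<in>interior K. v x = p x}"

(* Value at a boundary point x of K of the restriction of v to K. *)
definition trace_from ::
    "(real^2) set \<Rightarrow> (real^2 \<Rightarrow> 'b::t2_space) \<Rightarrow> real^2 \<Rightarrow> 'b" where
  "trace_from K v x = Lim (at x within interior K) v"

(* Arc length integral over the segment from a to b. *)
definition edge_integral ::
    "real^2 \<Rightarrow> real^2 \<Rightarrow> (real^2 \<Rightarrow> 'b::euclidean_space) \<Rightarrow> 'b" where
  "edge_integral a b g = norm (b - a) *\<^sub>R integral {0..1} (\<lambda>t. g (linepath a b t))"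

section \<open>Finite element spaces\<close>

(* Edges are written as segments with endpoints a, b.  An edge belongs to two different cells
   exactly if it is an interior edge, so the conditions that compare the traces from K and K'
   say something about interior edges only. *)

definition MWX_tilde :: "(real^2) set set \<Rightarrow> (real^2 \<Rightarrow> real) set" where
  "MWX_tilde \<T> = {v \<in> pw_polys \<T> 2.
     (\<forall>K\<in>\<T>. \<forall>K'\<in>\<T>. \<forall>a. a extreme_point_of K \<and> a extreme_point_of K' \<longrightarrow>
        trace_from K v a = trace_from K' v a) \<and>
     (\<forall>K\<in>\<T>. \<forall>K'\<in>\<T>. \<forall>a b n.
        closed_segment a b edge_of K \<and> closed_segment a b edge_of K' \<and>
        unit_normal (closed_segment a b) n \<longrightarrow>
        trace_from K (\<lambda>x. n \<bullet> grad_h \<T> v x) (midpoint a b) =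
        trace_from K' (\<lambda>x. n \<bullet> grad_h \<T> v x) (midpoint a b))}"

definition MWX :: "(real^2) set \<Rightarrow> (real^2) set set \<Rightarrow> (real^2 \<Rightarrow> real) set" where
  "MWX \<Omega> \<T> = {v \<in> MWX_tilde \<T>.
     \<forall>K\<in>\<T>. \<forall>a. a extreme_point_of K \<and> a \<in> frontier \<Omega> \<longrightarrow> trace_from K v a = 0}"

definition MWX0 :: "(real^2) set \<Rightarrow> (real^2) set set \<Rightarrow> (real^2 \<Rightarrow> real) set" where
  "MWX0 \<Omega> \<T> = {v \<in> MWX \<Omega> \<T>.
     \<forall>K\<in>\<T>. \<forall>a b n. closed_segment a b edge_of K \<and> closed_segment a b \<subseteq> frontier \<Omega> \<and>
       outward_unit_normal \<Omega> (closed_segment a b) n \<longrightarrow>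
       edge_integral a b (trace_from K (\<lambda>x. n \<bullet> grad_h \<T> v x)) = 0}"

definition Lagrange :: "(real^2) set \<Rightarrow> (real^2) set set \<Rightarrow> nat \<Rightarrow> (real^2 \<Rightarrow> real) set" where
  "Lagrange \<Omega> \<T> l = H10 \<Omega> \<inter> pw_polys \<T> l"

definition CR :: "(real^2) set \<Rightarrow> (real^2) set set \<Rightarrow> (real^2 \<Rightarrow> real^2) set" where
  "CR \<Omega> \<T> = {v \<in> L2 \<Omega> \<inter> pw_polys \<T> 1.
     (\<forall>K\<in>\<T>. \<forall>K'\<in>\<T>. \<forall>a b.
        closed_segment a b edge_of K \<and> closed_segment a b edge_of K' \<longrightarrow>
        edge_integral a b (\<lambda>x. trace_from K v x - trace_from K' v x) = 0) \<and>
     (\<forall>K\<in>\<T>. \<forall>a b n. closed_segment a b edge_of K \<and> closed_segment a b \<subseteq> frontier \<Omega> \<and>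
        outward_unit_normal \<Omega> (closed_segment a b) n \<longrightarrow>
        edge_integral a b (\<lambda>x. trace_from K v x \<bullet> n) = 0)}"

definition CR0 :: "(real^2) set \<Rightarrow> (real^2) set set \<Rightarrow> (real^2 \<Rightarrow> real^2) set" where
  "CR0 \<Omega> \<T> = {v \<in> CR \<Omega> \<T>.
     \<forall>K\<in>\<T>. \<forall>a b. closed_segment a b edge_of K \<and> closed_segment a b \<subseteq> frontier \<Omega> \<longrightarrow>
       edge_integral a b (trace_from K v) = 0}"

definition PW_const0 :: "(real^2) set \<Rightarrow> (real^2) set set \<Rightarrow> (real^2 \<Rightarrow> real) set" where
  "PW_const0 \<Omega> \<T> = {q \<in> pw_polys \<T> 0. (LINT x|lebesgue_on \<Omega>. q x) = 0}"

section \<open>Bilinear forms and the projection onto the Lagrange space\<close>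

definition a_h ::
    "(real^2) set \<Rightarrow> (real^2) set set \<Rightarrow> (real^2 \<Rightarrow> real) \<Rightarrow> (real^2 \<Rightarrow> real) \<Rightarrow> real" where
  "a_h \<Omega> \<T> w v = L2_inner \<Omega> (hess_h \<T> w) (hess_h \<T> v)"

definition b_h ::
    "(real^2) set \<Rightarrow> (real^2) set set \<Rightarrow> (real^2 \<Rightarrow> real) \<Rightarrow> (real^2 \<Rightarrow> real) \<Rightarrow> real" where
  "b_h \<Omega> \<T> w v = L2_inner \<Omega> (grad_h \<T> w) (grad_h \<T> v)"

(* For piecewise polynomial v the defining property has a solution, unique almost everywhere,
   so L2 inner products with P_h v do not depend on the choice. *)
definition P_h ::
    "(real^2) set \<Rightarrow> (real^2) set set \<Rightarrow> nat \<Rightarrow> (real^2 \<Rightarrow> real) \<Rightarrow> real^2 \<Rightarrow> real" where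
  "P_h \<Omega> \<T> l v = (SOME w. w \<in> Lagrange \<Omega> \<T> l \<and>
     (\<forall>\<eta>\<in>Lagrange \<Omega> \<T> l.
        L2_inner \<Omega> (weak_grad \<Omega> w) (weak_grad \<Omega> \<eta>) =
        L2_inner \<Omega> (grad_h \<T> v) (weak_grad \<Omega> \<eta>)))"

end

theory Submission
  imports Defs
begin

text \<open>
  The rotated gradient \<open>curl_h\<close> maps \<open>MWX0\<close> onto the discretely divergence free fields of \<open>CR0\<close>.
  Testing the Brinkman problem with \<open>\<psi> = curl_h v\<close> therefore eliminates the pressure and returns the
  MWX equation, because \<open>(f, P_h v) = (\<nabla> w, \<nabla> P_h v) = (\<nabla> w, \<nabla>\<^sub>h v) = (curl_h z, curl_h v)\<close> and
  \<open>curl_h\<close> preserves the forms \<open>a_h\<close> and \<open>b_h\<close>. Conversely, the residual of \<open>\<phi> = curl_h u\<close> in the Brinkman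
  problem vanishes on the kernel of the discrete divergence, so it is represented by a pressure; no
  inf-sup condition is needed for this.

  For the surjectivity of \<open>curl_h\<close>, the rotated averages of \<open>\<phi>\<close> over the edges form a closed cochain.
  It has a potential on the vertices because piecewise constant, tangentially continuous fields on a
  convex polygon are gradients of continuous functions: local potentials on vertex stars are
  patched along straight lines from a fixed point.
\<close>

text \<open>The equivalence asserts the existence of \<open>w\<close>, \<open>z\<close> and
  \<open>p\<close>, so each of them has to be constructed from an MWX solution. Functions stand for
  classes modulo null sets and are unconstrained on the skeleton; hence every energy form is only
  semidefinite and no space is literally finite-dimensional. A representation theorem that asks only
  that the functional vanish wherever the form does covers the Poisson problem, the Morley problem
  and the pressure alike. A second obstacle is the mean value constraint on the pressure space.
  Testing \<open>div_h \<T> \<phi>\<close> with mean-free functions only shows that it is one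
  constant on all cells. Gauss' theorem on the polygon would exclude a nonzero constant; here a
  potential does so instead, since it would have to grow monotonically along the closed boundary
  curve. Finally, the last equation places \<open>u\<close> in \<open>MWX\<close> only. The
  condition on its normal derivative comes from \<open>\<phi>\<close>: on the open cells
  \<open>u\<close> has the same curl as a function of \<open>MWX0\<close>.\<close>

section \<open>L2 functions and finite-dimensional Riesz representation\<close>

text \<open>A Riesz representation for a symmetric positive semidefinite form. The finitely many
  functionals bound the dimension modulo the kernel of the form, and the induction splits off
  one functional at a time; \<open>comb\<close> abstracts linear combinations.\<close>

lemma riesz_finite:
  fixes comb :: "real \<Rightarrow> 'v \<Rightarrow> real \<Rightarrow> 'v \<Rightarrow> 'v" and B :: "'v \<Rightarrow> 'v \<Rightarrow> real"
    and F :: "'v \<Rightarrow> real" and lf :: "'i \<Rightarrow> 'v \<Rightarrow> real"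
  assumes "finite I"
    and "V \<noteq> {}"
    and "\<And>c d v w. v \<in> V \<Longrightarrow> w \<in> V \<Longrightarrow> comb c v d w \<in> V"
    and "\<And>i c d v w. i \<in> I \<Longrightarrow> v \<in> V \<Longrightarrow> w \<in> V \<Longrightarrow> lf i (comb c v d w) = c * lf i v + d * lf i w"
    and "\<And>c d v w z. v \<in> V \<Longrightarrow> w \<in> V \<Longrightarrow> z \<in> V \<Longrightarrow> B (comb c v d w) z = c * B v z + d * B w z"
    and "\<And>v w. v \<in> V \<Longrightarrow> w \<in> V \<Longrightarrow> B v w = B w v"
    and "\<And>v. v \<in> V \<Longrightarrow> B v v \<ge> 0"
    and "\<And>c d v w. v \<in> V \<Longrightarrow> w \<in> V \<Longrightarrow> F (comb c v d w) = c * F v + d * F w"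
    and "\<And>v. v \<in> V \<Longrightarrow> B v v = 0 \<Longrightarrow> F v = 0"
    and "\<And>v. v \<in> V \<Longrightarrow> (\<And>i. i \<in> I \<Longrightarrow> lf i v = 0) \<Longrightarrow> B v v = 0"
  shows "\<exists>w\<in>V. \<forall>v\<in>V. B w v = F v"
  using assms
proof (induction I arbitrary: V F rule: finite_induct)
  case empty
  note comb = empty(2) and bil = empty(4) and sym = empty(5) and Fz = empty(8) and sep = empty(9)
  obtain w where w: "w \<in> V" using empty(1) by blast
  have "B w v = F v" if v: "v \<in> V" for v
  proof -
    \<comment> \<open>Without separating functionals \<open>B\<close> vanishes on the diagonal, and
      polarization with \<open>comb 1 v 1 w\<close> makes it vanish everywhere.\<close>
    have "B v w = 0"
    proof -
      have "B (comb 1 v 1 w) (comb 1 v 1 w) = 0" using sep comb[OF v w] by blast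
      moreover have "B (comb 1 v 1 w) (comb 1 v 1 w) = B v (comb 1 v 1 w) + B w (comb 1 v 1 w)"
        using bil[OF v w comb[OF v w], of 1 1 1 1] by simp
      moreover have "B v (comb 1 v 1 w) = B v v + B w v"
        using sym[OF v comb[OF v w]] bil[OF v w v, of 1 1] by simp
      moreover have "B w (comb 1 v 1 w) = B v w + B w w"
        using sym[OF w comb[OF v w]] bil[OF v w w, of 1 1] by simp
      ultimately show ?thesis using sep[OF v] sep[OF w] sym[OF v w] by simp
    qed
    then show ?thesis using Fz[OF v] sep[OF v] sym[OF v w] by simp
  qed
  then show ?case using w by blast
next
  case (insert i I)
  note comb = insert.prems(2) and lin = insert.prems(3) and bil = insert.prems(4)
    and sym = insert.prems(5) and pos = insert.prems(6) and Flin = insert.prems(7)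
    and Fz = insert.prems(8) and sep = insert.prems(9)
  have CS: "B x v = 0" if x: "x \<in> V" and v: "v \<in> V" and 0: "B v v = 0" for x v
  proof (rule ccontr)
    assume nz: "B x v \<noteq> 0"
    have ex: "B (comb t v 1 x) (comb t v 1 x) = 2 * t * B x v + B x x" for t
    proof -
      have c: "comb t v 1 x \<in> V" using comb v x by blast
      have "B (comb t v 1 x) (comb t v 1 x) = t * B v (comb t v 1 x) + B x (comb t v 1 x)"
        using bil[OF v x c, of t 1] by simp
      moreover have "B v (comb t v 1 x) = t * B v v + B x v"
        using sym[OF v c] bil[OF v x v, of t 1] by simp
      moreover have "B x (comb t v 1 x) = t * B v x + B x x"
        using sym[OF x c] bil[OF v x x, of t 1] by simp
      ultimately show ?thesis using 0 sym[OF v x] by (simp add: algebra_simps)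
    qed
    \<comment> \<open>Since \<open>B v v = 0\<close>, the energy of \<open>comb t v 1 x\<close> is
      affine in \<open>t\<close>; this value of \<open>t\<close> makes it -1.\<close>
    define t where "t = - (B x x + 1) / (2 * B x v)"
    have "2 * t * B x v + B x x = -1" using nz by (simp add: t_def field_simps)
    then show False using ex[of t] pos[OF comb[OF v x], of t 1] by simp
  qed
  show ?case
  proof (cases "\<forall>v\<in>V. lf i v = 0")
    case True
    \<comment> \<open>A functional that vanishes on all of \<open>V\<close> contributes nothing to
      the separation, so \<open>I\<close> alone separates.\<close>
    show ?thesis
    proof (rule insert.IH[OF insert.prems(1)])
      show "B v v = 0" if "v \<in> V" "\<And>i. i \<in> I \<Longrightarrow> lf i v = 0" for v
        using sep[OF that(1)] that(2) True that(1) by auto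
    qed (use comb lin bil sym pos Flin Fz in auto)
  next
    case False
    then obtain e0 where e0: "e0 \<in> V" "lf i e0 \<noteq> 0" by blast
    define e where "e = comb (1 / lf i e0) e0 0 e0"
    have e: "e \<in> V" "lf i e = 1" unfolding e_def using comb e0 lin by auto
    let ?V = "{v \<in> V. lf i v = 0}"
    have ne: "?V \<noteq> {}" using comb[OF e(1,1), of 0 0] lin[OF _ e(1,1), of i 0 0] by auto
    \<comment> \<open>The induction hypothesis is applied on the kernel of \<open>lf i\<close>. It
      is used twice: for \<open>F\<close> itself and for the functional \<open>B e\<close>.\<close>
    have ex: "\<exists>w\<in>?V. \<forall>v\<in>?V. B w v = G v"
      if "\<And>c d v w. v \<in> ?V \<Longrightarrow> w \<in> ?V \<Longrightarrow> G (comb c v d w) = c * G v + d * G w"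
        "\<And>v. v \<in> ?V \<Longrightarrow> B v v = 0 \<Longrightarrow> G v = 0" for G
    proof (rule insert.IH[OF ne])
      show "comb c v d w \<in> ?V" if "v \<in> ?V" "w \<in> ?V" for c d v w
        using that comb lin[of i v w c d] by auto
      show "B v v = 0" if "v \<in> ?V" "\<And>i. i \<in> I \<Longrightarrow> lf i v = 0" for v
        using that sep[of v] by auto
      show "B (comb c v d w) z = c * B v z + d * B w z" if "v \<in> ?V" "w \<in> ?V" "z \<in> ?V" for c d v w z
        using that bil by auto
    qed (use that lin sym pos in auto)
    obtain w' where w': "w' \<in> V" "lf i w' = 0" "\<And>v. v \<in> ?V \<Longrightarrow> B w' v = F v"
      using ex[of F] Flin Fz by auto
    have "\<exists>w\<in>?V. \<forall>v\<in>?V. B w v = B e v"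
    proof (rule ex)
      show "B e (comb c v d w) = c * B e v + d * B e w" if "v \<in> ?V" "w \<in> ?V" for c d v w
        using that sym[OF e(1) comb, of v w c d] bil[of v w e c d] e sym[of e v] sym[of e w] by auto
      show "B e v = 0" if "v \<in> ?V" "B v v = 0" for v using CS e that by blast
    qed
    then obtain e' where e': "e' \<in> V" "lf i e' = 0" "\<And>v. v \<in> ?V \<Longrightarrow> B e' v = B e v" by auto
    \<comment> \<open>\<open>e'\<close> acts as the projection of \<open>e\<close> onto the kernel
      with respect to \<open>B\<close>. So \<open>r\<close> is orthogonal to the kernel, and adding
      a multiple of it to \<open>w'\<close> keeps the values there while correcting the value at
      \<open>e\<close>.\<close>
    define r where "r = comb 1 e (-1) e'"
    have r: "r \<in> V" unfolding r_def using comb e e' by blast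
    have rv: "B r v = 0" if "v \<in> ?V" for v
      unfolding r_def using bil[OF e(1) e'(1), of v 1 "-1"] e'(3)[OF that] that by auto
    have xr: "B x r = B x e - B x e'" if "x \<in> V" for x
      unfolding r_def using sym[OF that comb[OF e(1) e'(1)], of 1 "-1"] bil[OF e(1) e'(1) that, of 1 "-1"]
        sym[OF that e(1)] sym[OF that e'(1)] by simp
    have rr: "B r r = B r e" using xr[OF r] rv[of e'] e' by simp
    have "\<exists>s. B w' e + s * B r e = F e"
    proof (cases "B r r = 0")
      \<comment> \<open>If \<open>r\<close> has energy zero, then \<open>F r = 0\<close>, and
        agreement at \<open>e\<close> already holds with \<open>s = 0\<close>.\<close>
      case True
      have "F r = 0" using Fz[OF r True] .
      then have "F e = F e'" unfolding r_def using Flin[OF e(1) e'(1), of 1 "-1"] by simp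
      also have "\<dots> = B w' e'" using w'(3)[of e'] e' by simp
      also have "\<dots> = B w' e" using CS[OF w'(1) r True] xr[OF w'(1)] by simp
      finally show ?thesis by (intro exI[of _ 0]) simp
    next
      case False
      then show ?thesis by (intro exI[of _ "(F e - B w' e) / B r r"]) (simp add: rr)
    qed
    then obtain s where s: "B w' e + s * B r e = F e" by blast
    define w where "w = comb 1 w' s r"
    have "B w v = F v" if v: "v \<in> V" for v
    proof -
      \<comment> \<open>Every \<open>v\<close> is an element \<open>v'\<close> of the kernel plus a
        multiple of \<open>e\<close>, so agreement on the kernel and at \<open>e\<close>
        suffices.\<close>
      define v' where "v' = comb 1 v (- lf i v) e"
      have v': "v' \<in> ?V" unfolding v'_def using comb[OF v e(1)] lin[OF _ v e(1), of i] e(2) by auto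
      have Bv': "B x v' = B x v - lf i v * B x e" if "x \<in> V" for x
        unfolding v'_def using sym[OF that comb[OF v e(1)], of 1 "- lf i v"] bil[OF v e(1) that, of 1 "- lf i v"]
          sym[OF that e(1)] sym[OF that v] by simp
      have Bw: "B w x = B w' x + s * B r x" if "x \<in> V" for x
        unfolding w_def using bil[OF w'(1) r that, of 1 s] by simp
      have "B w v' = F v'" using Bw[of v'] v' w'(3)[OF v'] rv[OF v'] by simp
      moreover have "F v' = F v - lf i v * F e"
        unfolding v'_def using Flin[OF v e(1), of 1 "- lf i v"] by simp
      moreover have "w \<in> V" unfolding w_def using comb w'(1) r by blast
      ultimately show ?thesis using Bv'[of w] Bw[OF e(1)] s by simp
    qed
    moreover have "w \<in> V" unfolding w_def using comb w'(1) r by blast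
    ultimately show ?thesis by blast
  qed
qed

section \<open>L2 inner products modulo null sets\<close>

lemma L2_measurable: "v \<in> L2 \<Omega> \<Longrightarrow> v \<in> borel_measurable (lebesgue_on \<Omega>)"
  and L2_square_integrable: "v \<in> L2 \<Omega> \<Longrightarrow> integrable (lebesgue_on \<Omega>) (\<lambda>x. (norm (v x))\<^sup>2)"
  by (auto simp: L2_def)

lemma L2_inner_integrable:
  fixes v w :: "real^2 \<Rightarrow> 'b::euclidean_space"
  assumes "v \<in> L2 \<Omega>" "w \<in> L2 \<Omega>"
  shows "integrable (lebesgue_on \<Omega>) (\<lambda>x. v x \<bullet> w x)"
proof (rule Bochner_Integration.integrable_bound)
  show "integrable (lebesgue_on \<Omega>) (\<lambda>x. (norm (v x))\<^sup>2 + (norm (w x))\<^sup>2)"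
    using assms by (intro Bochner_Integration.integrable_add L2_square_integrable)
  show "(\<lambda>x. v x \<bullet> w x) \<in> borel_measurable (lebesgue_on \<Omega>)"
    using assms[THEN L2_measurable] by (rule borel_measurable_inner)
  have "\<bar>a \<bullet> b\<bar> \<le> (norm a)\<^sup>2 + (norm b)\<^sup>2" for a b :: 'b
  proof -
    have "2 * (norm a * norm b) \<le> (norm a)\<^sup>2 + (norm b)\<^sup>2"
      using sum_squares_bound[of "norm a" "norm b"] by simp
    moreover have "norm a * norm b \<ge> 0" by simp
    ultimately show ?thesis using Cauchy_Schwarz_ineq2[of a b] by linarith
  qed
  then show "AE x in lebesgue_on \<Omega>. norm (v x \<bullet> w x) \<le> norm ((norm (v x))\<^sup>2 + (norm (w x))\<^sup>2)"
    by simp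
qed

lemma L2_scaleR: "v \<in> L2 \<Omega> \<Longrightarrow> (\<lambda>x. c *\<^sub>R v x) \<in> L2 \<Omega>"
  by (auto simp: L2_def power_mult_distrib)

lemma L2_add:
  assumes "v \<in> L2 \<Omega>" "w \<in> L2 \<Omega>"
  shows "(\<lambda>x. v x + w x) \<in> L2 \<Omega>"
proof -
  have "(\<lambda>x. (norm (v x + w x))\<^sup>2) = (\<lambda>x. (norm (v x))\<^sup>2 + 2 * (v x \<bullet> w x) + (norm (w x))\<^sup>2)"
    by (simp add: power2_norm_eq_inner inner_add_left inner_add_right inner_commute fun_eq_iff)
  then show ?thesis using assms L2_inner_integrable[OF assms]
    by (auto simp: L2_def intro!: Bochner_Integration.integrable_add)
qed

lemma L2_comb: "v \<in> L2 \<Omega> \<Longrightarrow> w \<in> L2 \<Omega> \<Longrightarrow> (\<lambda>x. c *\<^sub>R v x + d *\<^sub>R w x) \<in> L2 \<Omega>"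
  by (intro L2_add L2_scaleR)

lemma L2_diff: "v \<in> L2 \<Omega> \<Longrightarrow> w \<in> L2 \<Omega> \<Longrightarrow> (\<lambda>x. v x - w x) \<in> L2 \<Omega>"
  using L2_comb[of v \<Omega> w 1 "-1"] by simp

lemma L2_inner_comb_left:
  assumes "v \<in> L2 \<Omega>" "w \<in> L2 \<Omega>" "z \<in> L2 \<Omega>"
  shows "L2_inner \<Omega> (\<lambda>x. c *\<^sub>R v x + d *\<^sub>R w x) z = c * L2_inner \<Omega> v z + d * L2_inner \<Omega> w z"
proof -
  note i = L2_inner_integrable[OF assms(1,3)] L2_inner_integrable[OF assms(2,3)]
  show ?thesis unfolding L2_inner_def
    using i by (simp add: inner_add_left)
qed

lemma L2_inner_commute: "L2_inner \<Omega> v w = L2_inner \<Omega> w v"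
  by (simp add: L2_inner_def inner_commute)

lemma L2_inner_comb_right:
  assumes "v \<in> L2 \<Omega>" "w \<in> L2 \<Omega>" "z \<in> L2 \<Omega>"
  shows "L2_inner \<Omega> z (\<lambda>x. c *\<^sub>R v x + d *\<^sub>R w x) = c * L2_inner \<Omega> z v + d * L2_inner \<Omega> z w"
  using L2_inner_comb_left[OF assms] by (simp add: L2_inner_commute[of \<Omega> z])

lemma L2_inner_nonneg: "L2_inner \<Omega> v v \<ge> 0"
  by (simp add: L2_inner_def)

text \<open>Integrals ignore null sets once both integrands are measurable, which is what the four
  memberships in \<open>L2\<close> supply. This lets representatives be exchanged
  throughout.\<close>

lemma L2_inner_cong_AE:
  assumes "\<Omega> \<in> sets lebesgue" "v \<in> L2 \<Omega>" "w \<in> L2 \<Omega>" "v' \<in> L2 \<Omega>" "w' \<in> L2 \<Omega>"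
    and "AE x in lebesgue_on \<Omega>. v x = v' x" "AE x in lebesgue_on \<Omega>. w x = w' x"
  shows "L2_inner \<Omega> v w = L2_inner \<Omega> v' w'"
  unfolding L2_inner_def
proof (rule integral_cong_AE)
  show "(\<lambda>x. v x \<bullet> w x) \<in> borel_measurable (lebesgue_on \<Omega>)" "(\<lambda>x. v' x \<bullet> w' x) \<in> borel_measurable (lebesgue_on \<Omega>)"
    using assms(2-5)[THEN L2_measurable] by (auto intro: borel_measurable_inner)
  show "AE x in lebesgue_on \<Omega>. v x \<bullet> w x = v' x \<bullet> w' x" using assms(6,7) by eventually_elim simp
qed

lemma L2_inner_self_eq_0:
  assumes "v \<in> L2 \<Omega>" "L2_inner \<Omega> v v = 0"
  shows "AE x in lebesgue_on \<Omega>. v x = 0"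
proof -
  have "AE x in lebesgue_on \<Omega>. v x \<bullet> v x = 0"
    using assms integral_nonneg_eq_0_iff_AE[OF L2_inner_integrable[OF assms(1,1)]]
    by (simp add: L2_inner_def)
  then show ?thesis by simp
qed

text \<open>The product vanishes almost everywhere for an arbitrary \<open>w\<close>; in the
  decoupling this gives the continuity equation for every \<open>q\<close> at once.\<close>

lemma L2_inner_eq_0_AE:
  assumes "AE x in lebesgue_on \<Omega>. v x = 0"
  shows "L2_inner \<Omega> v w = 0"
proof -
  have "AE x in lebesgue_on \<Omega>. v x \<bullet> w x = 0" using assms by eventually_elim simp
  then show ?thesis unfolding L2_inner_def by (rule integral_eq_zero_AE)
qed

section \<open>Smooth functions and bump functions\<close>

lemma partial_eqI: "(v has_derivative D) (at x) \<Longrightarrow> partial i v x = D (axis i 1)"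
  unfolding partial_def using frechet_derivative_at by metis

lemma partial_comb:
  assumes "v differentiable (at x)" "w differentiable (at x)"
  shows "partial i (\<lambda>x. c *\<^sub>R v x + d *\<^sub>R w x) x = c *\<^sub>R partial i v x + d *\<^sub>R partial i w x"
proof -
  have "((\<lambda>x. c *\<^sub>R v x + d *\<^sub>R w x) has_derivative
      (\<lambda>h. c *\<^sub>R frechet_derivative v (at x) h + d *\<^sub>R frechet_derivative w (at x) h)) (at x)"
    by (intro derivative_intros) (use assms frechet_derivative_works in blast)+
  then show ?thesis by (subst partial_eqI) (auto simp: partial_def)
qed

lemma partial_mult:
  fixes v w :: "real^2 \<Rightarrow> real"
  assumes "v differentiable (at x)" "w differentiable (at x)"
  shows "partial i (\<lambda>x. v x * w x) x = v x * partial i w x + partial i v x * w x"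
proof -
  have "((\<lambda>x. v x * w x) has_derivative
      (\<lambda>h. v x * frechet_derivative w (at x) h + frechet_derivative v (at x) h * w x)) (at x)"
    by (intro has_derivative_mult) (use assms frechet_derivative_works in blast)+
  then show ?thesis by (subst partial_eqI) (auto simp: partial_def)
qed

lemma partial_local:
  assumes "eventually (\<lambda>y. v y = w y) (nhds x)"
  shows "partial i v x = partial i w x"
proof -
  obtain S where S: "open S" "x \<in> S" "\<And>y. y \<in> S \<Longrightarrow> v y = w y"
    using assms unfolding eventually_nhds by blast
  have "(v has_derivative D) (at x) \<longleftrightarrow> (w has_derivative D) (at x)" for D
    using has_derivative_transform_within_open[OF _ S(1,2), of v D UNIV w]
      has_derivative_transform_within_open[OF _ S(1,2), of w D UNIV v] S(3) by auto
  then show ?thesis unfolding partial_def frechet_derivative_def by simp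
qed

text \<open>\<open>smooth\<close> quantifies over all lists of derivatives. Exhibiting an invariant
  set of differentiable functions replaces the induction over such lists; each smoothness proof
  below chooses its own set \<open>A\<close>.\<close>

lemma smooth_closedI:
  assumes v: "v \<in> A" and diff: "\<And>v x. v \<in> A \<Longrightarrow> v differentiable (at x)"
    and closed: "\<And>v i. v \<in> A \<Longrightarrow> partial i v \<in> A"
  shows "smooth v"
  unfolding smooth_def
proof
  fix "is" :: "2 list"
  have "fold partial is v \<in> A" using v closed by (induction "is" arbitrary: v) auto
  then show "fold partial is v differentiable_on UNIV"
    using diff by (simp add: differentiable_on_def)
qed

lemma smooth_differentiable: "smooth v \<Longrightarrow> v differentiable (at x)"
  unfolding smooth_def differentiable_on_def by (metis UNIV_I fold_simps(1) id_apply)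

lemma smooth_partial: "smooth v \<Longrightarrow> smooth (partial i v)"
  unfolding smooth_def by (metis fold_simps(2))

lemma smooth_continuous: "smooth v \<Longrightarrow> continuous_on S v"
  using smooth_differentiable differentiable_imp_continuous_within
  by (metis continuous_at_imp_continuous_on)

text \<open>Closure under products: the derivatives of a product are sums of products.\<close>

inductive_set smooth_algebra :: "(real^2 \<Rightarrow> real) set" where
  smooth: "smooth v \<Longrightarrow> v \<in> smooth_algebra"
| comb: "v \<in> smooth_algebra \<Longrightarrow> w \<in> smooth_algebra \<Longrightarrow> (\<lambda>x. c * v x + d * w x) \<in> smooth_algebra"
| mult: "v \<in> smooth_algebra \<Longrightarrow> w \<in> smooth_algebra \<Longrightarrow> (\<lambda>x. v x * w x) \<in> smooth_algebra"

lemma smooth_algebra_differentiable: "v \<in> smooth_algebra \<Longrightarrow> v differentiable (at x)"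
  by (induction rule: smooth_algebra.induct) (auto intro: smooth_differentiable)

lemma smooth_algebra_partial: "v \<in> smooth_algebra \<Longrightarrow> partial i v \<in> smooth_algebra"
proof (induction rule: smooth_algebra.induct)
  case (smooth v)
  then show ?case by (intro smooth_algebra.smooth smooth_partial)
next
  case (comb v w c d)
  have "partial i (\<lambda>x. c * v x + d * w x) = (\<lambda>x. c * partial i v x + d * partial i w x)"
    using partial_comb[OF smooth_algebra_differentiable smooth_algebra_differentiable, OF comb(1,2), of i c d]
    by (simp add: fun_eq_iff)
  then show ?case using comb smooth_algebra.comb by metis
next
  case (mult v w)
  have "partial i (\<lambda>x. v x * w x) = (\<lambda>x. 1 * (v x * partial i w x) + 1 * (partial i v x * w x))"
    using partial_mult[OF smooth_algebra_differentiable smooth_algebra_differentiable, OF mult(1,2), of i]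
    by (simp add: fun_eq_iff)
  then show ?case
    using smooth_algebra.comb[OF smooth_algebra.mult smooth_algebra.mult, OF mult(1) mult(4) mult(3) mult(2)]
    by metis
qed

lemma smooth_algebra_smooth: "v \<in> smooth_algebra \<Longrightarrow> smooth v"
  using smooth_closedI smooth_algebra_differentiable smooth_algebra_partial by blast

lemma smooth_comb: "smooth v \<Longrightarrow> smooth w \<Longrightarrow> smooth (\<lambda>x. c * v x + d * w x)"
  by (rule smooth_algebra_smooth[OF smooth_algebra.comb[OF smooth_algebra.smooth smooth_algebra.smooth]])

lemma smooth_mult: "smooth v \<Longrightarrow> smooth w \<Longrightarrow> smooth (\<lambda>x. v x * w x)"
  by (rule smooth_algebra_smooth[OF smooth_algebra.mult[OF smooth_algebra.smooth smooth_algebra.smooth]])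

lemma smooth_coordinate: "smooth (\<lambda>x. x $ j)"
proof (rule smooth_closedI)
  let ?A = "insert (\<lambda>x. x $ j) (range (\<lambda>c (x::real^2). c))"
  show "(\<lambda>x. x $ j) \<in> ?A" by simp
  have d: "((\<lambda>x::real^2. x $ j) has_derivative (\<lambda>h. h $ j)) (at x)" for x
    by (intro bounded_linear_imp_has_derivative bounded_linear_vec_nth)
  show "v differentiable (at x)" if "v \<in> ?A" for v x
    using that d differentiableI by (auto intro: differentiable_const)
  show "partial i v \<in> ?A" if "v \<in> ?A" for v i
  proof -
    have "partial i (\<lambda>x::real^2. x $ j) = (\<lambda>x. axis i 1 $ j)" using partial_eqI[OF d] by blast
    moreover have "partial i (\<lambda>x::real^2. c) = (\<lambda>x. 0)" for c :: real
      using partial_eqI[OF has_derivative_const] by blast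
    ultimately show ?thesis using that by auto
  qed
qed

text \<open>The derivatives of \<open>exp (- \<delta> / t)\<close> on the positive half line are combinations of these.\<close>

definition flat_exp :: "real \<Rightarrow> nat \<Rightarrow> real \<Rightarrow> real" where
  "flat_exp \<delta> k t = (if t > 0 then exp (- \<delta> / t) / t ^ k else 0)"

text \<open>With \<open>s = \<delta> / h\<close> the limit from the right is that of
  \<open>s ^ k / exp s\<close>, divided by \<open>\<delta> ^ k\<close>; the exponential beats every
  power. From the left the function is zero.\<close>

lemma flat_exp_tendsto_0:
  assumes "\<delta> > 0"
  shows "(flat_exp \<delta> k \<longlongrightarrow> 0) (at 0)"
proof -
  have "filterlim (\<lambda>h. \<delta> * inverse h) at_top (at_right 0)"
    by (intro filterlim_tendsto_pos_mult_at_top[OF tendsto_const assms] filterlim_inverse_at_top_right)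
  then have "((\<lambda>h. (\<delta> * inverse h) ^ k / exp (\<delta> * inverse h)) \<longlongrightarrow> 0) (at_right 0)"
    by (rule filterlim_compose[OF tendsto_power_div_exp_0])
  then have "((\<lambda>h. (\<delta> * inverse h) ^ k / exp (\<delta> * inverse h) / \<delta> ^ k) \<longlongrightarrow> 0 / \<delta> ^ k) (at_right 0)"
    using assms by (intro tendsto_intros) auto
  then have "((\<lambda>h. (\<delta> * inverse h) ^ k / exp (\<delta> * inverse h) / \<delta> ^ k) \<longlongrightarrow> 0) (at_right 0)"
    by simp
  moreover have "eventually (\<lambda>h. (\<delta> * inverse h) ^ k / exp (\<delta> * inverse h) / \<delta> ^ k = flat_exp \<delta> k h) (at_right 0)"
    unfolding eventually_at_right_field
    using assms by (intro exI[of _ 1]) (auto simp: flat_exp_def exp_minus field_simps)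
  ultimately have r: "(flat_exp \<delta> k \<longlongrightarrow> 0) (at_right 0)"
    by (rule Lim_transform_eventually)
  have "eventually (\<lambda>h. 0 = flat_exp \<delta> k h) (at_left 0)"
    unfolding eventually_at_left_field by (intro exI[of _ "-1"]) (auto simp: flat_exp_def)
  then have "(flat_exp \<delta> k \<longlongrightarrow> 0) (at_left 0)" by (rule Lim_transform_eventually[OF tendsto_const])
  with r show ?thesis by (simp add: filterlim_split_at)
qed

lemma flat_exp_deriv:
  assumes "\<delta> > 0"
  shows "(flat_exp \<delta> k has_real_derivative
    \<delta> * flat_exp \<delta> (k + 2) t + - real k * flat_exp \<delta> (k + 1) t) (at t)"
proof -
  consider "t > 0" | "t < 0" | "t = 0" by linarith
  then show ?thesis
  proof cases
    case 1
    have "((\<lambda>t. exp (- \<delta> / t) / t ^ k) has_real_derivative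
        \<delta> * flat_exp \<delta> (k + 2) t + - real k * flat_exp \<delta> (k + 1) t) (at t)"
    proof -
      have "((\<lambda>t. exp (- \<delta> / t)) has_real_derivative exp (- \<delta> / t) * (\<delta> / t\<^sup>2)) (at t)"
        using 1 by (auto intro!: derivative_eq_intros simp: power2_eq_square)
      moreover have "((\<lambda>t. t ^ k) has_real_derivative real k * t ^ (k - 1)) (at t)"
        using DERIV_pow[of k t] by simp
      ultimately have "((\<lambda>t. exp (- \<delta> / t) / t ^ k) has_real_derivative
          (exp (- \<delta> / t) * (\<delta> / t\<^sup>2) * t ^ k - exp (- \<delta> / t) * (real k * t ^ (k - 1))) / (t ^ k * t ^ k)) (at t)"
        by (rule DERIV_divide) (use 1 in simp)
      moreover have "(exp (- \<delta> / t) * (\<delta> / t\<^sup>2) * t ^ k - exp (- \<delta> / t) * (real k * t ^ (k - 1))) / (t ^ k * t ^ k)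
          = \<delta> * flat_exp \<delta> (k + 2) t + - real k * flat_exp \<delta> (k + 1) t"
        using 1 by (cases k) (simp_all add: flat_exp_def field_simps power2_eq_square)
      ultimately show ?thesis by simp
    qed
    then show ?thesis
      by (rule has_field_derivative_transform_within_open[of _ _ _ "{0<..}"])
        (use 1 in \<open>auto simp: flat_exp_def\<close>)
  next
    case 2
    have "((\<lambda>t::real. 0) has_real_derivative 0) (at t)" by simp
    then have "(flat_exp \<delta> k has_real_derivative 0) (at t)"
      by (rule has_field_derivative_transform_within_open[of _ _ _ "{..<0}"])
        (use 2 in \<open>auto simp: flat_exp_def\<close>)
    then show ?thesis using 2 by (simp add: flat_exp_def)
  next
    case 3
    \<comment> \<open>At the origin the difference quotient is again a flat exponential, with the
      exponent raised by one, so its limit is already known.\<close>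
    have eq: "(flat_exp \<delta> k (0 + h) - flat_exp \<delta> k 0) / h = flat_exp \<delta> (k + 1) h" for h
      by (simp add: flat_exp_def)
    show ?thesis unfolding 3 DERIV_def eq
      using flat_exp_tendsto_0[OF assms, of "k + 1"]
      by (simp add: flat_exp_def[of \<delta> "k + 1" 0] flat_exp_def[of \<delta> "Suc k" 0] flat_exp_def[of \<delta> "Suc (Suc k)" 0] flat_exp_def[of \<delta> "k + 2" 0])
  qed
qed

text \<open>The derivative of one ridge is a combination of two, with exponents \<open>k + 1\<close>
  and \<open>k + 2\<close>. The invariant set therefore consists of combinations, with
  \<open>k\<close> free and \<open>\<delta>\<close>, the scale \<open>s\<close>, the shift
  \<open>c\<close> and the direction \<open>j\<close> fixed.\<close>

inductive_set flat_exp_ridges :: "real \<Rightarrow> real \<Rightarrow> real \<Rightarrow> 2 \<Rightarrow> (real^2 \<Rightarrow> real) set"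
  for \<delta> s c :: real and j :: 2 where
  base: "(\<lambda>x. flat_exp \<delta> k (s * x $ j + c)) \<in> flat_exp_ridges \<delta> s c j"
| comb: "v \<in> flat_exp_ridges \<delta> s c j \<Longrightarrow> w \<in> flat_exp_ridges \<delta> s c j \<Longrightarrow>
    (\<lambda>x. a * v x + b * w x) \<in> flat_exp_ridges \<delta> s c j"

lemma smooth_flat_exp_ridge:
  assumes "\<delta> > 0"
  shows "smooth (\<lambda>x. flat_exp \<delta> k (s * x $ j + c))"
proof (rule smooth_closedI)
  let ?A = "flat_exp_ridges \<delta> s c j"
  show "(\<lambda>x. flat_exp \<delta> k (s * x $ j + c)) \<in> ?A" by (rule flat_exp_ridges.base)
  have d: "((\<lambda>x::real^2. flat_exp \<delta> k (s * x $ j + c)) has_derivative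
     (\<lambda>h. (\<delta> * flat_exp \<delta> (k + 2) (s * x $ j + c) + - real k * flat_exp \<delta> (k + 1) (s * x $ j + c)) * (s * h $ j))) (at x)" for x k
  proof -
    have "((\<lambda>x::real^2. s * x $ j + c) has_derivative (\<lambda>h. s * h $ j)) (at x)"
      by (auto intro!: derivative_eq_intros bounded_linear_imp_has_derivative bounded_linear_vec_nth)
    from has_derivative_compose[OF this flat_exp_deriv[OF assms, of k, unfolded has_field_derivative_def]]
    show ?thesis by simp
  qed
  show diff: "v differentiable (at x)" if "v \<in> ?A" for v x
    using that
  proof induction
    case (base k)
    show ?case using d by (rule differentiableI)
  next
    case (comb v w a b)
    then show ?case by (intro differentiable_add differentiable_mult differentiable_const)
  qed
  show "partial i v \<in> ?A" if "v \<in> ?A" for v i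
    using that
  proof induction
    case (base k)
    have "partial i (\<lambda>x::real^2. flat_exp \<delta> k (s * x $ j + c)) =
       (\<lambda>x. (\<delta> * (s * axis i 1 $ j)) * flat_exp \<delta> (k + 2) (s * x $ j + c)
          + (- real k * (s * axis i 1 $ j)) * flat_exp \<delta> (k + 1) (s * x $ j + c))"
      using partial_eqI[OF d] by (auto simp: fun_eq_iff algebra_simps)
    then show ?case by (simp only:) (rule flat_exp_ridges.comb[OF flat_exp_ridges.base flat_exp_ridges.base])
  next
    case (comb v w a b)
    have "partial i (\<lambda>x. a * v x + b * w x) = (\<lambda>x. a * partial i v x + b * partial i w x)"
      using partial_comb[OF diff diff, OF comb(1,2), of i a b] by (simp add: fun_eq_iff)
    then show ?case by (simp only:) (rule flat_exp_ridges.comb[OF comb(3,4)])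
  qed
qed

text \<open>Each factor is positive exactly on one side of a face of the box. The unsimplified
  arguments such as \<open>1 * x $ 1 + - a $ 1\<close> have the form \<open>s * x $ j + c\<close> of
  the ridges. As \<open>\<delta>\<close> tends to zero, the product tends pointwise to the indicator
  of the open box, bounded by 1.\<close>

definition box_bump :: "real \<Rightarrow> real^2 \<Rightarrow> real^2 \<Rightarrow> real^2 \<Rightarrow> real" where
  "box_bump \<delta> a b x =
    (flat_exp \<delta> 0 (1 * x $ 1 + - a $ 1) * flat_exp \<delta> 0 (-1 * x $ 1 + b $ 1)) *
    (flat_exp \<delta> 0 (1 * x $ 2 + - a $ 2) * flat_exp \<delta> 0 (-1 * x $ 2 + b $ 2))"

lemma mem_box_2: "x \<in> box a b \<longleftrightarrow> a $ 1 < x $ 1 \<and> x $ 1 < b $ 1 \<and> a $ 2 < x $ 2 \<and> x $ 2 < b $ 2"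
  for x :: "real^2"
  by (auto simp: mem_box_cart forall_2)

lemma box_bump_nz: "box_bump \<delta> a b x \<noteq> 0 \<longleftrightarrow> x \<in> box a b"
  by (auto simp: box_bump_def flat_exp_def mem_box_2)

lemma box_bump_bound:
  assumes "\<delta> > 0"
  shows "\<bar>box_bump \<delta> a b x\<bar> \<le> 1"
proof -
  have f: "0 \<le> flat_exp \<delta> 0 t \<and> flat_exp \<delta> 0 t \<le> 1" for t using assms by (simp add: flat_exp_def)
  have "0 \<le> box_bump \<delta> a b x" unfolding box_bump_def using f by (intro mult_nonneg_nonneg) auto
  moreover have "box_bump \<delta> a b x \<le> 1" unfolding box_bump_def
    using f by (intro mult_le_one mult_nonneg_nonneg) auto
  ultimately show ?thesis by simp
qed

lemma box_bump_tendsto: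
  "(\<lambda>n. box_bump (1 / Suc n) a b x) \<longlonglongrightarrow> indicator (box a b) x"
proof (cases "x \<in> box a b")
  case True
  have f: "(\<lambda>n. flat_exp (1 / Suc n) 0 t) \<longlonglongrightarrow> 1" if "t > 0" for t
  proof -
    have z: "(\<lambda>n. 1 / real (Suc n)) \<longlonglongrightarrow> 0" using LIMSEQ_inverse_real_of_nat by (simp add: inverse_eq_divide)
    have "(\<lambda>n. exp (- (1 / real (Suc n)) / t)) \<longlonglongrightarrow> exp (- 0 / t)"
      using that by (intro tendsto_intros z) auto
    then show ?thesis using that by (simp add: flat_exp_def)
  qed
  have "(\<lambda>n. box_bump (1 / Suc n) a b x) \<longlonglongrightarrow> (1 * 1) * (1 * 1)"
    unfolding box_bump_def using True by (intro tendsto_mult f) (auto simp: mem_box_2)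
  then show ?thesis using True by simp
next
  case False
  then have "box_bump \<delta> a b x = 0" for \<delta> using box_bump_nz by blast
  then show ?thesis using False by simp
qed

lemma box_bump_test_function:
  assumes "\<delta> > 0" "cbox a b \<subseteq> \<Omega>"
  shows "box_bump \<delta> a b \<in> test_functions \<Omega>"
proof -
  have "smooth (box_bump \<delta> a b)"
    unfolding box_bump_def by (intro smooth_mult smooth_flat_exp_ridge assms)
  moreover have s: "{x. box_bump \<delta> a b x \<noteq> 0} = box a b" using box_bump_nz by blast
  have "closure (box a b) \<subseteq> cbox a b" by (rule closure_minimal[OF box_subset_cbox closed_cbox])
  then have "compact (closure {x. box_bump \<delta> a b x \<noteq> 0}) \<and> closure {x. box_bump \<delta> a b x \<noteq> 0} \<subseteq> \<Omega>"
    unfolding s using assms(2) by (auto simp: compact_closure)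
  ultimately show ?thesis by (simp add: test_functions_def)
qed

section \<open>Weak gradients\<close>

lemma L2_bounded:
  assumes "\<Omega> \<in> lmeasurable" "v \<in> borel_measurable (lebesgue_on \<Omega>)" "\<And>x. x \<in> \<Omega> \<Longrightarrow> norm (v x) \<le> M"
  shows "v \<in> L2 \<Omega>"
proof -
  interpret finite_measure "lebesgue_on \<Omega>" using assms(1) finite_measure_lebesgue_on by blast
  have "integrable (lebesgue_on \<Omega>) (\<lambda>x. (norm (v x))\<^sup>2)"
  proof (rule integrable_const_bound[where B = "M\<^sup>2"])
    show "AE x in lebesgue_on \<Omega>. norm ((norm (v x))\<^sup>2) \<le> M\<^sup>2"
      by (rule AE_I2) (use assms(3) power_mono[of "norm (v _)" M 2] in auto)
  qed (use assms(2) in measurable)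
  then show ?thesis using assms(2) by (simp add: L2_def)
qed

lemma bounded_open_lmeasurable: "open \<Omega> \<Longrightarrow> bounded \<Omega> \<Longrightarrow> \<Omega> \<in> lmeasurable"
  for \<Omega> :: "(real^2) set"
  using bounded_set_imp_lmeasurable[of \<Omega>] by (simp add: borel_open)

lemma L2_continuous_bounded:
  assumes "open \<Omega>" "bounded \<Omega>" "continuous_on UNIV v"
  shows "v \<in> L2 \<Omega>"
proof -
  have "compact (v ` closure \<Omega>)"
    by (intro compact_continuous_image) (use assms continuous_on_subset compact_closure in auto)
  then obtain M where "\<And>y. y \<in> v ` closure \<Omega> \<Longrightarrow> norm y \<le> M"
    using compact_imp_bounded bounded_iff by metis
  then have "norm (v x) \<le> M" if "x \<in> \<Omega>" for x using that closure_subset by blast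
  moreover have "v \<in> borel_measurable (lebesgue_on \<Omega>)"
    by (rule continuous_imp_measurable_on_sets_lebesgue)
      (use assms continuous_on_subset borel_open in auto)
  ultimately show ?thesis using L2_bounded bounded_open_lmeasurable assms by blast
qed

lemma box_Int_box_2:
  fixes a b c d :: "real^2"
  obtains e f where "box a b \<inter> box c d = box e f"
proof -
  let ?e = "vector [max (a$1) (c$1), max (a$2) (c$2)] :: real^2"
  let ?f = "vector [min (b$1) (d$1), min (b$2) (d$2)] :: real^2"
  have "box a b \<inter> box c d = box ?e ?f" by (auto simp: mem_box_2)
  then show ?thesis using that by blast
qed

text \<open>Dominated convergence turns bumps into indicators, so \<open>g\<close> integrates to
  zero over every box whose closure lies in the domain. Boxes are stable under intersection and
  generate the Borel sets; hence the density vanishes on each such box, and countably many boxes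
  cover the domain.\<close>

lemma fundamental_lemma:
  fixes g :: "real^2 \<Rightarrow> real"
  assumes \<Omega>: "open \<Omega>" "bounded \<Omega>" and g: "g \<in> L2 \<Omega>"
    and orth: "\<And>\<theta>. \<theta> \<in> test_functions \<Omega> \<Longrightarrow> L2_inner \<Omega> g \<theta> = 0"
  shows "AE x in lebesgue_on \<Omega>. g x = 0"
proof -
  have ms: "\<Omega> \<inter> space lebesgue \<in> sets lebesgue" using \<Omega> by (simp add: borel_open)
  have "integrable (lebesgue_on \<Omega>) (\<lambda>x. g x \<bullet> 1)"
    by (rule L2_inner_integrable[OF g L2_continuous_bounded[OF \<Omega>]]) simp
  then have "integrable (lebesgue_on \<Omega>) g" by simp
  then have "integrable lebesgue (\<lambda>x. indicator \<Omega> x *\<^sub>R g x)"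
    using integrable_restrict_space[OF ms, of g] by blast
  then have hm: "(\<lambda>x. indicator \<Omega> x *\<^sub>R g x) \<in> borel_measurable lebesgue" and hi: "integrable lebesgue (\<lambda>x. indicator \<Omega> x *\<^sub>R g x)"
    by auto
  \<comment> \<open>\<open>g\<close> is only Lebesgue measurable. A Borel representative gives
    access to \<open>lborel\<close> and to generators of the Borel sets.\<close>
  obtain k where k: "k \<in> borel_measurable lborel" "AE x in lborel. indicator \<Omega> x *\<^sub>R g x = k x"
    using completion_ex_borel_measurable_real[OF hm] by blast
  have kAE: "AE x in lebesgue. indicator \<Omega> x *\<^sub>R g x = k x" by (rule AE_completion[OF k(2)])
  have kml: "k \<in> borel_measurable lebesgue" using k(1) by (simp add: measurable_completion)
  have "integrable lebesgue k" using integrable_cong_AE[OF hm kml kAE] hi by simp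
  then have ki: "integrable lborel k" using integrable_completion[OF k(1)] by simp
  have bump: "(LINT x|lborel. k x * indicator (box a b) x) = 0" if ab: "cbox a b \<subseteq> \<Omega>" for a b
  proof -
    let ?\<theta> = "\<lambda>n. box_bump (1 / Suc n) a b"
    have t: "?\<theta> n \<in> test_functions \<Omega>" for n by (rule box_bump_test_function[OF _ ab]) simp
    have c: "continuous_on UNIV (?\<theta> n)" for n
      using t[of n] smooth_continuous by (simp add: test_functions_def)
    have \<theta>m: "?\<theta> n \<in> borel_measurable borel" for n using c by (rule borel_measurable_continuous_onI)
    have z: "(LINT x|lborel. k x * ?\<theta> n x) = 0" for n
    proof -
      have "0 = L2_inner \<Omega> g (?\<theta> n)" using orth[OF t[of n]] by simp
      also have "\<dots> = (LINT x|lebesgue. indicator \<Omega> x *\<^sub>R (g x \<bullet> ?\<theta> n x))"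
        unfolding L2_inner_def by (rule integral_restrict_space[OF ms])
      also have "\<dots> = (LINT x|lebesgue. k x * ?\<theta> n x)"
      proof (rule integral_cong_AE)
        have tl: "?\<theta> n \<in> borel_measurable lebesgue" using \<theta>m by (simp add: measurable_completion)
        show "(\<lambda>x. k x * ?\<theta> n x) \<in> borel_measurable lebesgue" using kml tl by measurable
        have "(\<lambda>x. (indicator \<Omega> x *\<^sub>R g x) * ?\<theta> n x) \<in> borel_measurable lebesgue" using hm tl by measurable
        then show "(\<lambda>x. indicator \<Omega> x *\<^sub>R (g x \<bullet> ?\<theta> n x)) \<in> borel_measurable lebesgue" by (simp add: mult.assoc)
        show "AE x in lebesgue. indicator \<Omega> x *\<^sub>R (g x \<bullet> ?\<theta> n x) = k x * ?\<theta> n x"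
          using kAE by eventually_elim (simp add: mult.assoc[symmetric])
      qed
      also have "\<dots> = (LINT x|lborel. k x * ?\<theta> n x)"
        by (rule integral_completion) (use k(1) \<theta>m in measurable)
      finally show ?thesis by simp
    qed
    have "(\<lambda>n. LINT x|lborel. k x * ?\<theta> n x) \<longlonglongrightarrow> (LINT x|lborel. k x * indicator (box a b) x)"
    proof (rule integral_dominated_convergence[where w = "\<lambda>x. \<bar>k x\<bar>"])
      show "integrable lborel (\<lambda>x. \<bar>k x\<bar>)" using ki by simp
      show "(\<lambda>x. k x * indicator (box a b) x) \<in> borel_measurable lborel" using k(1) by measurable
      show "(\<lambda>x. k x * ?\<theta> n x) \<in> borel_measurable lborel" for n using k(1) \<theta>m by measurable
      show "AE x in lborel. (\<lambda>n. k x * ?\<theta> n x) \<longlonglongrightarrow> k x * indicator (box a b) x"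
        by (intro AE_I2 tendsto_intros box_bump_tendsto)
      have "\<bar>k x\<bar> * \<bar>?\<theta> n x\<bar> \<le> \<bar>k x\<bar> * 1" for n x by (intro mult_left_mono box_bump_bound) auto
      then show "AE x in lborel. norm (k x * ?\<theta> n x) \<le> \<bar>k x\<bar>" for n by (simp add: abs_mult)
    qed
    then show ?thesis unfolding z using LIMSEQ_unique tendsto_const by blast
  qed
  have box0: "AE x in lborel. x \<in> box a b \<longrightarrow> k x = 0" if ab: "cbox a b \<subseteq> \<Omega>" for a b
  proof -
    \<comment> \<open>After this cut-off, an integral over any box is one over an intersection of
      boxes, which again has its closure inside the domain.\<close>
    let ?k = "\<lambda>x. indicator (box a b) x *\<^sub>R k x"
    have \<kappa>i: "integrable lborel ?k" by (rule integrable_mult_indicator[OF _ ki]) simp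
    have si: "set_integrable lborel A ?k" if "A \<in> sets borel" for A
      unfolding set_integrable_def by (rule integrable_mult_indicator[OF _ \<kappa>i]) (use that in simp)
    have bas: "set_lebesgue_integral lborel (box c d) ?k = 0" for c d
    proof -
      obtain e f where ef: "box a b \<inter> box c d = box e f" using box_Int_box_2 by blast
      have eq: "set_lebesgue_integral lborel (box c d) ?k = (LINT x|lborel. k x * indicator (box e f) x)"
        unfolding set_lebesgue_integral_def ef[symmetric]
        by (intro Bochner_Integration.integral_cong) (auto simp: indicator_def)
      show ?thesis
      proof (cases "box e f = {}")
        case True
        then show ?thesis unfolding eq by simp
      next
        case False
        have "cbox e f = closure (box e f)" using closure_box[OF False] by simp
        also have "\<dots> \<subseteq> cbox a b" unfolding ef[symmetric]
          by (rule closure_minimal) (use box_subset_cbox[of a b] in auto)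
        finally show ?thesis unfolding eq using bump ab by blast
      qed
    qed
    have all: "set_lebesgue_integral lborel A ?k = 0" if A: "A \<in> sets borel" for A
    proof -
      let ?G = "range (\<lambda>(a, b). box a b :: (real^2) set)"
      have "Int_stable ?G"
      proof (rule Int_stableI)
        fix A B assume "A \<in> ?G" "B \<in> ?G"
        then obtain a b c d where "A = box a b" "B = box c d" by auto
        moreover obtain e f where "box a b \<inter> box c d = box e f" using box_Int_box_2 by blast
        ultimately show "A \<inter> B \<in> ?G" by auto
      qed
      moreover have "?G \<subseteq> Pow UNIV" by simp
      moreover have sb: "sets borel = sigma_sets UNIV ?G" by (subst borel_eq_box) simp
      then have "A \<in> sigma_sets UNIV ?G" using A by simp
      ultimately show ?thesis
      proof (induction rule: sigma_sets_induct_disjoint)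
        case (basic A)
        then show ?case using bas by auto
      next
        case empty
        then show ?case by (simp add: set_lebesgue_integral_def)
      next
        case (compl A)
        have Ab: "A \<in> sets borel" using compl(1) sb by simp
        have "set_lebesgue_integral lborel (A \<union> (UNIV - A)) ?k =
            set_lebesgue_integral lborel A ?k + set_lebesgue_integral lborel (UNIV - A) ?k"
          by (rule set_integral_Un) (use si Ab in auto)
        \<comment> \<open>The integral over the whole plane is the one over \<open>box a b\<close>,
          hence zero; this settles complements.\<close>
        moreover have "set_lebesgue_integral lborel (A \<union> (UNIV - A)) ?k = 0"
        proof -
          have "set_lebesgue_integral lborel (A \<union> (UNIV - A)) ?k = set_lebesgue_integral lborel (box a b) ?k"
            unfolding set_lebesgue_integral_def
            by (intro Bochner_Integration.integral_cong) (auto simp: indicator_def)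
          then show ?thesis using bas by simp
        qed
        ultimately show ?case using compl by simp
      next
        case (union A)
        have Ab: "A i \<in> sets borel" for i using union(2) sb by auto
        have "set_lebesgue_integral lborel (\<Union>i. A i) ?k = (\<Sum>i. set_lebesgue_integral lborel (A i) ?k)"
          by (rule lebesgue_integral_countable_add)
            (use Ab si union(1) in \<open>auto simp: disjoint_family_on_def\<close>)
        then show ?case using union(3) by simp
      qed
    qed
    have "AE x in lborel. ?k x = 0"
      by (rule sigma_finite_measure.density_zero[OF sigma_finite_lborel \<kappa>i]) (use all in simp)
    then show ?thesis by eventually_elim (auto simp: indicator_def)
  qed
  \<comment> \<open>An open set is a countable union of closed boxes, and the faces of these boxes
    form null sets.\<close>
  obtain D where D: "countable D" "\<And>X. X \<in> D \<Longrightarrow> \<exists>a b. X = cbox a b" "\<Union>D = \<Omega>" "D \<subseteq> Pow \<Omega>"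
    using open_countable_Union_open_cbox[OF \<Omega>(1)] by metis
  have "AE x in lebesgue. \<forall>X\<in>D. x \<in> X \<longrightarrow> k x = 0"
  proof (subst AE_ball_countable[OF D(1)], intro ballI)
    fix X assume X: "X \<in> D"
    then obtain a b where ab: "X = cbox a b" using D by blast
    have "AE x in lebesgue. x \<in> box a b \<longrightarrow> k x = 0"
      by (rule AE_completion[OF box0]) (use X D(4) ab in blast)
    moreover have "cbox a b - box a b \<in> null_sets lebesgue"
      using negligible_frontier_interval[of a b] negligible_iff_null_sets by blast
    then have "AE x in lebesgue. x \<notin> cbox a b - box a b" by (rule AE_not_in)
    ultimately show "AE x in lebesgue. x \<in> X \<longrightarrow> k x = 0" unfolding ab by eventually_elim auto
  qed
  then have "AE x in lebesgue. x \<in> \<Omega> \<longrightarrow> g x = 0"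
    using kAE by eventually_elim (use D(3) in \<open>auto simp: indicator_def\<close>)
  then show ?thesis using AE_restrict_space_iff[OF ms] by blast
qed

lemma L2_component:
  assumes "g \<in> L2 \<Omega>"
  shows "(\<lambda>x. (g x :: real^2) $ i) \<in> L2 \<Omega>"
proof -
  have m: "(\<lambda>x. g x $ i) \<in> borel_measurable (lebesgue_on \<Omega>)"
    using L2_measurable[OF assms] borel_measurable_nth measurable_compose by blast
  have "integrable (lebesgue_on \<Omega>) (\<lambda>x. (norm (g x $ i))\<^sup>2)"
    by (rule Bochner_Integration.integrable_bound[OF L2_square_integrable[OF assms]])
      (use m in \<open>auto intro!: AE_I2 power_mono simp: abs_le_square_iff[symmetric] component_le_norm_cart\<close>)
  with m show ?thesis by (simp add: L2_def)
qed

lemma zero_off_support: "x \<notin> closure {x. f x \<noteq> 0} \<Longrightarrow> f x = 0"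
  using closure_subset[of "{x. f x \<noteq> 0}"] by auto

lemma test_function_smooth: "\<theta> \<in> test_functions \<Omega> \<Longrightarrow> smooth \<theta>"
  by (simp add: test_functions_def)

lemma test_functionI:
  assumes "\<theta> \<in> test_functions \<Omega>" "smooth \<zeta>" "\<And>x. x \<notin> closure {x. \<theta> x \<noteq> 0} \<Longrightarrow> \<zeta> x = 0"
  shows "\<zeta> \<in> test_functions \<Omega>"
proof -
  have sub: "closure {x. \<zeta> x \<noteq> 0} \<subseteq> closure {x. \<theta> x \<noteq> 0}"
    by (rule closure_minimal) (use assms(3) in auto)
  have c: "compact (closure {x. \<theta> x \<noteq> 0})" "closure {x. \<theta> x \<noteq> 0} \<subseteq> \<Omega>"
    using assms(1) by (auto simp: test_functions_def)
  from sub have "compact (closure {x. \<zeta> x \<noteq> 0})"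
    using closed_Int_compact[OF closed_closure[of "{x. \<zeta> x \<noteq> 0}"] c(1)] by (simp add: Int_absorb2)
  then show ?thesis using assms(2) c(2) sub by (auto simp: test_functions_def)
qed

lemma test_function_partial:
  assumes "\<theta> \<in> test_functions \<Omega>"
  shows "partial i \<theta> \<in> test_functions \<Omega>"
proof (rule test_functionI[OF assms smooth_partial[OF test_function_smooth[OF assms]]])
  fix x assume x: "x \<notin> closure {x. \<theta> x \<noteq> 0}"
  have "eventually (\<lambda>y. y \<in> - closure {x. \<theta> x \<noteq> 0}) (nhds x)"
    by (rule eventually_nhds_in_open) (use x in auto)
  then have "eventually (\<lambda>y. \<theta> y = 0) (nhds x)"
    by (rule eventually_mono) (rule zero_off_support, simp)
  then have "partial i \<theta> x = partial i (\<lambda>x. 0) x" by (rule partial_local)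
  then show "partial i \<theta> x = 0" using partial_eqI[OF has_derivative_const[of 0]] by metis
qed

lemma test_function_comb:
  assumes "\<theta> \<in> test_functions \<Omega>" "\<zeta> \<in> test_functions \<Omega>"
  shows "(\<lambda>x. c * \<theta> x + d * \<zeta> x) \<in> test_functions \<Omega>"
proof -
  let ?f = "\<lambda>x. c * \<theta> x + d * \<zeta> x"
  let ?S = "closure {x. \<theta> x \<noteq> 0} \<union> closure {x. \<zeta> x \<noteq> 0}"
  have "x \<in> ?S" if "?f x \<noteq> 0" for x
    using that zero_off_support[of x \<theta>] zero_off_support[of x \<zeta>] by fastforce
  then have "{x. ?f x \<noteq> 0} \<subseteq> ?S" by blast
  then have "closure {x. ?f x \<noteq> 0} \<subseteq> ?S"
    by (rule closure_minimal) (intro closed_Un closed_closure)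
  moreover have "compact ?S" "?S \<subseteq> \<Omega>" using assms by (auto simp: test_functions_def)
  ultimately have "compact (closure {x. ?f x \<noteq> 0})" "closure {x. ?f x \<noteq> 0} \<subseteq> \<Omega>"
    using compact_Int_closed[of ?S "closure {x. ?f x \<noteq> 0}"] by (auto simp: Int_absorb1)
  then show ?thesis using assms by (simp add: test_functions_def smooth_comb)
qed

context
  fixes \<Omega> :: "(real^2) set"
  assumes \<Omega>: "open \<Omega>" "bounded \<Omega>"
begin

lemma lebesgue_domain: "\<Omega> \<in> sets lebesgue"
  using \<Omega> by (simp add: borel_open)

lemma test_function_L2: "\<theta> \<in> test_functions \<Omega> \<Longrightarrow> \<theta> \<in> L2 \<Omega>"
  by (intro L2_continuous_bounded \<Omega> smooth_continuous test_function_smooth)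

lemma grad_test_L2:
  assumes "\<theta> \<in> test_functions \<Omega>"
  shows "grad \<theta> \<in> L2 \<Omega>"
proof -
  have "continuous_on UNIV (\<lambda>x. \<chi> i. partial i \<theta> x)"
    by (intro continuous_on_vec_lambda smooth_continuous smooth_partial test_function_smooth[OF assms])
  then show ?thesis using L2_continuous_bounded[OF \<Omega>] by (simp add: grad_def[abs_def])
qed

lemma is_weak_grad_comb:
  assumes v: "v \<in> L2 \<Omega>" "is_weak_grad \<Omega> v g" and w: "w \<in> L2 \<Omega>" "is_weak_grad \<Omega> w h"
  shows "is_weak_grad \<Omega> (\<lambda>x. c * v x + d * w x) (\<lambda>x. c *\<^sub>R g x + d *\<^sub>R h x)"
  unfolding is_weak_grad_def
proof (intro conjI ballI allI)
  have g: "g \<in> L2 \<Omega>" "h \<in> L2 \<Omega>" using v w by (auto simp: is_weak_grad_def)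
  then show "(\<lambda>x. c *\<^sub>R g x + d *\<^sub>R h x) \<in> L2 \<Omega>" by (rule L2_comb)
  fix \<theta> i assume t: "\<theta> \<in> test_functions \<Omega>"
  have p: "partial i \<theta> \<in> L2 \<Omega>" by (intro test_function_L2 test_function_partial t)
  have "L2_inner \<Omega> (\<lambda>x. c * v x + d * w x) (partial i \<theta>) =
      c * L2_inner \<Omega> v (partial i \<theta>) + d * L2_inner \<Omega> w (partial i \<theta>)"
    using L2_inner_comb_left[OF v(1) w(1) p, of c d] by simp
  also have "\<dots> = - (c * L2_inner \<Omega> (\<lambda>x. g x $ i) \<theta> + d * L2_inner \<Omega> (\<lambda>x. h x $ i) \<theta>)"
    using v(2) w(2) t by (simp add: is_weak_grad_def)
  also have "\<dots> = - L2_inner \<Omega> (\<lambda>x. (c *\<^sub>R g x + d *\<^sub>R h x) $ i) \<theta>"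
    using L2_inner_comb_left[OF L2_component[OF g(1)] L2_component[OF g(2)] test_function_L2[OF t], of c i d i]
    by simp
  finally show "L2_inner \<Omega> (\<lambda>x. c * v x + d * w x) (partial i \<theta>) =
      - L2_inner \<Omega> (\<lambda>x. (c *\<^sub>R g x + d *\<^sub>R h x) $ i) \<theta>" .
qed

text \<open>The fundamental lemma enters here. It makes the choice in \<open>weak_grad\<close>
  harmless: weak gradients depend on the class of \<open>v\<close> modulo null sets only.\<close>

lemma is_weak_grad_zero:
  assumes g: "is_weak_grad \<Omega> v g" and v: "AE x in lebesgue_on \<Omega>. v x = 0"
  shows "AE x in lebesgue_on \<Omega>. g x = 0"
proof -
  have gL: "g \<in> L2 \<Omega>" using g by (simp add: is_weak_grad_def)
  have "AE x in lebesgue_on \<Omega>. g x $ i = 0" for i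
  proof (rule fundamental_lemma[OF \<Omega> L2_component[OF gL]])
    fix \<theta> assume t: "\<theta> \<in> test_functions \<Omega>"
    have "L2_inner \<Omega> v (partial i \<theta>) = 0" using L2_inner_eq_0_AE[OF v] .
    then show "L2_inner \<Omega> (\<lambda>x. g x $ i) \<theta> = 0" using g t by (simp add: is_weak_grad_def)
  qed
  then have "AE x in lebesgue_on \<Omega>. g x $ 1 = 0 \<and> g x $ 2 = 0" by simp
  then show ?thesis by eventually_elim (auto simp: vec_eq_iff forall_2)
qed

lemma is_weak_grad_unique:
  assumes "v \<in> L2 \<Omega>" "is_weak_grad \<Omega> v g" "is_weak_grad \<Omega> v h"
  shows "AE x in lebesgue_on \<Omega>. g x = h x"
proof -
  have "is_weak_grad \<Omega> (\<lambda>x. 1 * v x + (-1) * v x) (\<lambda>x. 1 *\<^sub>R g x + (-1) *\<^sub>R h x)"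
    by (intro is_weak_grad_comb assms)
  from is_weak_grad_zero[OF this] show ?thesis by simp
qed

lemma H1_L2: "v \<in> H1 \<Omega> \<Longrightarrow> v \<in> L2 \<Omega>"
  by (simp add: H1_def)

lemma weak_grad: "v \<in> H1 \<Omega> \<Longrightarrow> is_weak_grad \<Omega> v (weak_grad \<Omega> v)"
  using someI_ex[of "is_weak_grad \<Omega> v"] unfolding H1_def weak_grad_def by auto

lemma weak_grad_L2: "v \<in> H1 \<Omega> \<Longrightarrow> weak_grad \<Omega> v \<in> L2 \<Omega>"
  using weak_grad by (auto simp: is_weak_grad_def)

lemma H1_comb:
  assumes "v \<in> H1 \<Omega>" "w \<in> H1 \<Omega>"
  shows "(\<lambda>x. c * v x + d * w x) \<in> H1 \<Omega>"
proof -
  have "(\<lambda>x. c * v x + d * w x) \<in> L2 \<Omega>" using L2_comb[OF H1_L2 H1_L2, OF assms, of c d] by simp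
  then show ?thesis
    using is_weak_grad_comb[OF H1_L2 weak_grad H1_L2 weak_grad, OF assms(1,1) assms(2,2)]
    by (auto simp: H1_def)
qed

lemma weak_grad_comb:
  assumes "v \<in> H1 \<Omega>" "w \<in> H1 \<Omega>"
  shows "AE x in lebesgue_on \<Omega>. weak_grad \<Omega> (\<lambda>x. c * v x + d * w x) x =
    c *\<^sub>R weak_grad \<Omega> v x + d *\<^sub>R weak_grad \<Omega> w x"
  by (rule is_weak_grad_unique[OF H1_L2 weak_grad is_weak_grad_comb[OF H1_L2 weak_grad H1_L2 weak_grad]])
    (use assms H1_comb in auto)

text \<open>The squared norm of \<open>c v - d w\<close> is nonnegative, which bounds the mixed term
  by the two squares. Working with squared norms throughout avoids square roots and the triangle
  inequality.\<close>

lemma L2_norm_comb_le: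
  assumes "v \<in> L2 \<Omega>" "w \<in> L2 \<Omega>"
  shows "L2_inner \<Omega> (\<lambda>x. c *\<^sub>R v x + d *\<^sub>R w x) (\<lambda>x. c *\<^sub>R v x + d *\<^sub>R w x)
    \<le> 2 * c\<^sup>2 * L2_inner \<Omega> v v + 2 * d\<^sup>2 * L2_inner \<Omega> w w"
proof -
  let ?s = "\<lambda>x. c *\<^sub>R v x + d *\<^sub>R w x" and ?t = "\<lambda>x. c *\<^sub>R v x + (- d) *\<^sub>R w x"
  have e: "L2_inner \<Omega> (\<lambda>x. c *\<^sub>R v x + d *\<^sub>R w x) (\<lambda>x. c *\<^sub>R v x + d *\<^sub>R w x) =
     c\<^sup>2 * L2_inner \<Omega> v v + 2 * c * d * L2_inner \<Omega> v w + d\<^sup>2 * L2_inner \<Omega> w w" for d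
    by (subst L2_inner_comb_left[OF assms L2_comb[OF assms]])
      (simp add: L2_inner_comb_right[OF assms assms(1)] L2_inner_comb_right[OF assms assms(2)]
        L2_inner_commute[of \<Omega> w v] algebra_simps power2_eq_square)
  have "0 \<le> L2_inner \<Omega> ?t ?t" by (rule L2_inner_nonneg)
  then show ?thesis unfolding e[of d] e[of "- d"] by (simp add: algebra_simps)
qed

lemma H10_H1: "v \<in> H10 \<Omega> \<Longrightarrow> v \<in> H1 \<Omega>"
  by (simp add: H10_def)

lemma H10_comb:
  assumes v: "v \<in> H10 \<Omega>" and w: "w \<in> H10 \<Omega>"
  shows "(\<lambda>x. c * v x + d * w x) \<in> H10 \<Omega>"
proof -
  let ?u = "\<lambda>x. c * v x + d * w x"
  let ?N = "\<lambda>v \<theta>. L2_inner \<Omega> (\<lambda>x. v x - \<theta> x) (\<lambda>x. v x - \<theta> x) +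
    L2_inner \<Omega> (\<lambda>x. weak_grad \<Omega> v x - grad \<theta> x) (\<lambda>x. weak_grad \<Omega> v x - grad \<theta> x)"
  obtain \<theta> where \<theta>: "\<And>n. \<theta> n \<in> test_functions \<Omega>" "(\<lambda>n. ?N v (\<theta> n)) \<longlonglongrightarrow> 0"
    using v unfolding H10_def by auto
  obtain \<zeta> where \<zeta>: "\<And>n. \<zeta> n \<in> test_functions \<Omega>" "(\<lambda>n. ?N w (\<zeta> n)) \<longlonglongrightarrow> 0"
    using w unfolding H10_def by auto
  let ?\<eta> = "\<lambda>n x. c * \<theta> n x + d * \<zeta> n x"
  note H1 = H10_H1[OF v] H10_H1[OF w]
  have t: "?\<eta> n \<in> test_functions \<Omega>" for n by (intro test_function_comb \<theta> \<zeta>)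
  have le: "?N ?u (?\<eta> n) \<le> 2 * c\<^sup>2 * ?N v (\<theta> n) + 2 * d\<^sup>2 * ?N w (\<zeta> n)" for n
  proof -
    have a: "(\<lambda>x. v x - \<theta> n x) \<in> L2 \<Omega>" "(\<lambda>x. w x - \<zeta> n x) \<in> L2 \<Omega>"
      by (intro L2_diff H1_L2 H1 test_function_L2 \<theta> \<zeta>)+
    have b: "(\<lambda>x. weak_grad \<Omega> v x - grad (\<theta> n) x) \<in> L2 \<Omega>" "(\<lambda>x. weak_grad \<Omega> w x - grad (\<zeta> n) x) \<in> L2 \<Omega>"
      by (intro L2_diff weak_grad_L2 H1 grad_test_L2 \<theta> \<zeta>)+
    have ge: "grad (?\<eta> n) x = c *\<^sub>R grad (\<theta> n) x + d *\<^sub>R grad (\<zeta> n) x" for x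
      using partial_comb[OF smooth_differentiable smooth_differentiable, of "\<theta> n" "\<zeta> n" _ c d x]
        test_function_smooth[OF \<theta>(1)] test_function_smooth[OF \<zeta>(1)]
      by (simp add: grad_def vec_eq_iff)
    have ae: "AE x in lebesgue_on \<Omega>. weak_grad \<Omega> ?u x - grad (?\<eta> n) x =
        c *\<^sub>R (weak_grad \<Omega> v x - grad (\<theta> n) x) + d *\<^sub>R (weak_grad \<Omega> w x - grad (\<zeta> n) x)"
      using weak_grad_comb[OF H1, of c d] by eventually_elim (simp add: ge algebra_simps)
    have l: "(\<lambda>x. weak_grad \<Omega> ?u x - grad (?\<eta> n) x) \<in> L2 \<Omega>"
      by (intro L2_diff weak_grad_L2 H1_comb H1 grad_test_L2 t)
    have "L2_inner \<Omega> (\<lambda>x. weak_grad \<Omega> ?u x - grad (?\<eta> n) x) (\<lambda>x. weak_grad \<Omega> ?u x - grad (?\<eta> n) x)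
      = L2_inner \<Omega> (\<lambda>x. c *\<^sub>R (weak_grad \<Omega> v x - grad (\<theta> n) x) + d *\<^sub>R (weak_grad \<Omega> w x - grad (\<zeta> n) x))
         (\<lambda>x. c *\<^sub>R (weak_grad \<Omega> v x - grad (\<theta> n) x) + d *\<^sub>R (weak_grad \<Omega> w x - grad (\<zeta> n) x))"
      by (rule L2_inner_cong_AE[OF lebesgue_domain l l L2_comb[OF b] L2_comb[OF b] ae ae])
    moreover have "(\<lambda>x. ?u x - ?\<eta> n x) = (\<lambda>x. c *\<^sub>R (v x - \<theta> n x) + d *\<^sub>R (w x - \<zeta> n x))"
      by (simp add: algebra_simps)
    ultimately show ?thesis
      using L2_norm_comb_le[OF a, of c d] L2_norm_comb_le[OF b, of c d] by (simp add: algebra_simps)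
  qed
  have "(\<lambda>n. 2 * c\<^sup>2 * ?N v (\<theta> n) + 2 * d\<^sup>2 * ?N w (\<zeta> n)) \<longlonglongrightarrow> 2 * c\<^sup>2 * 0 + 2 * d\<^sup>2 * 0"
    by (intro tendsto_intros \<theta>(2) \<zeta>(2))
  then have lim: "(\<lambda>n. ?N ?u (?\<eta> n)) \<longlonglongrightarrow> 0"
    by (intro tendsto_sandwich[of "\<lambda>_. 0" "\<lambda>n. ?N ?u (?\<eta> n)" sequentially
          "\<lambda>n. 2 * c\<^sup>2 * ?N v (\<theta> n) + 2 * d\<^sup>2 * ?N w (\<zeta> n)"] always_eventually allI le)
      (auto intro!: add_nonneg_nonneg L2_inner_nonneg)
  show ?thesis unfolding H10_def
    by (rule CollectI) (intro conjI exI[of _ ?\<eta>] allI H1_comb[OF H1] t lim)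
qed

end

section \<open>Integration by parts and the Friedrichs inequality\<close>

lemma line_derivative:
  fixes \<theta> :: "real^2 \<Rightarrow> real"
  assumes "smooth \<theta>"
  shows "((\<lambda>t. \<theta> (x + t *\<^sub>R axis i 1)) has_real_derivative partial i \<theta> (x + t *\<^sub>R axis i 1)) (at t)"
proof -
  let ?p = "x + t *\<^sub>R axis i 1"
  have "(\<theta> has_derivative frechet_derivative \<theta> (at ?p)) (at ?p)"
    using smooth_differentiable[OF assms] frechet_derivative_works by blast
  moreover have "((\<lambda>t. x + t *\<^sub>R axis i 1) has_derivative (\<lambda>s. s *\<^sub>R axis i (1::real))) (at t)"
    by (auto intro!: derivative_eq_intros)
  ultimately have d: "((\<lambda>t. \<theta> (x + t *\<^sub>R axis i 1)) has_derivative
      (\<lambda>s. frechet_derivative \<theta> (at ?p) (s *\<^sub>R axis i 1))) (at t)"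
    by (rule has_derivative_compose[rotated])
  have "linear (frechet_derivative \<theta> (at ?p))"
    using smooth_differentiable[OF assms] linear_frechet_derivative by blast
  then have "(\<lambda>s. frechet_derivative \<theta> (at ?p) (s *\<^sub>R axis i 1)) = (\<lambda>s. partial i \<theta> ?p * s)"
    by (simp add: partial_def linear_scale fun_eq_iff)
  with d show ?thesis unfolding has_field_derivative_def by simp
qed

lemma continuous_zero_off_compact_bounded:
  fixes f :: "'a::topological_space \<Rightarrow> real"
  assumes "compact S" "continuous_on UNIV f" "\<And>x. x \<notin> S \<Longrightarrow> f x = 0"
  obtains M where "M \<ge> 0" "\<And>x. \<bar>f x\<bar> \<le> M"
proof -
  have "compact (f ` S)" by (intro compact_continuous_image assms continuous_on_subset[OF assms(2)]) auto
  then obtain M where M: "\<And>y. y \<in> f ` S \<Longrightarrow> norm y \<le> M"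
    using compact_imp_bounded bounded_iff by metis
  have "\<bar>f x\<bar> \<le> max 0 M" for x
    using M[of "f x"] assms(3)[of x] by (cases "x \<in> S") auto
  then show ?thesis using that[of "max 0 M"] by simp
qed

text \<open>Difference quotients have integral zero by translation invariance.\<close>

lemma integral_partial_test_function:
  assumes \<Omega>: "open \<Omega>" and t: "\<theta> \<in> test_functions \<Omega>"
  shows "(LINT x|lebesgue_on \<Omega>. partial i \<theta> x) = 0"
proof -
  let ?e = "axis i 1 :: real^2" and ?S = "closure {x. \<theta> x \<noteq> 0}"
  have sm: "smooth \<theta>" using t by (rule test_function_smooth)
  have c: "continuous_on UNIV \<theta>" "continuous_on UNIV (partial i \<theta>)"
    using sm smooth_partial smooth_continuous by blast+
  have m: "\<theta> \<in> borel_measurable borel" "partial i \<theta> \<in> borel_measurable borel"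
    using c by (auto intro: borel_measurable_continuous_onI)
  have S: "compact ?S" using t by (simp add: test_functions_def)
  have S0: "\<theta> x = 0" if "x \<notin> ?S" for x using that by (rule zero_off_support)
  have \<theta>i: "integrable lborel \<theta>"
  proof -
    have "integrable lborel (\<lambda>x. indicator ?S x *\<^sub>R \<theta> x)"
      by (rule borel_integrable_compact[OF S]) (use c continuous_on_subset in blast)
    moreover have "(\<lambda>x. indicator ?S x *\<^sub>R \<theta> x) = \<theta>"
    proof
      show "indicator ?S x *\<^sub>R \<theta> x = \<theta> x" for x using S0[of x] by (cases "x \<in> ?S") auto
    qed
    ultimately show ?thesis by simp
  qed
  have tp: "partial i \<theta> \<in> test_functions \<Omega>" by (rule test_function_partial[OF t])
  then have "compact (closure {x. partial i \<theta> x \<noteq> 0})" by (simp add: test_functions_def)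
  then obtain M where M: "M \<ge> 0" "\<And>x. \<bar>partial i \<theta> x\<bar> \<le> M"
    using continuous_zero_off_compact_bounded[OF _ c(2) zero_off_support[of _ "partial i \<theta>"]] by blast
  define h where "h n = 1 / real (Suc n)" for n
  have h: "h n > 0" "h n \<le> 1" for n by (auto simp: h_def)
  have h0: "h \<longlonglongrightarrow> 0" using LIMSEQ_inverse_real_of_nat by (simp add: h_def[abs_def] inverse_eq_divide)
  define q where "q n x = (\<theta> (x + h n *\<^sub>R ?e) - \<theta> x) / h n" for n x
  \<comment> \<open>All steps \<open>h n\<close> have length at most 1, so the difference quotients
    vanish outside the closed unit neighbourhood of the support. Together with the mean value
    theorem this gives one integrable majorant.\<close>
  let ?T = "{x + y | x y. x \<in> ?S \<and> y \<in> cball 0 1}"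
  have Tc: "compact ?T" by (rule compact_sums[OF S compact_cball])
  have shift: "(\<lambda>x. \<theta> (x + h n *\<^sub>R ?e)) \<in> borel_measurable borel" for n
  proof -
    have "continuous_on UNIV (\<lambda>x. \<theta> (x + h n *\<^sub>R ?e))"
      by (rule continuous_on_compose2[OF c(1)]) (auto intro!: continuous_intros)
    then show ?thesis by (rule borel_measurable_continuous_onI)
  qed
  have q0: "(LINT x|lborel. q n x) = 0" for n
  proof -
    have sm: "(+) (h n *\<^sub>R ?e) \<in> measurable lborel borel" by simp
    have si: "integrable lborel (\<lambda>x. \<theta> (h n *\<^sub>R ?e + x))"
      using integrable_distr_eq[OF sm m(1)] \<theta>i lborel_distr_plus[of "h n *\<^sub>R ?e"] by simp
    have "(LINT x|lborel. \<theta> (h n *\<^sub>R ?e + x)) = (LINT x|lborel. \<theta> x)"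
      using integral_distr[OF sm m(1)] lborel_distr_plus[of "h n *\<^sub>R ?e"] by simp
    then show ?thesis
      using si \<theta>i unfolding q_def by (simp add: add.commute[of _ "h n *\<^sub>R ?e"])
  qed
  have bound: "\<bar>q n x\<bar> \<le> M * indicator ?T x" for n x
  proof (cases "x \<in> ?T")
    case True
    obtain s where "\<theta> (x + h n *\<^sub>R ?e) - \<theta> (x + 0 *\<^sub>R ?e) = (h n - 0) * partial i \<theta> (x + s *\<^sub>R ?e)"
      using MVT2[OF h(1) line_derivative[OF sm, of x i], of n] by blast
    then have "q n x = partial i \<theta> (x + s *\<^sub>R ?e)" using h[of n] by (simp add: q_def)
    then show ?thesis using M(2) True by simp
  next
    case False
    have "x = (x + h n *\<^sub>R ?e) + (- h n *\<^sub>R ?e)" by simp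
    moreover have "- h n *\<^sub>R ?e \<in> cball 0 1" using h[of n] by simp
    ultimately have "x + h n *\<^sub>R ?e \<notin> ?S" using False by blast
    then have "\<theta> (x + h n *\<^sub>R ?e) = 0" by (rule S0)
    moreover have "x = x + 0" "0 \<in> cball (0::real^2) 1" by simp_all
    then have "x \<notin> ?S" using False by blast
    then have "\<theta> x = 0" by (rule S0)
    ultimately have "q n x = 0" by (simp add: q_def)
    then show ?thesis using M(1) by simp
  qed
  have "(\<lambda>n. LINT x|lborel. q n x) \<longlonglongrightarrow> (LINT x|lborel. partial i \<theta> x)"
  proof (rule integral_dominated_convergence[where w = "\<lambda>x. M * indicator ?T x"])
    have "integrable lborel (\<lambda>x. indicator ?T x *\<^sub>R M)"
      by (rule borel_integrable_compact[OF Tc]) simp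
    then show "integrable lborel (\<lambda>x. M * indicator ?T x)" by (simp add: mult.commute)
    show "partial i \<theta> \<in> borel_measurable lborel" using m by simp
    show "q n \<in> borel_measurable lborel" for n unfolding q_def using m shift by simp
    show "AE x in lborel. (\<lambda>n. q n x) \<longlonglongrightarrow> partial i \<theta> x"
    proof (rule AE_I2)
      fix x
      have "((\<lambda>s. (\<theta> (x + (0 + s) *\<^sub>R ?e) - \<theta> (x + 0 *\<^sub>R ?e)) / s) \<longlongrightarrow> partial i \<theta> (x + 0 *\<^sub>R ?e)) (at 0)"
        using line_derivative[OF sm, of x i 0] unfolding DERIV_def .
      moreover have "filterlim h (at 0) sequentially"
        using h0 h by (auto simp: filterlim_at intro!: always_eventually less_imp_neq[THEN not_sym])
      ultimately have "(\<lambda>n. (\<theta> (x + (0 + h n) *\<^sub>R ?e) - \<theta> (x + 0 *\<^sub>R ?e)) / h n) \<longlonglongrightarrow> partial i \<theta> (x + 0 *\<^sub>R ?e)"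
        by (rule filterlim_compose)
      then show "(\<lambda>n. q n x) \<longlonglongrightarrow> partial i \<theta> x" by (simp add: q_def)
    qed
    show "AE x in lborel. norm (q n x) \<le> M * indicator ?T x" for n using bound by simp
  qed
  then have z: "(LINT x|lborel. partial i \<theta> x) = 0" unfolding q0 using LIMSEQ_unique tendsto_const by blast
  have "(LINT x|lebesgue_on \<Omega>. partial i \<theta> x) = (LINT x|lebesgue. indicator \<Omega> x *\<^sub>R partial i \<theta> x)"
    by (rule integral_restrict_space) (use \<Omega> in \<open>simp add: borel_open\<close>)
  also have "(\<lambda>x. indicator \<Omega> x *\<^sub>R partial i \<theta> x) = partial i \<theta>"
  proof
    fix x
    have "partial i \<theta> x = 0" if "x \<notin> \<Omega>"
      using tp that zero_off_support[of x "partial i \<theta>"] by (force simp: test_functions_def)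
    then show "indicator \<Omega> x *\<^sub>R partial i \<theta> x = partial i \<theta> x" by (auto simp: indicator_def)
  qed
  also have "(LINT x|lebesgue. partial i \<theta> x) = (LINT x|lborel. partial i \<theta> x)"
    by (rule integral_completion) (use m in simp)
  finally show ?thesis using z by simp
qed

context
  fixes \<Omega> :: "(real^2) set"
  assumes \<Omega>: "open \<Omega>" "bounded \<Omega>"
begin

text \<open>The first partial derivative of \<open>x $ 1 * (\<theta> x * \<theta> x)\<close> has
  integral zero, so the squared norm of \<open>\<theta>\<close> is the integral of
  \<open>-2 * (x $ 1 * \<theta> x) * partial 1 \<theta> x\<close>. Young's inequality returns half
  of the squared norm to the left side; the bound \<open>R\<close> on \<open>x $ 1\<close> then
  yields the constant \<open>4 * R\<^sup>2\<close>.\<close>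

lemma Friedrichs_test_function:
  obtains C where "C \<ge> 0" "\<And>\<theta>. \<theta> \<in> test_functions \<Omega> \<Longrightarrow> L2_inner \<Omega> \<theta> \<theta> \<le> C * L2_inner \<Omega> (grad \<theta>) (grad \<theta>)"
proof -
  obtain R where R: "\<And>x. x \<in> \<Omega> \<Longrightarrow> norm x \<le> R" using \<Omega>(2) bounded_iff by metis
  have "L2_inner \<Omega> \<theta> \<theta> \<le> 4 * R\<^sup>2 * L2_inner \<Omega> (grad \<theta>) (grad \<theta>)" if t: "\<theta> \<in> test_functions \<Omega>" for \<theta>
  proof -
    have sm: "smooth \<theta>" using t by (rule test_function_smooth)
    let ?p = "partial 1 \<theta>"
    let ?\<zeta> = "\<lambda>x::real^2. x $ 1 * (\<theta> x * \<theta> x)"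
    have t\<zeta>: "?\<zeta> \<in> test_functions \<Omega>"
    proof (rule test_functionI[OF t])
      show "smooth ?\<zeta>" by (intro smooth_mult smooth_coordinate sm)
      show "?\<zeta> x = 0" if "x \<notin> closure {x. \<theta> x \<noteq> 0}" for x
        using zero_off_support[OF that] by simp
    qed
    have tx: "(\<lambda>x. x $ 1 * \<theta> x) \<in> test_functions \<Omega>"
    proof (rule test_functionI[OF t])
      show "smooth (\<lambda>x. x $ 1 * \<theta> x)" by (intro smooth_mult smooth_coordinate sm)
      show "x $ 1 * \<theta> x = 0" if "x \<notin> closure {x. \<theta> x \<noteq> 0}" for x
        using zero_off_support[OF that] by simp
    qed
    have d: "((\<lambda>x::real^2. x $ 1) has_derivative (\<lambda>h. h $ 1)) (at x)" for x
      by (intro bounded_linear_imp_has_derivative bounded_linear_vec_nth)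
    then have "partial 1 (\<lambda>x::real^2. x $ 1) x = (axis 1 1 :: real^2) $ 1" for x
      by (simp only: partial_eqI[OF d])
    then have p\<zeta>: "partial 1 ?\<zeta> x = x $ 1 * (2 * (\<theta> x * ?p x)) + \<theta> x * \<theta> x" for x
      using partial_mult[of "\<lambda>x. x $ 1" x "\<lambda>x. \<theta> x * \<theta> x" 1] partial_mult[of \<theta> x \<theta> 1]
        smooth_differentiable[OF sm] smooth_differentiable[OF smooth_coordinate]
        smooth_differentiable[OF smooth_mult[OF sm sm]]
      by (simp add: axis_def)
    have tp: "?p \<in> test_functions \<Omega>" using test_function_partial[OF t] .
    have i1: "integrable (lebesgue_on \<Omega>) (\<lambda>x. \<theta> x \<bullet> \<theta> x)"
      and i2: "integrable (lebesgue_on \<Omega>) (\<lambda>x. ?p x \<bullet> ?p x)"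
      and i3: "integrable (lebesgue_on \<Omega>) (\<lambda>x. (x $ 1 * \<theta> x) \<bullet> ?p x)"
      by (intro L2_inner_integrable test_function_L2[OF \<Omega>] t tp tx)+
    have "0 = (LINT x|lebesgue_on \<Omega>. 2 * ((x $ 1 * \<theta> x) \<bullet> ?p x) + \<theta> x \<bullet> \<theta> x)"
      using integral_partial_test_function[OF \<Omega>(1) t\<zeta>, of 1] unfolding p\<zeta> by (simp add: algebra_simps)
    also have "\<dots> = 2 * (LINT x|lebesgue_on \<Omega>. (x $ 1 * \<theta> x) \<bullet> ?p x) + L2_inner \<Omega> \<theta> \<theta>"
      unfolding L2_inner_def using i1 i3 by simp
    finally have eq: "L2_inner \<Omega> \<theta> \<theta> = (LINT x|lebesgue_on \<Omega>. -2 * ((x $ 1 * \<theta> x) \<bullet> ?p x))"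
      by simp
    have "\<dots> \<le> (LINT x|lebesgue_on \<Omega>. (1/2) * (\<theta> x \<bullet> \<theta> x) + 2 * R\<^sup>2 * (?p x \<bullet> ?p x))"
    proof (rule integral_mono_AE)
      show "integrable (lebesgue_on \<Omega>) (\<lambda>x. -2 * ((x $ 1 * \<theta> x) \<bullet> ?p x))" using i3 by simp
      show "integrable (lebesgue_on \<Omega>) (\<lambda>x. (1/2) * (\<theta> x \<bullet> \<theta> x) + 2 * R\<^sup>2 * (?p x \<bullet> ?p x))"
        using i1 i2 by simp
      have "-2 * ((x $ 1 * \<theta> x) \<bullet> ?p x) \<le> (1/2) * (\<theta> x \<bullet> \<theta> x) + 2 * R\<^sup>2 * (?p x \<bullet> ?p x)" if "x \<in> \<Omega>" for x
      proof -
        have "\<bar>x $ 1\<bar> \<le> R" using R[OF that] component_le_norm_cart[of x 1] by linarith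
        then have "(x $ 1)\<^sup>2 \<le> R\<^sup>2" by (metis abs_le_square_iff abs_of_nonneg abs_ge_zero order_trans)
        then have "(x $ 1)\<^sup>2 * (?p x)\<^sup>2 \<le> R\<^sup>2 * (?p x)\<^sup>2" by (rule mult_right_mono) simp
        \<comment> \<open>Half of this square is Young's inequality with the weights 1/2 and
          2.\<close>
        moreover have "0 \<le> (\<theta> x + 2 * (x $ 1 * ?p x))\<^sup>2" by simp
        ultimately show ?thesis by (simp add: power2_eq_square algebra_simps)
      qed
      then show "AE x in lebesgue_on \<Omega>. -2 * ((x $ 1 * \<theta> x) \<bullet> ?p x) \<le> (1/2) * (\<theta> x \<bullet> \<theta> x) + 2 * R\<^sup>2 * (?p x \<bullet> ?p x)"
        by (intro AE_I2) simp
    qed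
    also have "\<dots> = (1/2) * L2_inner \<Omega> \<theta> \<theta> + 2 * R\<^sup>2 * L2_inner \<Omega> ?p ?p"
      unfolding L2_inner_def using i1 i2 by simp
    finally have "L2_inner \<Omega> \<theta> \<theta> \<le> 4 * R\<^sup>2 * L2_inner \<Omega> ?p ?p" using eq by linarith
    moreover have "L2_inner \<Omega> ?p ?p \<le> L2_inner \<Omega> (grad \<theta>) (grad \<theta>)"
      unfolding L2_inner_def
    proof (rule integral_mono_AE)
      show "integrable (lebesgue_on \<Omega>) (\<lambda>x. grad \<theta> x \<bullet> grad \<theta> x)"
        by (intro L2_inner_integrable grad_test_L2[OF \<Omega>] t)
      show "AE x in lebesgue_on \<Omega>. ?p x \<bullet> ?p x \<le> grad \<theta> x \<bullet> grad \<theta> x"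
        by (simp add: grad_def inner_vec_def sum_2)
    qed (rule i2)
    ultimately show ?thesis
      by (meson mult_left_mono order_trans zero_le_power2 mult_nonneg_nonneg zero_le_numeral)
  qed
  then show ?thesis using that[of "4 * R\<^sup>2"] by simp
qed

text \<open>Test functions approximating \<open>v\<close> have gradients tending to zero, so by
  Friedrichs they tend to zero themselves. This makes the Dirichlet form definite on
  \<open>H10\<close> modulo null sets.\<close>

lemma H10_gradient_zero:
  assumes v: "v \<in> H10 \<Omega>" and z: "L2_inner \<Omega> (weak_grad \<Omega> v) (weak_grad \<Omega> v) = 0"
  shows "AE x in lebesgue_on \<Omega>. v x = 0"
proof -
  let ?g = "weak_grad \<Omega> v"
  let ?N = "\<lambda>\<theta>. L2_inner \<Omega> (\<lambda>x. v x - \<theta> x) (\<lambda>x. v x - \<theta> x) +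
    L2_inner \<Omega> (\<lambda>x. ?g x - grad \<theta> x) (\<lambda>x. ?g x - grad \<theta> x)"
  obtain \<theta> where \<theta>: "\<And>n. \<theta> n \<in> test_functions \<Omega>" "(\<lambda>n. ?N (\<theta> n)) \<longlonglongrightarrow> 0"
    using v unfolding H10_def by auto
  have H1: "v \<in> H1 \<Omega>" using v by (rule H10_H1[OF \<Omega>])
  have vL: "v \<in> L2 \<Omega>" "?g \<in> L2 \<Omega>" using H1_L2[OF \<Omega> H1] weak_grad_L2[OF \<Omega> H1] .
  have g0: "AE x in lebesgue_on \<Omega>. ?g x = 0" by (rule L2_inner_self_eq_0[OF vL(2) z])
  obtain C where C: "C \<ge> 0" "\<And>\<theta>. \<theta> \<in> test_functions \<Omega> \<Longrightarrow> L2_inner \<Omega> \<theta> \<theta> \<le> C * L2_inner \<Omega> (grad \<theta>) (grad \<theta>)"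
    using Friedrichs_test_function by blast
  \<comment> \<open>The factor 2 comes from splitting \<open>v\<close> into
    \<open>v - \<theta> n\<close> and \<open>\<theta> n\<close>, the factor \<open>2 * C\<close>
    from Friedrichs for the second summand; their sum dominates both.\<close>
  have "L2_inner \<Omega> v v \<le> (2 + 2 * C) * ?N (\<theta> n)" for n
  proof -
    let ?t = "\<theta> n"
    have tL: "?t \<in> L2 \<Omega>" "grad ?t \<in> L2 \<Omega>" using test_function_L2[OF \<Omega> \<theta>(1)] grad_test_L2[OF \<Omega> \<theta>(1)] .
    have d: "(\<lambda>x. v x - ?t x) \<in> L2 \<Omega>" "(\<lambda>x. ?g x - grad ?t x) \<in> L2 \<Omega>" using L2_diff vL tL by blast+
    have "L2_inner \<Omega> v v \<le> 2 * L2_inner \<Omega> (\<lambda>x. v x - ?t x) (\<lambda>x. v x - ?t x) + 2 * L2_inner \<Omega> ?t ?t"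
      using L2_norm_comb_le[OF \<Omega> d(1) tL(1), of 1 1] by simp
    moreover have "L2_inner \<Omega> ?t ?t \<le> C * L2_inner \<Omega> (grad ?t) (grad ?t)" by (rule C(2)[OF \<theta>(1)])
    moreover have "L2_inner \<Omega> (grad ?t) (grad ?t) = L2_inner \<Omega> (\<lambda>x. ?g x - grad ?t x) (\<lambda>x. ?g x - grad ?t x)"
    proof -
      have "L2_inner \<Omega> (grad ?t) (grad ?t) = L2_inner \<Omega> (\<lambda>x. (-1) *\<^sub>R grad ?t x + 0 *\<^sub>R grad ?t x) (\<lambda>x. (-1) *\<^sub>R grad ?t x + 0 *\<^sub>R grad ?t x)"
        by (simp add: L2_inner_def)
      also have "\<dots> = L2_inner \<Omega> (\<lambda>x. ?g x - grad ?t x) (\<lambda>x. ?g x - grad ?t x)"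
        by (rule L2_inner_cong_AE[OF lebesgue_domain[OF \<Omega>] L2_comb[OF tL(2) tL(2)] L2_comb[OF tL(2) tL(2)] d(2) d(2)])
          (use g0 in eventually_elim, simp)+
      finally show ?thesis .
    qed
    moreover define A where "A = L2_inner \<Omega> (\<lambda>x. v x - ?t x) (\<lambda>x. v x - ?t x)"
    moreover define B where "B = L2_inner \<Omega> (\<lambda>x. ?g x - grad ?t x) (\<lambda>x. ?g x - grad ?t x)"
    ultimately have "L2_inner \<Omega> v v \<le> 2 * A + 2 * (C * B)" by simp
    moreover have "A \<ge> 0" "B \<ge> 0" by (simp_all add: A_def B_def L2_inner_nonneg)
    then have "C * A \<ge> 0" using C(1) by simp
    moreover have "(2 + 2 * C) * (A + B) = 2 * A + 2 * B + 2 * (C * A) + 2 * (C * B)"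
      by (simp add: algebra_simps)
    ultimately show ?thesis using \<open>B \<ge> 0\<close> unfolding A_def B_def by linarith
  qed
  moreover have "(\<lambda>n. (2 + 2 * C) * ?N (\<theta> n)) \<longlonglongrightarrow> (2 + 2 * C) * 0"
    by (intro tendsto_intros \<theta>(2))
  ultimately have "L2_inner \<Omega> v v \<le> (2 + 2 * C) * 0" by (intro LIMSEQ_le_const) auto
  then have "L2_inner \<Omega> v v = 0" using L2_inner_nonneg[of \<Omega> v] by simp
  then show ?thesis by (rule L2_inner_self_eq_0[OF vL(1)])
qed

end

section \<open>The mesh of a convex polygon\<close>

locale convex_mesh =
  fixes \<Omega> :: "(real^2) set" and \<T> :: "(real^2) set set"
  assumes polygon: "convex_polygon \<Omega>" and mesh: "mesh \<Omega> \<T>"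
begin

lemma open_domain: "open \<Omega>" and convex_domain: "convex \<Omega>" and bounded_domain: "bounded \<Omega>"
  and nonempty_domain: "\<Omega> \<noteq> {}"
  using polygon by (auto simp: convex_polygon_def)

lemma finite_cells: "finite \<T>"
  and cells_cover: "\<Union>\<T> = closure \<Omega>"
  and cell_simplex: "K \<in> \<T> \<Longrightarrow> 2 simplex K"
  and cells_face: "K \<in> \<T> \<Longrightarrow> K' \<in> \<T> \<Longrightarrow> (K \<inter> K') face_of K"
  using mesh by (auto simp: mesh_def triangulation_def)

lemma compact_closure_domain: "compact (closure \<Omega>)"
  using bounded_domain compact_closure by blast

lemma convex_closure_domain: "convex (closure \<Omega>)"
  by (simp add: convex_domain convex_closure)

lemma interior_closure_domain: "interior (closure \<Omega>) = \<Omega>"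
  using convex_interior_closure[OF convex_domain] open_domain by (simp add: interior_open)

lemma closed_cell: "K \<in> \<T> \<Longrightarrow> closed K"
  and convex_cell: "K \<in> \<T> \<Longrightarrow> convex K"
  and polytope_cell: "K \<in> \<T> \<Longrightarrow> polytope K"
  and aff_dim_cell: "K \<in> \<T> \<Longrightarrow> aff_dim K = 2"
  using cell_simplex[of K] closed_simplex[of 2 K] convex_simplex[of 2 K]
    simplex_imp_polytope[of 2 K] aff_dim_simplex[of 2 K] by auto

lemma cell_subset: "K \<in> \<T> \<Longrightarrow> K \<subseteq> closure \<Omega>"
  using cells_cover by blast

lemma interior_cell_nonempty:
  assumes "K \<in> \<T>"
  shows "interior K \<noteq> {}"
proof -
  have "K \<noteq> {}" using aff_dim_cell[OF assms] by auto
  then have "rel_interior K \<noteq> {}" using rel_interior_eq_empty[OF convex_cell[OF assms]] by blast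
  then show ?thesis using aff_dim_cell[OF assms] by (simp add: interior_rel_interior_gen)
qed

lemma closure_interior_cell: "K \<in> \<T> \<Longrightarrow> closure (interior K) = K"
  using closed_cell[of K] convex_closure_interior[OF convex_cell[of K]] interior_cell_nonempty[of K]
  by simp

lemma interior_cell_subset: "K \<in> \<T> \<Longrightarrow> interior K \<subseteq> \<Omega>"
  using cell_subset interior_mono interior_closure_domain by blast

text \<open>The common face \<open>L \<inter> M\<close> contains a relative interior point of
  \<open>L\<close>, so it is all of \<open>L\<close>; symmetry gives equality.\<close>

lemma disjoint_interiors:
  assumes "K \<in> \<T>" "K' \<in> \<T>" "x \<in> interior K" "x \<in> interior K'"
  shows "K = K'"
proof -
  have "L \<subseteq> M" if "L \<in> \<T>" "M \<in> \<T>" "x \<in> interior L" "x \<in> interior M" for L M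
  proof -
    have "(L \<inter> M) face_of L" using that cells_face by blast
    moreover have "x \<in> L \<inter> M" "x \<in> rel_interior L"
      using that interior_subset[of L] interior_subset[of M] interior_subset_rel_interior[of L]
      by auto
    ultimately have "L \<inter> M = L"
      using face_of_disjoint_rel_interior[of "L \<inter> M" L] by blast
    then show ?thesis by blast
  qed
  with assms show ?thesis by blast
qed

text \<open>Two cells meet in a common face. If it is an edge, the hypothesis applies to its
  direction; a vertex leaves nothing to compare; a face of full dimension makes the cells equal. So
  the fields can be compared at all points of the intersection, not only at vertices.\<close>

lemma tangential_consistent:
  fixes g :: "(real^2) set \<Rightarrow> real^2"
  assumes g: "\<And>K K' a b. K \<in> \<T> \<Longrightarrow> K' \<in> \<T> \<Longrightarrow> closed_segment a b edge_of K \<Longrightarrow>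
      closed_segment a b edge_of K' \<Longrightarrow> g K \<bullet> (b - a) = g K' \<bullet> (b - a)"
    and K: "K \<in> \<T>" "K' \<in> \<T>" and x: "x \<in> K \<inter> K'" and y: "y \<in> K \<inter> K'"
  shows "g K \<bullet> (y - x) = g K' \<bullet> (y - x)"
proof -
  let ?F = "K \<inter> K'"
  have F: "?F face_of K" "?F face_of K'"
    using cells_face[OF K] cells_face[OF K(2,1)] by (auto simp: Int_commute)
  have poly: "polytope ?F" 
    using face_of_polytope_polytope[OF polytope_cell[OF K(1)] F(1)] .
  have "aff_dim ?F \<le> 2" using aff_dim_subset[of ?F K] aff_dim_cell K by simp
  moreover have "aff_dim ?F \<ge> 0" using x by (metis aff_dim_negative_iff empty_iff linorder_not_le)
  ultimately consider "aff_dim ?F = 0" | "aff_dim ?F = 1" | "aff_dim ?F = 2" by linarith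
  then show ?thesis
  proof cases
    case 1
    then obtain a where "?F = {a}" using aff_dim_eq_0 by blast
    then have "x = y" using x y by (simp only: singleton_iff)
    then show ?thesis by simp
  next
    case 2
    then obtain n where "n simplex ?F"
      using polytope_lowdim_imp_simplex[OF poly] by auto
    with 2 have "1 simplex ?F" using aff_dim_simplex[of n ?F] by simp
    then obtain C where C: "card C = 2" "?F = convex hull C" unfolding simplex by auto
    then obtain a b where "C = {a, b}" by (meson card_2_iff)
    with C have ab: "?F = closed_segment a b" by (simp add: segment_convex_hull)
    have e: "closed_segment a b edge_of K" "closed_segment a b edge_of K'"
      using F 2 by (auto simp: edge_of_def ab)
    obtain s t where "x = (1 - s) *\<^sub>R a + s *\<^sub>R b" "y = (1 - t) *\<^sub>R a + t *\<^sub>R b"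
      using x y unfolding ab closed_segment_def by auto
    then have "y - x = (t - s) *\<^sub>R (b - a)" by (simp only: scaleR_left_diff_distrib scaleR_right_diff_distrib) simp
    then show ?thesis using g[OF K e] by (simp only: inner_scaleR_right)
  next
    case 3
    then have "?F = K" "?F = K'"
      using face_of_aff_dim_lt[OF convex_cell[OF K(1)] F(1)] face_of_aff_dim_lt[OF convex_cell[OF K(2)] F(2)]
        aff_dim_cell[OF K(1)] aff_dim_cell[OF K(2)] by linarith+
    then show ?thesis by simp
  qed
qed

text \<open>The finitely many closed cells that avoid \<open>p\<close> have a closed union.\<close>

lemma star_neighbourhood:
  "\<exists>r>0. \<forall>K\<in>\<T>. K \<inter> ball p r \<noteq> {} \<longrightarrow> p \<in> K"
proof -
  have "closed (\<Union>{K\<in>\<T>. p \<notin> K})" using finite_cells closed_cell by auto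
  then have "open (- \<Union>{K\<in>\<T>. p \<notin> K})" by auto
  moreover have "p \<in> - \<Union>{K\<in>\<T>. p \<notin> K}" by auto
  ultimately obtain r where "r > 0" "ball p r \<subseteq> - \<Union>{K\<in>\<T>. p \<notin> K}"
    using open_contains_ball by blast
  then show ?thesis by blast
qed

lemma continuous_on_cells:
  fixes f :: "real^2 \<Rightarrow> 'b::topological_space"
  assumes "\<And>K. K \<in> \<T> \<Longrightarrow> continuous_on (S \<inter> K) f" "S \<subseteq> closure \<Omega>" "closed S"
  shows "continuous_on S f"
proof -
  have "continuous_on (\<Union>K\<in>\<T>. S \<inter> K) f"
    using assms finite_cells closed_cell by (intro continuous_on_closed_Union) auto
  moreover have "(\<Union>K\<in>\<T>. S \<inter> K) = S" using assms(2) cells_cover by blast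
  ultimately show ?thesis by simp
qed

end

section \<open>Potentials of tangentially continuous fields\<close>

context convex_mesh begin

text \<open>For tangentially continuous \<open>g\<close> this is the function on the star of
  \<open>p\<close> that vanishes at \<open>p\<close> and has slope \<open>g K\<close> on each cell
  \<open>K\<close> of the star. The chosen cell is then immaterial, since any two cells containing
  both \<open>p\<close> and \<open>y\<close> give the same value.\<close>

definition local_potential :: "((real^2) set \<Rightarrow> real^2) \<Rightarrow> real^2 \<Rightarrow> real^2 \<Rightarrow> real" where
  "local_potential g p y = g (SOME K. K \<in> \<T> \<and> p \<in> K \<and> y \<in> K) \<bullet> (y - p)"

text \<open>Local potentials on overlapping stars differ by constants along segments, so increments
  over short distances are well defined. Convexity allows them to be summed along the segment from a
  base point, and around each small quadrilateral between neighbouring segments they cancel.\<close>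

lemma exists_potential:
  fixes g :: "(real^2) set \<Rightarrow> real^2"
  assumes g: "\<And>K K' a b. K \<in> \<T> \<Longrightarrow> K' \<in> \<T> \<Longrightarrow> closed_segment a b edge_of K \<Longrightarrow>
      closed_segment a b edge_of K' \<Longrightarrow> g K \<bullet> (b - a) = g K' \<bullet> (b - a)"
  obtains u where "continuous_on (closure \<Omega>) u"
    "\<And>K x y. K \<in> \<T> \<Longrightarrow> x \<in> K \<Longrightarrow> y \<in> K \<Longrightarrow> u y - u x = g K \<bullet> (y - x)"
proof -
  note tc = tangential_consistent[of g, OF g]
  let ?C = "closure \<Omega>"
  let ?h = "local_potential g"
  have h: "?h p y = g K \<bullet> (y - p)" if "K \<in> \<T>" "p \<in> K" "y \<in> K" for K p y
  proof -
    let ?K = "SOME K. K \<in> \<T> \<and> p \<in> K \<and> y \<in> K"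
    have "?K \<in> \<T> \<and> p \<in> ?K \<and> y \<in> ?K" by (rule someI[of _ K]) (use that in blast)
    then show ?thesis unfolding local_potential_def
      using tc[where K="?K" and K'=K and x=p and y=y] that by blast
  qed
  obtain r where r: "\<And>p. r p > 0" "\<And>p K. K \<in> \<T> \<Longrightarrow> K \<inter> ball p (r p) \<noteq> {} \<Longrightarrow> p \<in> K"
    using star_neighbourhood by metis
  have diff: "?h p y - ?h p x = g K \<bullet> (y - x)"
    if "K \<in> \<T>" "x \<in> K \<inter> ball p (r p)" "y \<in> K \<inter> ball p (r p)" for p x y K
  proof -
    have "p \<in> K" using r(2)[of K p] that by blast
    then show ?thesis using h[of K p x] h[of K p y] that by (auto simp: algebra_simps)
  qed
  have overlap: "?h p y - ?h p x = ?h q y - ?h q x"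
    if x: "x \<in> ?C" "x \<in> ball p (r p)" "x \<in> ball q (r q)"
      and y: "y \<in> ?C" "y \<in> ball p (r p)" "y \<in> ball q (r q)" for p q x y
  proof -
    let ?S = "closed_segment x y"
    have S: "?S \<subseteq> ?C" "?S \<subseteq> ball p (r p)" "?S \<subseteq> ball q (r q)"
      by (rule closed_segment_subset; use x y convex_closure_domain in simp)+
    define d where "d z = ?h p z - ?h q z" for z
    have d: "d z = d w" if "K \<in> \<T>" "z \<in> ?S \<inter> K" "w \<in> ?S \<inter> K" for K z w
      using diff[of K z p w] diff[of K z q w] that S unfolding d_def by fastforce
    \<comment> \<open>The difference of two local potentials is constant on each cell along the
      segment. Being continuous with finitely many values on a connected set, it is constant; this
      replaces an enumeration of the cells met by the segment.\<close>
    have "continuous_on ?S d"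
    proof (rule continuous_on_cells)
      fix K assume "K \<in> \<T>"
      then have "d constant_on (?S \<inter> K)" using d unfolding constant_on_def by blast
      then show "continuous_on (?S \<inter> K) d"
        by (metis (no_types, lifting) constant_on_def continuous_on_const continuous_on_cong)
    qed (use S in auto)
    moreover have "finite (d ` ?S)"
    proof -
      have "?S \<subseteq> (\<Union>K\<in>\<T>. ?S \<inter> K)" using S(1) unfolding cells_cover[symmetric] by auto
      then have "d ` ?S \<subseteq> (\<Union>K\<in>\<T>. d ` (?S \<inter> K))" by (metis image_UN image_mono)
      moreover have "finite (d ` (?S \<inter> K))" if "K \<in> \<T>" for K
      proof (cases "?S \<inter> K = {}")
        case False
        then obtain z where "z \<in> ?S \<inter> K" by blast
        have "d w \<in> {d z}" if w: "w \<in> ?S \<inter> K" for w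
          using d[OF \<open>K \<in> \<T>\<close> w \<open>z \<in> ?S \<inter> K\<close>] by (simp only: singleton_iff)
        then have "d ` (?S \<inter> K) \<subseteq> {d z}" by (rule image_subsetI)
        then show ?thesis by (rule finite_subset) simp
      qed simp
      ultimately show ?thesis using finite_cells by (metis (no_types, lifting) finite_UN_I finite_subset)
    qed
    ultimately have "d constant_on ?S"
      by (intro continuous_finite_range_constant) auto
    then have "d x = d y" unfolding constant_on_def by auto
    then show ?thesis unfolding d_def by simp
  qed
  \<comment> \<open>By compactness every subset of diameter below \<open>\<delta>\<close> fits into
    a single star neighbourhood.\<close>
  obtain \<delta> where \<delta>: "\<delta> > 0" "\<And>T. T \<subseteq> ?C \<Longrightarrow> diameter T < \<delta> \<Longrightarrow> \<exists>p. T \<subseteq> ball p (r p)"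
  proof (rule Lebesgue_number_lemma[of ?C "range (\<lambda>p. ball p (r p))"])
    have "x \<in> \<Union>(range (\<lambda>p. ball p (r p)))" for x using r(1)[of x] by (intro UnionI[of "ball x (r x)"]) auto
    then show "?C \<subseteq> \<Union>(range (\<lambda>p. ball p (r p)))" by blast
  qed (use compact_closure_domain in auto)
  \<comment> \<open>The increment from \<open>x\<close> to \<open>y\<close> in any star
    neighbourhood containing both points; \<open>overlap\<close> makes it independent of the
    choice.\<close>
  define D where "D x y = (let p = SOME p. {x, y} \<subseteq> ball p (r p) in ?h p y - ?h p x)" for x y
  have D: "D x y = ?h p y - ?h p x"
    if "x \<in> ?C" "x \<in> ball p (r p)" "y \<in> ?C" "y \<in> ball p (r p)" for x y p
  proof -
    let ?p = "SOME p. {x, y} \<subseteq> ball p (r p)"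
    have "{x, y} \<subseteq> ball ?p (r ?p)" by (rule someI[of _ p]) (use that in blast)
    then show ?thesis unfolding D_def Let_def using overlap[of x ?p p y] that by auto
  qed
  obtain x0 where x0: "x0 \<in> ?C" using nonempty_domain closure_subset by blast
  obtain M where M: "M > 0" "\<And>x y. x \<in> ?C \<Longrightarrow> y \<in> ?C \<Longrightarrow> dist x y \<le> M"
  proof -
    have b: "bounded ?C" using compact_closure_domain compact_imp_bounded by blast
    show ?thesis
      by (rule that[of "diameter ?C + 1"])
        (use b diameter_ge_0[OF b] diameter_bounded_bound[OF b] in force)+
  qed
  \<comment> \<open>With steps below \<open>\<delta> / 8\<close> and end points closer than that,
    the four corners considered below lie in a ball of radius \<open>\<delta> / 4\<close>, whose
    diameter \<open>\<delta> / 2\<close> is below the Lebesgue number.\<close>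
  obtain N :: nat where N: "N > 0" "M / N < \<delta> / 8"
  proof -
    obtain N :: nat where N: "N > M / (\<delta> / 8)" using reals_Archimedean2 by blast
    moreover have "M / (\<delta> / 8) > 0" using M \<delta> by simp
    ultimately have "N > 0" by (metis of_nat_0_less_iff order_less_trans)
    moreover have "M / N < \<delta> / 8" using N \<open>N > 0\<close> \<delta> by (simp add: field_simps)
    ultimately show ?thesis using that by blast
  qed
  define s where "s x i = x0 + (real i / real N) *\<^sub>R (x - x0)" for x i
  have s_in: "s x i \<in> ?C" if "x \<in> ?C" "i \<le> N" for x i
  proof -
    have "s x i = (1 - real i / N) *\<^sub>R x0 + (real i / N) *\<^sub>R x" unfolding s_def by (simp add: algebra_simps)
    then show ?thesis
      using convexD_alt[OF convex_closure_domain x0 that(1), of "real i / N"] that(2) N by simp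
  qed
  have s_step: "dist (s x i) (s x (Suc i)) < \<delta> / 8" if "x \<in> ?C" for x i
  proof -
    have "s x (Suc i) - s x i = (1 / N) *\<^sub>R (x - x0)"
      unfolding s_def by (simp add: algebra_simps add_divide_distrib)
    then have "norm (s x (Suc i) - s x i) = norm (x - x0) / N" by simp
    then have "dist (s x i) (s x (Suc i)) = dist x0 x / N"
      by (simp only: dist_norm norm_minus_commute)
    also have "\<dots> \<le> M / N" using M(2)[OF x0 that] N by (simp add: divide_right_mono)
    finally show ?thesis using N(2) by linarith
  qed
  have s_dist: "dist (s x i) (s y i) \<le> dist x y" if "i \<le> N" for x y i
  proof -
    have "s x i - s y i = (real i / N) *\<^sub>R (x - y)" unfolding s_def by (simp add: algebra_simps)
    then have "dist (s x i) (s y i) = (real i / N) * dist x y" by (simp add: dist_norm)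
    also have "\<dots> \<le> 1 * dist x y" using that N by (intro mult_right_mono) auto
    finally show ?thesis by simp
  qed
  define u where "u x = (\<Sum>i<N. D (s x i) (s x (Suc i)))" for x
  have u: "u y - u x = D x y" if x: "x \<in> ?C" and y: "y \<in> ?C" and xy: "dist x y < \<delta> / 8" for x y
  proof -
    \<comment> \<open>Both paths from \<open>s x i\<close> to \<open>s y (Suc i)\<close> run inside
      one star, so the increments around the quadrilateral cancel. Summation over \<open>i\<close>
      telescopes and leaves the increment from \<open>x\<close> to \<open>y\<close>.\<close>
    have step: "D (s y i) (s y (Suc i)) - D (s x i) (s x (Suc i)) = D (s x (Suc i)) (s y (Suc i)) - D (s x i) (s y i)"
      if i: "i < N" for i
    proof -
      let ?T = "{s x i, s x (Suc i), s y i, s y (Suc i)}"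
      have "dist (s x i) (s y i) < \<delta> / 8" "dist (s x i) (s x (Suc i)) < \<delta> / 8" "dist (s y i) (s y (Suc i)) < \<delta> / 8"
        using s_dist[of i x y] xy s_step x y i by auto
      then have "?T \<subseteq> cball (s x i) (\<delta> / 4)"
        using dist_triangle[of "s x i" "s y (Suc i)" "s y i"] \<delta>(1) by auto
      then have "diameter ?T \<le> diameter (cball (s x i) (\<delta> / 4))"
        by (intro diameter_subset) auto
      also have "\<dots> < \<delta>" using \<delta>(1) by simp
      finally obtain p where p: "?T \<subseteq> ball p (r p)"
        using \<delta>(2)[of ?T] s_in x y i by auto
      have C: "s x i \<in> ?C" "s x (Suc i) \<in> ?C" "s y i \<in> ?C" "s y (Suc i) \<in> ?C"
        using s_in x y i by auto
      show ?thesis using p by (simp add: D[OF C(1) _ C(2), of p] D[OF C(3) _ C(4), of p]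
          D[OF C(2) _ C(4), of p] D[OF C(1) _ C(3), of p])
    qed
    have "u y - u x = (\<Sum>i<N. D (s x (Suc i)) (s y (Suc i)) - D (s x i) (s y i))"
      unfolding u_def sum_subtractf[symmetric] by (intro sum.cong) (auto simp: step)
    also have "\<dots> = D (s x N) (s y N) - D (s x 0) (s y 0)"
      by (rule sum_lessThan_telescope)
    also have "\<dots> = D x y"
    proof -
      have "D x0 x0 = 0" using D[OF x0 _ x0, of x0] r(1)[of x0] by simp
      then show ?thesis using N by (simp add: s_def)
    qed
    finally show ?thesis .
  qed
  have cell: "u y - u x = g K \<bullet> (y - x)" if K: "K \<in> \<T>" and xy: "x \<in> K" "y \<in> K" for K x y
  proof -
    let ?f = "\<lambda>z. u z - g K \<bullet> z"
    \<comment> \<open>The slope of \<open>u\<close> is known at short range only. It extends to the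
      cell because \<open>?f\<close> is locally constant on a connected set.\<close>
    have "\<forall>z\<in>K. eventually (\<lambda>w. ?f z = ?f w) (at z within K)"
    proof
      fix z assume z: "z \<in> K"
      let ?e = "min (r z) (\<delta> / 8)"
      show "eventually (\<lambda>w. ?f z = ?f w) (at z within K)"
        unfolding eventually_at
      proof (intro exI[of _ ?e] conjI ballI impI)
        show "0 < ?e" using r \<delta> by auto
        fix w assume w: "w \<in> K" "w \<noteq> z \<and> dist w z < ?e"
        have "u w - u z = D z w" using u[of z w] w z cell_subset[OF K] by (auto simp: dist_commute)
        also have "\<dots> = ?h z w - ?h z z"
          using D[of z z w] w z cell_subset[OF K] r(1)[of z] by (auto simp: dist_commute)
        also have "\<dots> = g K \<bullet> (w - z)"
          using diff[of K z z w] w z K r(1)[of z] by (auto simp: dist_commute)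
        finally show "?f z = ?f w" by (simp add: algebra_simps)
      qed
    qed
    then have "?f x = ?f y"
      using connected_local_const[of K x y ?f] convex_connected[OF convex_cell[OF K]] xy by blast
    then show ?thesis by (simp add: algebra_simps)
  qed
  have "continuous_on ?C u"
  proof (rule continuous_on_cells)
    fix K assume K: "K \<in> \<T>"
    obtain x where x: "x \<in> K" using interior_cell_nonempty[OF K] interior_subset by blast
    have eq: "u x + g K \<bullet> (y - x) = u y" if "y \<in> ?C \<inter> K" for y
      using cell[OF K x, of y] that by simp
    have "continuous_on (?C \<inter> K) (\<lambda>y. u x + g K \<bullet> (y - x))" by (intro continuous_intros)
    then show "continuous_on (?C \<inter> K) u"
      using eq by (rule continuous_on_eq)
  qed auto
  then show ?thesis using cell that by blast
qed

end

text \<open>Twice the signed area of the triangle with vertices 0, \<open>x\<close> and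
  \<open>y\<close>, positive when \<open>y\<close> lies counterclockwise of
  \<open>x\<close>.\<close>

definition cross2 :: "real^2 \<Rightarrow> real^2 \<Rightarrow> real" where
  "cross2 x y = x $ 1 * y $ 2 - x $ 2 * y $ 1"

section \<open>Geometry of the boundary and functions along it\<close>

context convex_mesh begin

lemma edge_is_segment:
  assumes "K \<in> \<T>" "E face_of K" "aff_dim E = 1"
  obtains a b where "E = closed_segment a b" "a \<noteq> b" "a extreme_point_of K" "b extreme_point_of K"
proof -
  have "polytope E" by (rule face_of_polytope_polytope[OF polytope_cell[OF assms(1)] assms(2)])
  then obtain n where n: "n simplex E" using polytope_lowdim_imp_simplex[of E] assms(3) by auto
  then have "1 simplex E" using aff_dim_simplex[OF n] assms(3) by simp
  then obtain C where C: "card C = 2" "E = convex hull C" unfolding simplex by auto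
  then obtain a b where ab: "C = {a, b}" "a \<noteq> b" by (meson card_2_iff)
  with C have E: "E = closed_segment a b" by (simp add: segment_convex_hull)
  have "a extreme_point_of K" "b extreme_point_of K"
    using extreme_point_of_face[OF assms(2)] extreme_point_of_segment[of _ a b] E by blast+
  with that E ab show ?thesis by blast
qed

lemma domain_disjoint_frontier: "x \<in> frontier \<Omega> \<Longrightarrow> x \<notin> \<Omega>"
  using open_domain by (simp add: frontier_def interior_open)

lemma frontier_subset_closure: "x \<in> frontier \<Omega> \<Longrightarrow> x \<in> closure \<Omega>"
  by (simp add: frontier_def)

lemma frontier_support:
  assumes "x \<in> frontier \<Omega>"
  obtains n where "n \<noteq> 0" "\<And>y. y \<in> closure \<Omega> \<Longrightarrow> n \<bullet> y \<le> n \<bullet> x"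
proof -
  have "x \<notin> rel_interior \<Omega>" using domain_disjoint_frontier[OF assms] rel_interior_subset by blast
  then obtain a where a: "a \<noteq> 0" "\<And>y. y \<in> closure \<Omega> \<Longrightarrow> a \<bullet> x \<le> a \<bullet> y"
    using supporting_hyperplane_relative_frontier[OF convex_domain frontier_subset_closure[OF assms]]
    by metis
  show ?thesis by (rule that[of "- a"]) (use a in auto)
qed

lemma supported_not_in_domain:
  assumes "n \<noteq> 0" "\<And>y. y \<in> closure \<Omega> \<Longrightarrow> n \<bullet> y \<le> n \<bullet> x"
  shows "x \<notin> \<Omega>"
proof
  assume "x \<in> \<Omega>"
  then obtain e where e: "e > 0" "ball x e \<subseteq> \<Omega>" using open_domain open_contains_ball by blast
  let ?y = "x + (e / 2 / norm n) *\<^sub>R n"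
  have "?y \<in> ball x e" using e assms(1) by (simp add: dist_norm)
  then have "n \<bullet> ?y \<le> n \<bullet> x" using e assms(2) closure_subset by blast
  moreover have "n \<bullet> ?y = n \<bullet> x + (e / 2 / norm n) * (n \<bullet> n)" by (simp add: inner_add_right)
  moreover have "(e / 2 / norm n) * (n \<bullet> n) > 0" using e assms(1) by simp
  ultimately show False by linarith
qed

text \<open>A linear functional that is maximal at an inner point of a segment is constant along it.
  The whole segment thus lies in the supporting line, which misses the open domain.\<close>

lemma segment_meets_frontier:
  assumes "a \<in> closure \<Omega>" "b \<in> closure \<Omega>" "x \<in> open_segment a b" "x \<in> frontier \<Omega>"
    and n: "n \<noteq> 0" "\<And>y. y \<in> closure \<Omega> \<Longrightarrow> n \<bullet> y \<le> n \<bullet> x"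
  shows "\<And>y. y \<in> closed_segment a b \<Longrightarrow> n \<bullet> y = n \<bullet> x" "closed_segment a b \<subseteq> frontier \<Omega>"
proof -
  obtain t where t: "0 < t" "t < 1" "x = (1 - t) *\<^sub>R a + t *\<^sub>R b"
    using assms(3) by (auto simp: in_segment)
  have nx: "n \<bullet> x = (1 - t) * (n \<bullet> a) + t * (n \<bullet> b)" by (simp add: t(3) inner_add_right)
  have le: "n \<bullet> a \<le> n \<bullet> x" "n \<bullet> b \<le> n \<bullet> x" using n assms by auto
  have "(1 - t) * (n \<bullet> x - n \<bullet> a) + t * (n \<bullet> x - n \<bullet> b) = 0"
    using nx by (simp add: algebra_simps)
  moreover have "(1 - t) * (n \<bullet> x - n \<bullet> a) \<ge> 0" "t * (n \<bullet> x - n \<bullet> b) \<ge> 0" using le t by auto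
  ultimately have "(1 - t) * (n \<bullet> x - n \<bullet> a) = 0" "t * (n \<bullet> x - n \<bullet> b) = 0" by linarith+
  then have eq: "n \<bullet> a = n \<bullet> x" "n \<bullet> b = n \<bullet> x" using t by auto
  show nxy: "n \<bullet> y = n \<bullet> x" if "y \<in> closed_segment a b" for y
  proof -
    obtain s where "y = (1 - s) *\<^sub>R a + s *\<^sub>R b" using \<open>y \<in> closed_segment a b\<close> by (auto simp: in_segment)
    then have "n \<bullet> y = (1 - s) * (n \<bullet> a) + s * (n \<bullet> b)" by (simp add: inner_add_right)
    then show ?thesis by (simp add: eq algebra_simps)
  qed
  show "closed_segment a b \<subseteq> frontier \<Omega>"
  proof
    fix y assume y: "y \<in> closed_segment a b"
    then have "y \<in> closure \<Omega>"
      using closed_segment_subset[OF assms(1,2) convex_closure_domain] by blast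
    moreover have "y \<notin> \<Omega>"
      by (rule supported_not_in_domain[OF n(1)]) (use n nxy[OF y] in simp)
    ultimately show "y \<in> frontier \<Omega>" using open_domain by (simp add: frontier_def interior_open)
  qed
qed

text \<open>A cell containing \<open>x\<close> has it on an edge, and strictly between the endpoints
  because \<open>x\<close> is no vertex. The supporting line at \<open>x\<close> then contains that
  edge. This produces boundary edges without any combinatorics of the polygon.\<close>

lemma frontier_point_in_edge:
  assumes x: "x \<in> frontier \<Omega>" and nv: "\<And>K. K \<in> \<T> \<Longrightarrow> \<not> x extreme_point_of K"
  obtains K a b where "K \<in> \<T>" "closed_segment a b edge_of K" "closed_segment a b \<subseteq> frontier \<Omega>"
    "x \<in> closed_segment a b"
proof -
  obtain K where K: "K \<in> \<T>" "x \<in> K" using x cells_cover frontier_subset_closure by blast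
  have "x \<notin> interior K" using interior_cell_subset[OF K(1)] domain_disjoint_frontier[OF x] by blast
  then have "x \<in> rel_frontier K"
    using K closed_cell[OF K(1)] aff_dim_cell[OF K(1)] interior_rel_interior_gen[of K]
    by (simp add: rel_frontier_def)
  then obtain E where E: "E facet_of K" "x \<in> E"
    using rel_frontier_of_polyhedron[OF polytope_imp_polyhedron[OF polytope_cell[OF K(1)]]] by blast
  then have f: "E face_of K" "aff_dim E = 1" using aff_dim_cell[OF K(1)] by (auto simp: facet_of_def)
  obtain a b where ab: "E = closed_segment a b" "a \<noteq> b" "a extreme_point_of K" "b extreme_point_of K"
    using edge_is_segment[OF K(1) f] .
  have xo: "x \<in> open_segment a b" using E ab nv[OF K(1)] by (auto simp: open_segment_def)
  have abC: "a \<in> closure \<Omega>" "b \<in> closure \<Omega>"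
    using ab cell_subset[OF K(1)] by (auto simp: extreme_point_of_def)
  obtain n where n: "n \<noteq> 0" "\<And>y. y \<in> closure \<Omega> \<Longrightarrow> n \<bullet> y \<le> n \<bullet> x"
    using frontier_support[OF x] by blast
  have "closed_segment a b \<subseteq> frontier \<Omega>"
    using segment_meets_frontier(2)[OF abC xo x n] .
  then show ?thesis using that[OF K(1), of a b] E f ab by (auto simp: edge_of_def)
qed

text \<open>A supporting line at the midpoint, an inner point of the edge, contains the whole edge;
  its normal is rescaled to unit length.\<close>

lemma boundary_edge_normal:
  assumes K: "K \<in> \<T>" and e: "closed_segment a b edge_of K" "closed_segment a b \<subseteq> frontier \<Omega>"
  obtains n where "outward_unit_normal \<Omega> (closed_segment a b) n"
    "\<And>y. y \<in> closed_segment a b \<Longrightarrow> n \<bullet> (y - a) = 0"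
proof -
  have "a \<noteq> b" using e(1) by (auto simp: edge_of_def)
  then have m: "midpoint a b \<in> open_segment a b" by simp
  then have mF: "midpoint a b \<in> frontier \<Omega>" using e(2) open_closed_segment by blast
  have abC: "a \<in> closure \<Omega>" "b \<in> closure \<Omega>"
    using e(2) frontier_subset_closure by auto
  obtain n where n: "n \<noteq> 0" "\<And>y. y \<in> closure \<Omega> \<Longrightarrow> n \<bullet> y \<le> n \<bullet> midpoint a b"
    using frontier_support[OF mF] by blast
  have eq: "n \<bullet> y = n \<bullet> midpoint a b" if "y \<in> closed_segment a b" for y
    using segment_meets_frontier(1)[OF abC m mF n that] .
  let ?n = "n /\<^sub>R norm n"
  show ?thesis
  proof (rule that[of ?n])
    have "n \<bullet> (y - x) \<le> 0" if "x \<in> closed_segment a b" "y \<in> \<Omega>" for x y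
      using eq[OF that(1)] n(2)[of y] that(2) closure_subset by (auto simp: inner_diff_right)
    then show "outward_unit_normal \<Omega> (closed_segment a b) ?n"
      using n(1) by (auto simp: outward_unit_normal_def intro!: mult_nonneg_nonpos)
    show "?n \<bullet> (y - a) = 0" if "y \<in> closed_segment a b" for y
      using eq[OF that] eq[of a] by (simp add: inner_diff_right)
  qed
qed

definition mesh_faces :: "(real^2) set set" where
  "mesh_faces = {E. \<exists>K\<in>\<T>. E face_of K}"

lemma finite_mesh_faces: "finite mesh_faces"
proof -
  have "mesh_faces = (\<Union>K\<in>\<T>. {E. E face_of K})" unfolding mesh_faces_def by blast
  then show ?thesis using finite_cells finite_polytope_faces[OF polytope_cell] by simp
qed

lemma closed_mesh_face: "E \<in> mesh_faces \<Longrightarrow> closed E"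
  unfolding mesh_faces_def using face_of_imp_closed[OF convex_cell closed_cell] by blast

lemma connected_frontier_domain: "connected (frontier \<Omega>)"
proof -
  have i: "interior \<Omega> \<noteq> {}" using nonempty_domain open_domain by (simp add: interior_open)
  then have "aff_dim \<Omega> = 2" using aff_dim_nonempty_interior[of \<Omega>] by simp
  then have "path_connected (rel_frontier \<Omega>)"
    using path_connected_sphere_gen[OF convex_domain bounded_domain] by simp
  then show ?thesis using rel_frontier_nonempty_interior[OF i] path_connected_imp_connected by simp
qed

text \<open>If one frontier point on a ray from \<open>p\<close> came strictly before another,
  convexity would make it an interior point. Applying this to \<open>d\<close> and to
  \<open>1 / d\<close> excludes both orders.\<close>

lemma domain_ray_unique:
  assumes p: "p \<in> \<Omega>" and "x \<in> frontier \<Omega>" "p + d *\<^sub>R (x - p) \<in> frontier \<Omega>" "d > 0"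
  shows "d = 1"
proof -
  have below: "s \<ge> 1" if y: "y \<in> frontier \<Omega>" "p + s *\<^sub>R (y - p) \<in> frontier \<Omega>" "s > 0" for s y
  proof (rule ccontr)
    assume s1: "\<not> s \<ge> 1"
    have "y \<noteq> p" using p domain_disjoint_frontier y(1) by blast
    moreover have "p + s *\<^sub>R (y - p) = (1 - s) *\<^sub>R p + s *\<^sub>R y" by (simp add: algebra_simps)
    ultimately have "p + s *\<^sub>R (y - p) \<in> open_segment p y" using y(3) s1 by (auto simp: in_segment)
    moreover have "open_segment p y \<subseteq> interior \<Omega>"
      using in_interior_closure_convex_segment[OF convex_domain, of p y] p open_domain
        frontier_subset_closure[OF y(1)] by (simp add: interior_open)
    ultimately show False using domain_disjoint_frontier[OF y(2)] interior_subset by blast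
  qed
  have "d \<ge> 1" using below[OF assms(2,3,4)] .
  moreover have "1 / d \<ge> 1" using below[OF assms(3), of "1 / d"] assms by simp
  ultimately show ?thesis using assms(4) by (simp add: field_simps)
qed

text \<open>Moving counterclockwise along the boundary strictly increases \<open>u\<close> if \<open>\<kappa>\<close> is positive, so that
  \<open>u\<close> has no maximum on the frontier.\<close>

lemma boundary_slope_nonpos:
  assumes p: "p \<in> \<Omega>" and cont: "continuous_on (frontier \<Omega>) u"
    and slope: "\<And>K a b x y. K \<in> \<T> \<Longrightarrow> closed_segment a b edge_of K \<Longrightarrow>
      closed_segment a b \<subseteq> frontier \<Omega> \<Longrightarrow> x \<in> closed_segment a b \<Longrightarrow> y \<in> closed_segment a b \<Longrightarrow>
      u y - u x = \<kappa> * cross2 (x - p) (y - p)"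
  shows "\<kappa> \<le> (0::real)"
proof (rule ccontr)
  assume "\<not> \<kappa> \<le> 0"
  then have \<kappa>: "\<kappa> > 0" by simp
  have comp: "compact (frontier \<Omega>)" using bounded_domain by (simp add: compact_frontier_bounded)
  have "frontier \<Omega> \<noteq> {}"
    using bounded_domain nonempty_domain not_bounded_UNIV frontier_eq_empty by metis
  then obtain x where x: "x \<in> frontier \<Omega>" and max: "\<And>y. y \<in> frontier \<Omega> \<Longrightarrow> u y \<le> u x"
    using continuous_attains_sup[OF comp _ cont] by blast
  define q where "q = x - p"
  have qnz: "q \<noteq> 0" using p x domain_disjoint_frontier by (auto simp: q_def)
  \<comment> \<open>Directions turned slightly counterclockwise from \<open>q\<close>: the added
    vector is \<open>q\<close> rotated by a quarter turn, so the cross product with \<open>q\<close>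
    is a positive multiple of its squared norm.\<close>
  define y where "y n = q + (1 / Suc n) *\<^sub>R vector [- q $ 2, q $ 1]" for n :: nat
  have cy: "cross2 q (y n) = (1 / Suc n) * (norm q)\<^sup>2" for n
    by (simp add: y_def cross2_def norm_vec_def L2_set_def sum_2 power2_eq_square algebra_simps)
  have cy_pos: "cross2 q (y n) > 0" for n unfolding cy using qnz by simp
  have ynz: "y n \<noteq> 0" for n using cy_pos[of n] by (auto simp: cross2_def)
  then have "\<exists>d>0. p + d *\<^sub>R y n \<in> frontier \<Omega>" for n
    using ray_to_frontier[OF bounded_domain, of p "y n"] p open_domain
    by (metis interior_open)
  then obtain d where d: "\<And>n. d n > 0" "\<And>n. p + d n *\<^sub>R y n \<in> frontier \<Omega>" by metis
  define z where "z n = p + d n *\<^sub>R y n" for n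
  obtain l r where l: "l \<in> frontier \<Omega>" and r: "strict_mono r" "(z \<circ> r) \<longlonglongrightarrow> l"
    using comp[unfolded compact_def, rule_format, of z] d(2) by (auto simp: z_def)
  have "(\<lambda>n. 1 / real (Suc n)) \<longlonglongrightarrow> 0" using LIMSEQ_inverse_real_of_nat by (simp add: inverse_eq_divide)
  then have "y \<longlonglongrightarrow> q + 0 *\<^sub>R vector [- q $ 2, q $ 1]"
    unfolding y_def by (intro tendsto_intros)
  then have yl: "(y \<circ> r) \<longlonglongrightarrow> q" using LIMSEQ_subseq_LIMSEQ[OF _ r(1)] by simp
  \<comment> \<open>Along the subsequence the ray parameters converge as well, so the limit
    \<open>l\<close> lies on the ray from \<open>p\<close> through \<open>x\<close> and, being a
    frontier point, equals \<open>x\<close>.\<close>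
  have dz: "d n = norm (z n - p) / norm (y n)" for n
    using d(1)[of n] ynz by (simp add: z_def)
  have "(\<lambda>n. norm ((z \<circ> r) n - p) / norm ((y \<circ> r) n)) \<longlonglongrightarrow> norm (l - p) / norm q"
    by (intro tendsto_intros yl r(2)) (use qnz in simp)
  then have dl: "(\<lambda>n. d (r n)) \<longlonglongrightarrow> norm (l - p) / norm q" by (simp add: dz)
  have "(\<lambda>n. p + d (r n) *\<^sub>R (y \<circ> r) n) \<longlonglongrightarrow> p + (norm (l - p) / norm q) *\<^sub>R q"
    by (intro tendsto_intros dl yl)
  then have "(z \<circ> r) \<longlonglongrightarrow> p + (norm (l - p) / norm q) *\<^sub>R q" by (simp add: z_def comp_def)
  then have leq: "l = p + (norm (l - p) / norm q) *\<^sub>R q" using r(2) LIMSEQ_unique by blast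
  have lp: "l \<noteq> p" using p l domain_disjoint_frontier by blast
  have "p + (norm (l - p) / norm q) *\<^sub>R (x - p) \<in> frontier \<Omega>" using l leq by (simp only: q_def[symmetric])
  then have "norm (l - p) / norm q = 1"
    by (rule domain_ray_unique[OF p x]) (use lp qnz in simp)
  then have "l = p + q" using leq by (simp only: scaleR_one)
  then have zx: "(z \<circ> r) \<longlonglongrightarrow> x" using r(2) by (simp add: q_def)
  \<comment> \<open>There are finitely many faces, so points close to \<open>x\<close> lie on no
    face that avoids \<open>x\<close>. Such a frontier point other than \<open>x\<close> is
    therefore no vertex, and its boundary edge also contains \<open>x\<close>, which makes the slope
    formula applicable.\<close>
  let ?U = "- \<Union>{E \<in> mesh_faces. x \<notin> E}"
  have "open ?U" using finite_mesh_faces closed_mesh_face by (intro open_Compl closed_Union) auto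
  then have "eventually (\<lambda>n. (z \<circ> r) n \<in> ?U) sequentially"
    using topological_tendstoD[OF zx, of ?U] by auto
  then obtain n where n: "z (r n) \<in> ?U" by (auto simp: eventually_sequentially)
  let ?z = "z (r n)"
  have zF: "?z \<in> frontier \<Omega>" using d(2) by (simp add: z_def)
  have cz: "cross2 q (?z - p) > 0"
  proof -
    have "cross2 q (?z - p) = d (r n) * cross2 q (y (r n))"
      unfolding z_def cross2_def by (simp add: algebra_simps)
    then show ?thesis using cy_pos d(1) by simp
  qed
  then have zx: "?z \<noteq> x" by (auto simp: cross2_def q_def)
  have "\<not> ?z extreme_point_of K" if "K \<in> \<T>" for K
  proof
    assume "?z extreme_point_of K"
    then have "{?z} \<in> mesh_faces" unfolding mesh_faces_def using that face_of_singleton by blast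
    then show False using n zx by auto
  qed
  then obtain K a b where K: "K \<in> \<T>" "closed_segment a b edge_of K" "closed_segment a b \<subseteq> frontier \<Omega>"
    and z: "?z \<in> closed_segment a b"
    using frontier_point_in_edge[OF zF] by blast
  have "closed_segment a b \<in> mesh_faces" using K unfolding mesh_faces_def edge_of_def by blast
  then have "x \<in> closed_segment a b" using n z by blast
  then have "u ?z - u x = \<kappa> * cross2 q (?z - p)" unfolding q_def by (rule slope[OF K _ z])
  moreover have "\<kappa> * cross2 q (?z - p) > 0" using \<kappa> cz by simp
  ultimately have "u ?z > u x" by linarith
  then show False using max[OF zF] by simp
qed

lemma boundary_slope_zero:
  assumes p: "p \<in> \<Omega>" and cont: "continuous_on (frontier \<Omega>) u"
    and slope: "\<And>K a b x y. K \<in> \<T> \<Longrightarrow> closed_segment a b edge_of K \<Longrightarrow>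
      closed_segment a b \<subseteq> frontier \<Omega> \<Longrightarrow> x \<in> closed_segment a b \<Longrightarrow> y \<in> closed_segment a b \<Longrightarrow>
      u y - u x = \<kappa> * cross2 (x - p) (y - p)"
  shows "\<kappa> = (0::real)"
proof -
  have "\<kappa> \<le> 0" by (rule boundary_slope_nonpos[OF p cont slope])
  moreover have "- \<kappa> \<le> 0"
  proof (rule boundary_slope_nonpos[OF p])
    show "continuous_on (frontier \<Omega>) (\<lambda>x. - u x)" using cont by (intro continuous_intros)
    fix K a b x y
    assume "K \<in> \<T>" "closed_segment a b edge_of K" "closed_segment a b \<subseteq> frontier \<Omega>"
      "x \<in> closed_segment a b" "y \<in> closed_segment a b"
    from slope[OF this] show "- u y - - u x = - \<kappa> * cross2 (x - p) (y - p)" by simp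
  qed
  ultimately show ?thesis by simp
qed

text \<open>Finitely many vertices and boundary edges cover the frontier, and \<open>u\<close> has a
  single value on each. A continuous function with finitely many values on the connected frontier is
  constant.\<close>

lemma boundary_constant:
  fixes u :: "real^2 \<Rightarrow> real"
  assumes cont: "continuous_on (frontier \<Omega>) u"
    and const: "\<And>K a b x y. K \<in> \<T> \<Longrightarrow> closed_segment a b edge_of K \<Longrightarrow>
      closed_segment a b \<subseteq> frontier \<Omega> \<Longrightarrow> x \<in> closed_segment a b \<Longrightarrow> y \<in> closed_segment a b \<Longrightarrow>
      u y = u x"
  obtains c where "\<And>x. x \<in> frontier \<Omega> \<Longrightarrow> u x = c"
proof -
  let ?\<E> = "{E \<in> mesh_faces. \<exists>c. u ` E \<subseteq> {c}}"
  have "x \<in> \<Union>?\<E>" if x: "x \<in> frontier \<Omega>" for x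
  proof (cases "\<exists>K\<in>\<T>. x extreme_point_of K")
    case True
    then have "{x} \<in> mesh_faces" unfolding mesh_faces_def by (simp add: face_of_singleton)
    then have "{x} \<in> ?\<E>" by auto
    then show ?thesis by blast
  next
    case False
    then obtain K a b where K: "K \<in> \<T>" "closed_segment a b edge_of K" "closed_segment a b \<subseteq> frontier \<Omega>"
      and z: "x \<in> closed_segment a b" using frontier_point_in_edge[OF x] by blast
    have "closed_segment a b \<in> mesh_faces" using K unfolding mesh_faces_def edge_of_def by blast
    moreover have "u ` closed_segment a b \<subseteq> {u x}" using const[OF K z] by auto
    ultimately have "closed_segment a b \<in> ?\<E>" by blast
    with z show ?thesis by blast
  qed
  then have "frontier \<Omega> \<subseteq> \<Union>?\<E>" by (rule subsetI)
  then have "u ` frontier \<Omega> \<subseteq> u ` \<Union>?\<E>" by (rule image_mono)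
  then have sub: "u ` frontier \<Omega> \<subseteq> (\<Union>E\<in>?\<E>. u ` E)" by (simp only: image_Union)
  have "finite (u ` E)" if E: "E \<in> ?\<E>" for E
  proof -
    obtain c where "u ` E \<subseteq> {c}" using E by auto
    then show ?thesis by (rule finite_subset) simp
  qed
  then have "finite (\<Union>E\<in>?\<E>. u ` E)" using finite_mesh_faces by (intro finite_UN_I) auto
  then have "finite (u ` frontier \<Omega>)" using sub finite_subset by blast
  then have "u constant_on frontier \<Omega>"
    using continuous_finite_range_constant[OF connected_frontier_domain cont] by blast
  then show ?thesis using that unfolding constant_on_def by blast
qed

end

section \<open>Piecewise polynomials\<close>

lemma polys_0: "p \<in> polys 0 \<longleftrightarrow> (\<exists>a. p = (\<lambda>_. a))"
  unfolding polys_def by (auto simp: fun_eq_iff intro: exI[of _ "\<lambda>_ _. _"])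

lemma polys_1: "p \<in> polys 1 \<longleftrightarrow> (\<exists>a b c. p = (\<lambda>x. a + x $ 1 *\<^sub>R b + x $ 2 *\<^sub>R c))"
proof
  assume "p \<in> polys 1"
  then obtain c where "p x = (\<Sum>i\<le>1. \<Sum>j\<le>1 - i. ((x $ 1) ^ i * (x $ 2) ^ j) *\<^sub>R c i j)" for x
    unfolding polys_def by blast
  then have "p = (\<lambda>x. c 0 0 + x $ 1 *\<^sub>R c 1 0 + x $ 2 *\<^sub>R c 0 1)"
    by (simp add: fun_eq_iff atMost_Suc algebra_simps)
  then show "\<exists>a b c. p = (\<lambda>x. a + x $ 1 *\<^sub>R b + x $ 2 *\<^sub>R c)" by blast
next
  assume "\<exists>a b c. p = (\<lambda>x. a + x $ 1 *\<^sub>R b + x $ 2 *\<^sub>R c)"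
  then obtain a b c where "p = (\<lambda>x. a + x $ 1 *\<^sub>R b + x $ 2 *\<^sub>R c)" by blast
  then show "p \<in> polys 1"
    unfolding polys_def
    by (auto intro!: exI[of _ "\<lambda>i j. if i = 0 then if j = 0 then a else c else b"] simp: atMost_Suc algebra_simps)
qed

definition quadratic ::
    "'b::real_vector \<Rightarrow> 'b \<Rightarrow> 'b \<Rightarrow> 'b \<Rightarrow> 'b \<Rightarrow> 'b \<Rightarrow> real^2 \<Rightarrow> 'b" where
  "quadratic a b c d e f x = a + x $ 1 *\<^sub>R b + x $ 2 *\<^sub>R c +
     (x $ 1)\<^sup>2 *\<^sub>R d + (x $ 1 * x $ 2) *\<^sub>R e + (x $ 2)\<^sup>2 *\<^sub>R f"

lemma polys_2: "p \<in> polys 2 \<longleftrightarrow> (\<exists>a b c d e f. p = quadratic a b c d e f)"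
proof
  assume "p \<in> polys 2"
  then obtain c where "p x = (\<Sum>i\<le>2. \<Sum>j\<le>2 - i. ((x $ 1) ^ i * (x $ 2) ^ j) *\<^sub>R c i j)" for x
    unfolding polys_def by blast
  then have "p = quadratic (c 0 0) (c 1 0) (c 0 1) (c 2 0) (c 1 1) (c 0 2)"
    by (simp add: quadratic_def fun_eq_iff numeral_2_eq_2 atMost_Suc algebra_simps)
  then show "\<exists>a b c d e f. p = quadratic a b c d e f" by blast
next
  assume "\<exists>a b c d e f. p = quadratic a b c d e f"
  then obtain a b c d e f where "p = quadratic a b c d e f" by blast
  then show "p \<in> polys 2"
    unfolding polys_def
    by (auto intro!: exI[of _ "\<lambda>i j. if i = 0 then if j = 0 then a else if j = 1 then c else f
          else if i = 1 then if j = 0 then b else e else d"]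
        simp: quadratic_def numeral_2_eq_2 atMost_Suc algebra_simps)
qed

lemma polys_mono:
  assumes "k \<le> m" "m \<le> 2" "p \<in> polys k"
  shows "p \<in> polys m"
proof -
  have a: "p \<in> polys 1" if "p \<in> polys 0" for p :: "real^2 \<Rightarrow> 'a"
  proof -
    obtain a where "p = (\<lambda>_. a)" using \<open>p \<in> polys 0\<close> polys_0 by blast
    then have "p = (\<lambda>x. a + x $ 1 *\<^sub>R 0 + x $ 2 *\<^sub>R 0)" by simp
    then show ?thesis using polys_1 by blast
  qed
  have b: "p \<in> polys 2" if "p \<in> polys 1" for p :: "real^2 \<Rightarrow> 'a"
  proof -
    obtain a b c where "p = (\<lambda>x. a + x $ 1 *\<^sub>R b + x $ 2 *\<^sub>R c)" using \<open>p \<in> polys 1\<close> polys_1 by blast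
    then have "p = quadratic a b c 0 0 0" by (simp add: quadratic_def fun_eq_iff)
    then show ?thesis using polys_2 by blast
  qed
  consider "k = m" | "k = 0" "m = 1" | "k = 0" "m = 2" | "k = 1" "m = 2" using assms(1,2) by linarith
  then show ?thesis by cases (use assms(3) a b in auto)
qed

lemma polys_comb:
  assumes "p \<in> polys k" "q \<in> polys k"
  shows "(\<lambda>x. s *\<^sub>R p x + t *\<^sub>R q x) \<in> polys k"
proof -
  obtain c where c: "\<And>x. p x = (\<Sum>i\<le>k. \<Sum>j\<le>k - i. ((x $ 1) ^ i * (x $ 2) ^ j) *\<^sub>R c i j)"
    using assms(1) unfolding polys_def by blast
  obtain d where d: "\<And>x. q x = (\<Sum>i\<le>k. \<Sum>j\<le>k - i. ((x $ 1) ^ i * (x $ 2) ^ j) *\<^sub>R d i j)"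
    using assms(2) unfolding polys_def by blast
  show ?thesis unfolding polys_def
    by (auto intro!: exI[of _ "\<lambda>i j. s *\<^sub>R c i j + t *\<^sub>R d i j"]
        simp: c d scaleR_sum_right sum.distrib scaleR_add_right mult_ac)
qed

lemma polys_linear_image:
  assumes "linear L" "p \<in> polys k"
  shows "(\<lambda>x. L (p x)) \<in> polys k"
proof -
  obtain c where c: "\<And>x. p x = (\<Sum>i\<le>k. \<Sum>j\<le>k - i. ((x $ 1) ^ i * (x $ 2) ^ j) *\<^sub>R c i j)"
    using assms(2) unfolding polys_def by blast
  show ?thesis unfolding polys_def
    by (auto intro!: exI[of _ "\<lambda>i j. L (c i j)"] simp: c linear_sum[OF assms(1)] linear_scale[OF assms(1)])
qed

lemma quadratic_has_derivative:
  fixes a :: "'b::real_normed_vector"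
  shows "(quadratic a b c d e f has_derivative
    (\<lambda>h. h $ 1 *\<^sub>R (b + (2 * x $ 1) *\<^sub>R d + x $ 2 *\<^sub>R e) + h $ 2 *\<^sub>R (c + x $ 1 *\<^sub>R e + (2 * x $ 2) *\<^sub>R f))) (at x)"
proof -
  have n: "((\<lambda>x::real^2. x $ i) has_derivative (\<lambda>h. h $ i)) (at x)" for i
    by (intro bounded_linear_imp_has_derivative bounded_linear_vec_nth)
  show ?thesis unfolding quadratic_def[abs_def]
    by (auto intro!: derivative_eq_intros n simp: fun_eq_iff algebra_simps power2_eq_square)
qed

lemma polys_differentiable:
  fixes p :: "real^2 \<Rightarrow> 'b::real_normed_vector"
  assumes "p \<in> polys k" "k \<le> 2"
  shows "p differentiable (at x)"
proof -
  have "p \<in> polys 2" using polys_mono assms by blast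
  then obtain a b c d e f where "p = quadratic a b c d e f" using polys_2 by blast
  then show ?thesis using quadratic_has_derivative differentiableI by blast
qed

lemma polys_continuous:
  fixes p :: "real^2 \<Rightarrow> 'b::real_normed_vector"
  assumes "p \<in> polys k" "k \<le> 2"
  shows "continuous_on S p"
  using polys_differentiable[OF assms] differentiable_imp_continuous_within continuous_at_imp_continuous_on by blast

lemma partial_quadratic:
  fixes a :: "'b::real_normed_vector"
  shows "partial 1 (quadratic a b c d e f) = (\<lambda>x. b + x $ 1 *\<^sub>R (2 *\<^sub>R d) + x $ 2 *\<^sub>R e)"
    "partial 2 (quadratic a b c d e f) = (\<lambda>x. c + x $ 1 *\<^sub>R e + x $ 2 *\<^sub>R (2 *\<^sub>R f))"
proof -
  have "partial 1 (quadratic a b c d e f) x = b + x $ 1 *\<^sub>R (2 *\<^sub>R d) + x $ 2 *\<^sub>R e" for x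
    by (subst partial_eqI[OF quadratic_has_derivative]) (simp add: axis_def mult.commute)
  moreover have "partial 2 (quadratic a b c d e f) x = c + x $ 1 *\<^sub>R e + x $ 2 *\<^sub>R (2 *\<^sub>R f)" for x
    by (subst partial_eqI[OF quadratic_has_derivative]) (simp add: axis_def mult.commute)
  ultimately show "partial 1 (quadratic a b c d e f) = (\<lambda>x. b + x $ 1 *\<^sub>R (2 *\<^sub>R d) + x $ 2 *\<^sub>R e)"
    "partial 2 (quadratic a b c d e f) = (\<lambda>x. c + x $ 1 *\<^sub>R e + x $ 2 *\<^sub>R (2 *\<^sub>R f))"
    by auto
qed

lemma partial_polys_2:
  fixes p :: "real^2 \<Rightarrow> 'b::real_normed_vector"
  assumes "p \<in> polys 2"
  shows "partial i p \<in> polys 1"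
proof -
  obtain a b c d e f where p: "p = quadratic a b c d e f" using assms polys_2 by blast
  consider "i = 1" | "i = 2" using exhaust_2 by blast
  then show ?thesis
  proof cases
    case 1
    then show ?thesis unfolding p 1 partial_quadratic polys_1 by blast
  next
    case 2
    then show ?thesis unfolding p 2 partial_quadratic polys_1 by blast
  qed
qed

lemma partial_affine:
  fixes a :: "'b::real_normed_vector"
  shows "partial 1 (\<lambda>x. a + x $ 1 *\<^sub>R b + x $ 2 *\<^sub>R c) = (\<lambda>_. b)"
    "partial 2 (\<lambda>x. a + x $ 1 *\<^sub>R b + x $ 2 *\<^sub>R c) = (\<lambda>_. c)"
proof -
  have "(\<lambda>x::real^2. a + x $ 1 *\<^sub>R b + x $ 2 *\<^sub>R c) = quadratic a b c 0 0 0"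
    by (simp add: quadratic_def fun_eq_iff)
  then show "partial 1 (\<lambda>x. a + x $ 1 *\<^sub>R b + x $ 2 *\<^sub>R c) = (\<lambda>_. b)"
    "partial 2 (\<lambda>x. a + x $ 1 *\<^sub>R b + x $ 2 *\<^sub>R c) = (\<lambda>_. c)"
    by (simp_all add: partial_quadratic)
qed

lemma partial_polys_1: "p \<in> polys 1 \<Longrightarrow> partial i p \<in> polys 0"
  for p :: "real^2 \<Rightarrow> 'b::real_normed_vector"
  using exhaust_2[of i] unfolding polys_1 by (auto simp: partial_affine polys_0)

lemma polys_1_linepath:
  assumes "p \<in> polys 1"
  shows "p (linepath a b t) = (1 - t) *\<^sub>R p a + t *\<^sub>R p b"
  using assms unfolding polys_1 by (auto simp: linepath_def algebra_simps)

lemma polys_1_midpoint: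
  assumes "p \<in> polys 1"
  shows "p (midpoint a b) = (1 / 2) *\<^sub>R (p a + p b)"
  using polys_1_linepath[OF assms, of a b "1/2"] by (simp add: linepath_def midpoint_def scaleR_add_right)

text \<open>Expand about \<open>x0\<close>. On each axis the values at distances \<open>h\<close>
  and \<open>2 * h\<close> separate the linear from the square coefficient, and the point with both
  offsets \<open>h\<close> then isolates the mixed one.\<close>

lemma polys_2_separating:
  assumes p: "p \<in> polys 2" and h: "h \<noteq> 0"
    and z: "\<And>i j. i \<in> {0, 1, 2} \<Longrightarrow> j \<in> {0, 1, 2} \<Longrightarrow> p (x0 + vector [h * i, h * j]) = (0::real)"
  shows "p x = 0"
proof -
  obtain a b c d e f where p: "p = quadratic a b c d e f" using p polys_2 by blast
  define r s where "r = x0 $ 1" and "s = x0 $ 2"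
  define B where "B = b + 2 * r * d + s * e"
  define C where "C = c + r * e + 2 * s * f"
  have ex: "p (x0 + vector [u, v]) = p x0 + u * B + v * C + u\<^sup>2 * d + u * v * e + v\<^sup>2 * f" for u v
    by (simp add: p quadratic_def B_def C_def r_def s_def power2_eq_square algebra_simps)
  have A: "p x0 = 0" using z[of 0 0] ex[of 0 0] by simp
  have 1: "h * B + h\<^sup>2 * d = 0" "2 * (h * B) + 4 * (h\<^sup>2 * d) = 0"
    using z[of 1 0] z[of 2 0] ex[of h 0] ex[of "h * 2" 0] A by (simp_all add: power2_eq_square algebra_simps)
  then have "h * B = 0" "h\<^sup>2 * d = 0" by linarith+
  then have B: "B = 0" "d = 0" using h by auto
  have 2: "h * C + h\<^sup>2 * f = 0" "2 * (h * C) + 4 * (h\<^sup>2 * f) = 0"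
    using z[of 0 1] z[of 0 2] ex[of 0 h] ex[of 0 "h * 2"] A by (simp_all add: power2_eq_square algebra_simps)
  then have "h * C = 0" "h\<^sup>2 * f = 0" by linarith+
  then have C: "C = 0" "f = 0" using h by auto
  have "h * h * e = 0" using z[of 1 1] ex[of h h] A B C by simp
  then have "e = 0" using h by simp
  moreover have "x = x0 + vector [x $ 1 - r, x $ 2 - s]" by (simp add: vec_eq_iff forall_2 r_def s_def)
  ultimately show ?thesis using ex[of "x $ 1 - r" "x $ 2 - s"] A B C by simp
qed

text \<open>The midpoint rule is exact for affine functions. It turns the edge integrals in the
  definitions of the spaces into midpoint values; \<open>f\<close> is compared with \<open>p\<close>
  on the edge only, since it will be a trace.\<close>

lemma edge_integral_affine:
  fixes p :: "real^2 \<Rightarrow> 'b::euclidean_space"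
  assumes "p \<in> polys 1" "\<And>x. x \<in> closed_segment a b \<Longrightarrow> f x = p x"
  shows "edge_integral a b f = norm (b - a) *\<^sub>R p (midpoint a b)"
proof -
  have "((\<lambda>t. (1 - t) *\<^sub>R p a + t *\<^sub>R p b) has_integral
      ((1 - 1\<^sup>2 / 2) *\<^sub>R p a + (1\<^sup>2 / 2) *\<^sub>R p b) - ((0 - 0\<^sup>2 / 2) *\<^sub>R p a + (0\<^sup>2 / 2) *\<^sub>R p b)) {0..1}"
  proof (rule fundamental_theorem_of_calculus)
    fix t :: real
    have "((\<lambda>t. (t - t\<^sup>2 / 2) *\<^sub>R p a + (t\<^sup>2 / 2) *\<^sub>R p b) has_vector_derivative
      (1 - t) *\<^sub>R p a + t *\<^sub>R p b) (at t within {0..1})"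
      by (auto intro!: derivative_eq_intros has_vector_derivative_scaleR[THEN has_vector_derivative_eq_rhs]
          simp: has_real_derivative_iff_has_vector_derivative[symmetric])
    then show "((\<lambda>t. (t - t\<^sup>2 / 2) *\<^sub>R p a + (t\<^sup>2 / 2) *\<^sub>R p b) has_vector_derivative
      (1 - t) *\<^sub>R p a + t *\<^sub>R p b) (at t within {0..1})" .
  qed simp
  then have "integral {0..1} (\<lambda>t. (1 - t) *\<^sub>R p a + t *\<^sub>R p b) = p (midpoint a b)"
    by (simp add: polys_1_midpoint[OF assms(1)] scaleR_add_right integral_unique)
  moreover have "integral {0..1} (\<lambda>t. f (linepath a b t)) = integral {0..1} (\<lambda>t. (1 - t) *\<^sub>R p a + t *\<^sub>R p b)"
  proof (rule Henstock_Kurzweil_Integration.integral_cong)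
    fix t :: real assume "t \<in> {0..1}"
    then show "f (linepath a b t) = (1 - t) *\<^sub>R p a + t *\<^sub>R p b"
      using assms(2)[OF linepath_in_path] polys_1_linepath[OF assms(1)] by simp
  qed
  ultimately show ?thesis by (simp add: edge_integral_def)
qed

text \<open>The clockwise quarter turn, which makes the curl a rotated gradient. It is linear and
  orthogonal with square -1, so it preserves the inner products in the bilinear forms and can be
  undone.\<close>

definition rot :: "real^2 \<Rightarrow> real^2" where
  "rot x = vector [x $ 2, - x $ 1]"

lemma rot_nth [simp]: "rot x $ 1 = x $ 2" "rot x $ 2 = - x $ 1"
  by (simp_all add: rot_def)

lemma linear_rot: "linear rot"
  by (rule linearI) (simp_all add: vec_eq_iff forall_2)

lemma rot_inner_rot: "rot x \<bullet> rot y = x \<bullet> y"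
  by (simp add: inner_vec_def sum_2)

lemma rot_rot [simp]: "rot (rot x) = - x"
  by (simp add: vec_eq_iff forall_2)

lemma rot_eq_0_iff [simp]: "rot x = 0 \<longleftrightarrow> x = 0"
  by (auto simp: vec_eq_iff forall_2)

lemma norm_rot [simp]: "norm (rot x) = norm x"
  by (simp add: norm_eq_sqrt_inner rot_inner_rot)

lemma rot_inner_self [simp]: "rot x \<bullet> x = 0"
  by (simp add: inner_vec_def sum_2)

text \<open>By Lagrange's identity two orthogonal nonzero vectors have nonzero determinant, and
  Cramer's rule finishes. With an edge direction and a normal as the pair, this combines tangential
  and normal information into a statement about the full gradient.\<close>

lemma orthogonal_pair_zero:
  fixes x y w :: "real^2"
  assumes "x \<noteq> 0" "y \<noteq> 0" "x \<bullet> y = 0" "x \<bullet> w = 0" "y \<bullet> w = 0"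
  shows "w = 0"
proof -
  let ?D = "cross2 x y"
  have "?D\<^sup>2 + (x \<bullet> y)\<^sup>2 = (x \<bullet> x) * (y \<bullet> y)"
    by (simp add: cross2_def inner_vec_def sum_2 power2_eq_square algebra_simps)
  then have D: "?D \<noteq> 0" using assms by auto
  have "?D * w $ 1 = y $ 2 * (x \<bullet> w) - x $ 2 * (y \<bullet> w)" "?D * w $ 2 = x $ 1 * (y \<bullet> w) - y $ 1 * (x \<bullet> w)"
    by (simp_all add: cross2_def inner_vec_def sum_2 algebra_simps)
  then show ?thesis using D assms by (auto simp: vec_eq_iff forall_2)
qed

lemma grad_nth [simp]: "grad p x $ i = partial i p x"
  by (simp add: grad_def)

lemma polys_vec:
  fixes f :: "real^2 \<Rightarrow> ('b::real_vector)^2"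
  assumes "\<And>m. (\<lambda>x. f x $ m) \<in> polys k"
  shows "f \<in> polys k"
proof -
  have "\<forall>m. \<exists>c. \<forall>x. f x $ m = (\<Sum>i\<le>k. \<Sum>j\<le>k - i. ((x $ 1) ^ i * (x $ 2) ^ j) *\<^sub>R c i j)"
    using assms unfolding polys_def by blast
  from choice[OF this] obtain c where c: "\<And>m x. f x $ m = (\<Sum>i\<le>k. \<Sum>j\<le>k - i. ((x $ 1) ^ i * (x $ 2) ^ j) *\<^sub>R c m i j)"
    by blast
  show ?thesis unfolding polys_def
    by (auto intro!: exI[of _ "\<lambda>i j. \<chi> m. c m i j"] simp: vec_eq_iff c)
qed

lemma grad_polys_2: "p \<in> polys 2 \<Longrightarrow> grad p \<in> polys 1"
  for p :: "real^2 \<Rightarrow> 'b::real_normed_vector"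
  by (rule polys_vec) (simp only: grad_nth partial_polys_2)

lemma grad_polys_1: "p \<in> polys 1 \<Longrightarrow> grad p \<in> polys 0"
  for p :: "real^2 \<Rightarrow> 'b::real_normed_vector"
  by (rule polys_vec) (simp only: grad_nth partial_polys_1)

text \<open>The derivative along the segment is affine, so the midpoint rule integrates it exactly.
  Vertex values thus determine the tangential derivative at an edge midpoint, which links Morley
  continuity at vertices to Crouzeix-Raviart continuity at midpoints.\<close>

lemma midpoint_rule:
  fixes p :: "real^2 \<Rightarrow> real"
  assumes "p \<in> polys 2"
  shows "p b - p a = grad p (midpoint a b) \<bullet> (b - a)"
proof -
  obtain c0 c1 c2 c3 c4 c5 where p: "p = quadratic c0 c1 c2 c3 c4 c5" using assms polys_2 by blast
  show ?thesis
    by (simp add: inner_vec_def sum_2 p partial_quadratic quadratic_def midpoint_def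
        power2_eq_square field_simps)
qed

lemma partial_linear_image:
  fixes p :: "real^2 \<Rightarrow> 'b::euclidean_space" and L :: "'b \<Rightarrow> 'c::real_normed_vector"
  assumes "linear L" "p differentiable (at x)"
  shows "partial i (\<lambda>x. L (p x)) x = L (partial i p x)"
proof -
  have "((\<lambda>x. L (p x)) has_derivative (\<lambda>h. L (frechet_derivative p (at x) h))) (at x)"
    using bounded_linear.has_derivative[OF linear_conv_bounded_linear[THEN iffD1, OF assms(1)]]
      frechet_derivative_works assms(2) by blast
  then show ?thesis by (subst partial_eqI) (auto simp: partial_def)
qed

lemma partial_nth:
  fixes p :: "real^2 \<Rightarrow> real^2"
  assumes "p differentiable (at x)"
  shows "partial i (\<lambda>y. p y $ j) x = partial i p x $ j"
  by (rule partial_linear_image[OF bounded_linear.linear[OF bounded_linear_vec_nth] assms])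

lemma curl_h_eq_rot: "curl_h \<T> v x = rot (grad_h \<T> v x)"
  by (simp add: curl_h_def rot_def grad_h_def)

text \<open>The defining inequality passes to the closure of the domain, so two points of the edge
  can be compared with each other in both orders.\<close>

lemma outward_unit_normal_orthogonal:
  assumes n: "outward_unit_normal \<Omega> F n" and ab: "a \<in> F" "b \<in> F" "F \<subseteq> frontier \<Omega>"
  shows "n \<bullet> (b - a) = 0"
proof -
  have le: "n \<bullet> (y - x) \<le> 0" if "x \<in> F" "y \<in> closure \<Omega>" for x y
  proof -
    have "closure \<Omega> \<subseteq> {y. n \<bullet> y \<le> n \<bullet> x}"
      by (rule closure_minimal) (use n that(1) in \<open>auto simp: outward_unit_normal_def inner_diff_right closed_halfspace_le\<close>)
    then show ?thesis using that(2) by (auto simp: inner_diff_right)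
  qed
  have "a \<in> closure \<Omega>" "b \<in> closure \<Omega>" using ab by (auto simp: frontier_def)
  then have "n \<bullet> (b - a) \<le> 0" "n \<bullet> (a - b) \<le> 0" using le ab by blast+
  then show ?thesis by (simp add: inner_diff_right)
qed

section \<open>Piecewise polynomials on the mesh\<close>

context convex_mesh begin

text \<open>One function per cell, compared on open cells only, so that values on the skeleton stay
  free. Traces and elementwise derivatives are computed from \<open>P\<close>.\<close>

definition agrees :: "(real^2 \<Rightarrow> 'b) \<Rightarrow> ((real^2) set \<Rightarrow> real^2 \<Rightarrow> 'b) \<Rightarrow> bool" where
  "agrees v P \<longleftrightarrow> (\<forall>K\<in>\<T>. \<forall>x\<in>interior K. v x = P K x)"

lemma agreesD: "agrees v P \<Longrightarrow> K \<in> \<T> \<Longrightarrow> x \<in> interior K \<Longrightarrow> v x = P K x"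
  by (simp add: agrees_def)

lemma pw_polysE:
  assumes "v \<in> pw_polys \<T> k"
  obtains P where "agrees v P" "\<And>K. K \<in> \<T> \<Longrightarrow> P K \<in> polys k"
proof -
  have "\<forall>K\<in>\<T>. \<exists>p. p \<in> polys k \<and> (\<forall>x\<in>interior K. v x = p x)"
    using assms unfolding pw_polys_def by blast
  then obtain P where "\<forall>K\<in>\<T>. P K \<in> polys k \<and> (\<forall>x\<in>interior K. v x = P K x)" by metis
  then show ?thesis using that by (auto simp: agrees_def)
qed

lemma pw_polysI:
  assumes "agrees v P" "\<And>K. K \<in> \<T> \<Longrightarrow> P K \<in> polys k"
  shows "v \<in> pw_polys \<T> k"
  using assms unfolding agrees_def pw_polys_def by blast

lemma pw_polys_mono: "k \<le> m \<Longrightarrow> m \<le> 2 \<Longrightarrow> v \<in> pw_polys \<T> k \<Longrightarrow> v \<in> pw_polys \<T> m"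
  using polys_mono pw_polysE pw_polysI by metis

lemma agrees_comb:
  "agrees v P \<Longrightarrow> agrees w R \<Longrightarrow> agrees (\<lambda>x. s *\<^sub>R v x + t *\<^sub>R w x) (\<lambda>K x. s *\<^sub>R P K x + t *\<^sub>R R K x)"
  by (simp add: agrees_def)

lemma pw_polys_comb:
  assumes "v \<in> pw_polys \<T> k" "w \<in> pw_polys \<T> k"
  shows "(\<lambda>x. s *\<^sub>R v x + t *\<^sub>R w x) \<in> pw_polys \<T> k"
proof -
  obtain P where P: "agrees v P" "\<And>K. K \<in> \<T> \<Longrightarrow> P K \<in> polys k" using pw_polysE[OF assms(1)] by blast
  obtain R where R: "agrees w R" "\<And>K. K \<in> \<T> \<Longrightarrow> R K \<in> polys k" using pw_polysE[OF assms(2)] by blast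
  show ?thesis by (rule pw_polysI[OF agrees_comb[OF P(1) R(1)]]) (intro polys_comb P R)
qed

lemma trace_from_agrees:
  fixes v :: "real^2 \<Rightarrow> 'b::t2_space"
  assumes K: "K \<in> \<T>" and v: "agrees v P" and c: "continuous_on UNIV (P K)" and x: "x \<in> K"
  shows "trace_from K v x = P K x"
  unfolding trace_from_def
proof (rule tendsto_Lim)
  \<comment> \<open>The limit in \<open>trace_from\<close> is determined only if \<open>x\<close> is
    a limit point of the open cell; this holds because a cell is the closure of its
    interior.\<close>
  have "x \<in> closure (interior K)" using x closure_interior_cell[OF K] by simp
  then have "x islimpt interior K"
    by (metis closure_def UnE mem_Collect_eq interior_interior interior_limit_point islimpt_subset
        interior_subset open_interior open_imp_islimpt)
  then show "at x within interior K \<noteq> bot" using trivial_limit_within by blast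
  have "(P K \<longlongrightarrow> P K x) (at x within interior K)"
    using c by (metis UNIV_I continuous_on_def tendsto_within_subset subset_UNIV)
  moreover have "eventually (\<lambda>y. P K y = v y) (at x within interior K)"
    using agreesD[OF v K] by (auto simp: eventually_at_filter)
  ultimately show "(v \<longlongrightarrow> P K x) (at x within interior K)"
    by (rule Lim_transform_eventually)
qed

lemma agrees_partial_h:
  assumes "agrees v P"
  shows "agrees (partial_h \<T> i v) (\<lambda>K. partial i (P K))"
  unfolding agrees_def
proof (intro ballI)
  fix K x assume K: "K \<in> \<T>" "x \<in> interior K"
  have "eventually (\<lambda>y. y \<in> interior K) (nhds x)"
    by (rule eventually_nhds_in_open) (use K in auto)
  then have "eventually (\<lambda>y. v y = P K y) (nhds x)"
    by eventually_elim (use agreesD[OF assms K(1)] in auto)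
  then have "partial i v x = partial i (P K) x" by (rule partial_local)
  then show "partial_h \<T> i v x = partial i (P K) x" using K by (auto simp: partial_h_def)
qed

lemma agrees_grad_h: "agrees v P \<Longrightarrow> agrees (grad_h \<T> v) (\<lambda>K. grad (P K))"
  using agrees_partial_h[of v P] by (auto simp: agrees_def grad_h_def grad_def vec_eq_iff)

lemma agrees_curl_h: "agrees v P \<Longrightarrow> agrees (curl_h \<T> v) (\<lambda>K x. rot (grad (P K) x))"
  using agrees_grad_h[of v P] by (auto simp: agrees_def curl_h_eq_rot)

lemma agrees_linear: "agrees v P \<Longrightarrow> agrees (\<lambda>x. L (v x)) (\<lambda>K x. L (P K x))"
  by (simp add: agrees_def)

lemma agrees_div_h:
  assumes "agrees v P" "\<And>K. K \<in> \<T> \<Longrightarrow> P K \<in> polys 1"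
  shows "agrees (div_h \<T> v) (\<lambda>K x. partial 1 (P K) x $ 1 + partial 2 (P K) x $ 2)"
proof -
  have a: "agrees (partial_h \<T> i (\<lambda>y. v y $ j)) (\<lambda>K. partial i (\<lambda>y. P K y $ j))" for i j
    by (rule agrees_partial_h[OF agrees_linear[OF assms(1)]])
  have "partial i (\<lambda>y. P K y $ j) x = partial i (P K) x $ j" if "K \<in> \<T>" for i j K x
    by (rule partial_nth[OF polys_differentiable[OF assms(2)[OF that]]]) simp
  then show ?thesis using a unfolding agrees_def div_h_def by auto
qed

lemma grad_h_pw_polys_2: "v \<in> pw_polys \<T> 2 \<Longrightarrow> grad_h \<T> v \<in> pw_polys \<T> 1"
  for v :: "real^2 \<Rightarrow> 'b::real_normed_vector"
  using pw_polysE[of v 2] pw_polysI[OF agrees_grad_h] grad_polys_2 by metis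

lemma grad_h_pw_polys_1: "v \<in> pw_polys \<T> 1 \<Longrightarrow> grad_h \<T> v \<in> pw_polys \<T> 0"
  for v :: "real^2 \<Rightarrow> 'b::real_normed_vector"
  using pw_polysE[of v 1] pw_polysI[OF agrees_grad_h] grad_polys_1 by metis

lemma curl_h_pw_polys: "v \<in> pw_polys \<T> 2 \<Longrightarrow> curl_h \<T> v \<in> pw_polys \<T> 1"
proof -
  assume "v \<in> pw_polys \<T> 2"
  then obtain P where P: "agrees v P" "\<And>K. K \<in> \<T> \<Longrightarrow> P K \<in> polys 2" using pw_polysE by blast
  show ?thesis
    by (rule pw_polysI[OF agrees_curl_h[OF P(1)]]) (rule polys_linear_image[OF linear_rot grad_polys_2[OF P(2)]])
qed

lemma div_h_pw_polys: "v \<in> pw_polys \<T> 1 \<Longrightarrow> div_h \<T> v \<in> pw_polys \<T> 0"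
proof -
  assume "v \<in> pw_polys \<T> 1"
  then obtain P where P: "agrees v P" "\<And>K. K \<in> \<T> \<Longrightarrow> P K \<in> polys 1" using pw_polysE by blast
  show ?thesis
  proof (rule pw_polysI[OF agrees_div_h[OF P]])
    fix K assume K: "K \<in> \<T>"
    have "(\<lambda>x. partial i (P K) x $ j) \<in> polys 0" for i j
      using polys_linear_image[OF bounded_linear.linear[OF bounded_linear_vec_nth] partial_polys_1[OF P(2)[OF K]]] .
    from polys_comb[OF this[of 1 1] this[of 2 2], of 1 1]
    show "(\<lambda>x. partial 1 (P K) x $ 1 + partial 2 (P K) x $ 2) \<in> polys 0" by simp
  qed
qed

lemma domain_lebesgue: "\<Omega> \<in> sets lebesgue"
  using lebesgue_domain[OF open_domain bounded_domain] .

text \<open>The skeleton is a finite union of boundaries of convex sets, hence negligible. This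
  reduces claims modulo null sets to claims on open cells.\<close>

lemma AE_domain:
  assumes "\<And>K x. K \<in> \<T> \<Longrightarrow> x \<in> interior K \<Longrightarrow> Q x"
  shows "AE x in lebesgue_on \<Omega>. Q x"
proof -
  have "negligible (\<Union>K\<in>\<T>. frontier K)"
    using finite_cells negligible_convex_frontier convex_cell by (intro negligible_Union) auto
  then have "AE x in lebesgue. x \<notin> (\<Union>K\<in>\<T>. frontier K)"
    using negligible_iff_null_sets AE_not_in by blast
  then have "AE x in lebesgue. x \<in> \<Omega> \<longrightarrow> Q x"
  proof eventually_elim
    fix x assume x: "x \<notin> (\<Union>K\<in>\<T>. frontier K)"
    show "x \<in> \<Omega> \<longrightarrow> Q x"
    proof
      assume "x \<in> \<Omega>"
      then obtain K where K: "K \<in> \<T>" "x \<in> K" using cells_cover closure_subset by blast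
      then have "x \<in> interior K"
        using x closed_cell[OF K(1)] by (auto simp: frontier_def closure_closed)
      then show "Q x" using assms K by blast
    qed
  qed
  then show ?thesis using AE_restrict_space_iff[of \<Omega> lebesgue Q] domain_lebesgue by simp
qed

lemma L2_cong_AE:
  fixes v :: "real^2 \<Rightarrow> 'b::euclidean_space"
  assumes v: "v \<in> L2 \<Omega>" and ae: "AE x in lebesgue_on \<Omega>. v x = w x"
  shows "w \<in> L2 \<Omega>"
proof -
  have "AE x in lebesgue. x \<in> \<Omega> \<longrightarrow> v x = w x"
    using ae AE_restrict_space_iff[of \<Omega> lebesgue "\<lambda>x. v x = w x"] domain_lebesgue by simp
  then have "AE x in lebesgue. (if x \<in> \<Omega> then v x else 0) = (if x \<in> \<Omega> then w x else 0)"
    by eventually_elim auto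
  then have "(\<lambda>x. if x \<in> \<Omega> then w x else 0) \<in> borel_measurable lebesgue"
    by (rule borel_measurable_AE[OF borel_measurable_if_I[OF L2_measurable[OF v] domain_lebesgue]])
  then have m: "w \<in> borel_measurable (lebesgue_on \<Omega>)" by (rule borel_measurable_if_D)
  have "integrable (lebesgue_on \<Omega>) (\<lambda>x. (norm (v x))\<^sup>2) = integrable (lebesgue_on \<Omega>) (\<lambda>x. (norm (w x))\<^sup>2)"
    by (rule integrable_cong_AE) (use L2_measurable[OF v] m ae in \<open>auto elim: eventually_mono\<close>)
  then show ?thesis using m L2_square_integrable[OF v] by (simp add: L2_def)
qed

lemma pw_polys_L2:
  fixes v :: "real^2 \<Rightarrow> 'b::euclidean_space"
  assumes "v \<in> pw_polys \<T> k" "k \<le> 2"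
  shows "v \<in> L2 \<Omega>"
proof -
  obtain P where P: "agrees v P" "\<And>K. K \<in> \<T> \<Longrightarrow> P K \<in> polys k" using pw_polysE[OF assms(1)] by blast
  define t where "t K x = indicator (interior K) x *\<^sub>R P K x" for K x
  have tL: "t K \<in> L2 \<Omega>" if K: "K \<in> \<T>" for K
  proof -
    have c: "continuous_on UNIV (P K)" using polys_continuous[OF P(2)[OF K] assms(2)] .
    have "P K \<in> L2 \<Omega>" by (rule L2_continuous_bounded[OF open_domain bounded_domain c])
    then have L: "P K \<in> borel_measurable (lebesgue_on \<Omega>)" "integrable (lebesgue_on \<Omega>) (\<lambda>x. (norm (P K x))\<^sup>2)"
      by (auto simp: L2_def)
    have iK: "interior K \<in> sets (lebesgue_on \<Omega>)"
      using interior_cell_subset[OF K] by (auto simp: sets_restrict_space borel_open)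
    have m: "t K \<in> borel_measurable (lebesgue_on \<Omega>)"
      unfolding t_def[abs_def] by (intro borel_measurable_scaleR borel_measurable_indicator iK L(1))
    have n: "(\<lambda>x. (norm (t K x))\<^sup>2) \<in> borel_measurable (lebesgue_on \<Omega>)" using m by measurable
    have "integrable (lebesgue_on \<Omega>) (\<lambda>x. (norm (t K x))\<^sup>2)"
      by (rule Bochner_Integration.integrable_bound[OF L(2) n]) (simp add: t_def indicator_def)
    then show ?thesis using m by (simp add: L2_def)
  qed
  have "(\<lambda>x. \<Sum>K\<in>S. t K x) \<in> L2 \<Omega>" if "S \<subseteq> \<T>" "finite S" for S
    using that(2,1)
  proof (induction S rule: finite_induct)
    case empty
    show ?case using L2_continuous_bounded[OF open_domain bounded_domain, of "\<lambda>_. 0"] by simp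
  next
    case (insert K S)
    then show ?case using L2_add[OF tL] by simp
  qed
  then have "(\<lambda>x. \<Sum>K\<in>\<T>. t K x) \<in> L2 \<Omega>" using finite_cells by blast
  moreover have "AE x in lebesgue_on \<Omega>. (\<Sum>K\<in>\<T>. t K x) = v x"
  proof (rule AE_domain)
    fix K x assume K: "K \<in> \<T>" "x \<in> interior K"
    have "(\<Sum>K\<in>\<T>. t K x) = (\<Sum>K'\<in>\<T>. if K' = K then P K x else 0)"
      by (rule sum.cong) (use disjoint_interiors K in \<open>auto simp: t_def indicator_def\<close>)
    also have "\<dots> = P K x" using finite_cells K by simp
    finally show "(\<Sum>K\<in>\<T>. t K x) = v x" using agreesD[OF P(1) K] by simp
  qed
  ultimately show ?thesis by (rule L2_cong_AE)
qed

text \<open>A continuous function that vanishes almost everywhere on an open cell vanishes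
  throughout it. This brings energy arguments, which end modulo null sets, back to pointwise
  identities.\<close>

lemma pw_polys_AE_zero:
  fixes v :: "real^2 \<Rightarrow> 'b::euclidean_space"
  assumes v: "v \<in> pw_polys \<T> k" "k \<le> 2" and ae: "AE x in lebesgue_on \<Omega>. v x = 0"
    and K: "K \<in> \<T>" "x \<in> interior K"
  shows "v x = 0"
proof -
  obtain P where P: "agrees v P" "\<And>K. K \<in> \<T> \<Longrightarrow> P K \<in> polys k" using pw_polysE[OF v(1)] by blast
  have c: "continuous_on UNIV (P K)" using polys_continuous[OF P(2)[OF K(1)] v(2)] .
  have "closed {x. P K x = 0}" using closed_Collect_eq[OF c continuous_on_const] by simp
  moreover have "AE x\<in>interior K in lebesgue. x \<in> {x. P K x = 0}"
  proof -
    have "AE x in lebesgue. x \<in> \<Omega> \<longrightarrow> v x = 0"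
      using ae AE_restrict_space_iff[of \<Omega> lebesgue "\<lambda>x. v x = 0"] domain_lebesgue by simp
    then show ?thesis
      by eventually_elim (use agreesD[OF P(1) K(1)] interior_cell_subset[OF K(1)] in auto)
  qed
  ultimately have "x \<in> {x. P K x = 0}"
    using mem_closed_if_AE_lebesgue_open[OF open_interior, of "{x. P K x = 0}" K x] K by blast
  then show ?thesis using agreesD[OF P(1) K] by simp
qed

text \<open>A 3 by 3 grid inside each open cell determines a quadratic. The values at these finitely
  many points are the separating functionals for the Riesz representation.\<close>

lemma pw_polys_separating:
  obtains X where "finite X" "\<And>v K x. v \<in> pw_polys \<T> 2 \<Longrightarrow> (\<And>x. x \<in> X \<Longrightarrow> v x = (0::real)) \<Longrightarrow>
    K \<in> \<T> \<Longrightarrow> x \<in> interior K \<Longrightarrow> v x = 0"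
proof -
  have "\<exists>X. finite X \<and> X \<subseteq> interior K \<and> (\<forall>p\<in>polys 2. (\<forall>x\<in>X. p x = (0::real)) \<longrightarrow> (\<forall>x. p x = 0))"
    if K: "K \<in> \<T>" for K
  proof -
    obtain x0 where "x0 \<in> interior K" using interior_cell_nonempty[OF K] by blast
    then obtain r where r: "r > 0" "ball x0 r \<subseteq> interior K" using open_contains_ball open_interior by metis
    \<comment> \<open>Grid points then have distance at most \<open>4 * h\<close>, that is
      \<open>r / 2\<close>, from \<open>x0\<close>.\<close>
    define h where "h = r / 8"
    define g where "g q = (x0 + vector [h * fst q, h * snd q] :: real^2)" for q :: "real \<times> real"
    define G :: "real set" where "G = {0, 1, 2}"
    let ?X = "g ` (G \<times> G)"
    have "g q \<in> ball x0 r" if q: "q \<in> G \<times> G" for q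
    proof -
      have ij: "0 \<le> fst q" "fst q \<le> 2" "0 \<le> snd q" "snd q \<le> 2" using q by (auto simp: G_def)
      have "norm (vector [h * fst q, h * snd q] :: real^2) \<le> \<bar>h * fst q\<bar> + \<bar>h * snd q\<bar>"
        using norm_le_l1_cart[of "vector [h * fst q, h * snd q] :: real^2"] by (simp add: sum_2)
      also have "\<dots> = h * (fst q + snd q)" using ij r(1) by (simp add: h_def algebra_simps)
      also have "\<dots> \<le> h * 4" using ij r(1) by (intro mult_left_mono) (auto simp: h_def)
      also have "\<dots> < r" using r(1) by (simp add: h_def)
      finally show ?thesis by (simp add: g_def dist_norm)
    qed
    then have A: "?X \<subseteq> interior K" using r(2) by blast
    have B: "p x = 0" if p: "p \<in> polys 2" "\<forall>x\<in>?X. p x = (0::real)" for p x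
    proof (rule polys_2_separating[OF p(1), of h x0])
      show "h \<noteq> 0" using r(1) by (simp add: h_def)
      show "p (x0 + vector [h * i, h * j]) = 0" if "i \<in> {0, 1, 2}" "j \<in> {0, 1, 2}" for i j
      proof -
        have "g (i, j) \<in> ?X" using that by (intro imageI SigmaI) (simp_all only: G_def)
        then have "p (g (i, j)) = 0" by (rule bspec[OF p(2)])
        then show ?thesis by (simp add: g_def)
      qed
    qed
    have C: "finite ?X" by (intro finite_imageI finite_cartesian_product) (simp_all add: G_def)
    show ?thesis by (rule exI[of _ ?X], intro conjI ballI impI allI A C) (rule B)
  qed
  then obtain X where X: "\<And>K. K \<in> \<T> \<Longrightarrow> finite (X K)" "\<And>K. K \<in> \<T> \<Longrightarrow> X K \<subseteq> interior K"
    "\<And>K p x. K \<in> \<T> \<Longrightarrow> p \<in> polys 2 \<Longrightarrow> (\<And>x. x \<in> X K \<Longrightarrow> p x = (0::real)) \<Longrightarrow> p x = 0" by metis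
  show ?thesis
  proof (rule that[of "\<Union>K\<in>\<T>. X K"])
    show "finite (\<Union>K\<in>\<T>. X K)" using X(1) finite_cells by blast
    fix v :: "real^2 \<Rightarrow> real" and K x
    assume v: "v \<in> pw_polys \<T> 2" "\<And>x. x \<in> (\<Union>K\<in>\<T>. X K) \<Longrightarrow> v x = 0" and K: "K \<in> \<T>" "x \<in> interior K"
    obtain P where P: "agrees v P" "\<And>K. K \<in> \<T> \<Longrightarrow> P K \<in> polys 2" using pw_polysE[OF v(1)] by blast
    have "P K y = 0" if "y \<in> X K" for y
    proof -
      have "v y = 0" using v(2) K(1) that by blast
      then show ?thesis using agreesD[OF P(1) K(1), of y] X(2)[OF K(1)] that by auto
    qed
    then have "P K x = 0" using X(3)[OF K(1) P(2)[OF K(1)]] by blast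
    then show "v x = 0" using agreesD[OF P(1) K] by simp
  qed
qed

end

section \<open>Discrete spaces and the discrete exact sequence\<close>

context convex_mesh begin

lemma edge_properties:
  assumes "closed_segment a b edge_of K"
  shows "a \<noteq> b" "closed_segment a b \<subseteq> K" "midpoint a b \<in> K" "a extreme_point_of K" "b extreme_point_of K"
proof -
  show "a \<noteq> b" using assms by (auto simp: edge_of_def)
  show s: "closed_segment a b \<subseteq> K" using assms by (simp add: edge_of_imp_subset)
  then show "midpoint a b \<in> K" by auto
  have "closed_segment a b face_of K" using assms by (simp add: edge_of_def)
  then show "a extreme_point_of K" "b extreme_point_of K"
    using extreme_point_of_face extreme_point_of_segment by blast+
qed

lemma trace_from_polys:
  fixes v :: "real^2 \<Rightarrow> 'b::euclidean_space"
  assumes "K \<in> \<T>" "agrees v P" "P K \<in> polys k" "k \<le> 2" "x \<in> K"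
  shows "trace_from K v x = P K x"
  by (rule trace_from_agrees[OF assms(1,2) polys_continuous[OF assms(3,4)] assms(5)])

lemma edge_integral_trace:
  fixes v :: "real^2 \<Rightarrow> 'b::euclidean_space"
  assumes "K \<in> \<T>" "agrees v Q" "Q K \<in> polys 1" "closed_segment a b edge_of K"
  shows "edge_integral a b (trace_from K v) = norm (b - a) *\<^sub>R Q K (midpoint a b)"
  by (rule edge_integral_affine[OF assms(3)])
    (use trace_from_polys[OF assms(1-3)] edge_properties(2)[OF assms(4)] in auto)

lemma normal_derivative_data:
  fixes v :: "real^2 \<Rightarrow> real"
  assumes v: "agrees v P" and P: "\<And>K. K \<in> \<T> \<Longrightarrow> P K \<in> polys 2"
  shows "agrees (\<lambda>x. n \<bullet> grad_h \<T> v x) (\<lambda>K x. n \<bullet> grad (P K) x)"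
    "K \<in> \<T> \<Longrightarrow> (\<lambda>x. n \<bullet> grad (P K) x) \<in> polys 1"
proof -
  show "agrees (\<lambda>x. n \<bullet> grad_h \<T> v x) (\<lambda>K x. n \<bullet> grad (P K) x)"
    by (rule agrees_linear[OF agrees_grad_h[OF v]])
  show "(\<lambda>x. n \<bullet> grad (P K) x) \<in> polys 1" if "K \<in> \<T>"
    by (rule polys_linear_image[OF _ grad_polys_2[OF P[OF that]]])
      (auto intro: bounded_linear.linear bounded_linear_inner_right)
qed

text \<open>The conditions of the spaces rewritten for the cell polynomials. Limits disappear here,
  and in the two predicates that follow the midpoint rule removes the edge integrals as
  well.\<close>

definition mwx_traces :: "((real^2) set \<Rightarrow> real^2 \<Rightarrow> real) \<Rightarrow> bool" where
  "mwx_traces P \<longleftrightarrow>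
    (\<forall>K\<in>\<T>. \<forall>K'\<in>\<T>. \<forall>a. a extreme_point_of K \<and> a extreme_point_of K' \<longrightarrow> P K a = P K' a) \<and>
    (\<forall>K\<in>\<T>. \<forall>K'\<in>\<T>. \<forall>a b n. closed_segment a b edge_of K \<and> closed_segment a b edge_of K' \<and>
       unit_normal (closed_segment a b) n \<longrightarrow>
       n \<bullet> grad (P K) (midpoint a b) = n \<bullet> grad (P K') (midpoint a b)) \<and>
    (\<forall>K\<in>\<T>. \<forall>a. a extreme_point_of K \<and> a \<in> frontier \<Omega> \<longrightarrow> P K a = 0)"

definition zero_normal_traces :: "((real^2) set \<Rightarrow> real^2 \<Rightarrow> real) \<Rightarrow> bool" where
  "zero_normal_traces P \<longleftrightarrow>
    (\<forall>K\<in>\<T>. \<forall>a b n. closed_segment a b edge_of K \<and> closed_segment a b \<subseteq> frontier \<Omega> \<and>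
       outward_unit_normal \<Omega> (closed_segment a b) n \<longrightarrow> n \<bullet> grad (P K) (midpoint a b) = 0)"

definition cr0_traces :: "((real^2) set \<Rightarrow> real^2 \<Rightarrow> real^2) \<Rightarrow> bool" where
  "cr0_traces Q \<longleftrightarrow>
    (\<forall>K\<in>\<T>. \<forall>K'\<in>\<T>. \<forall>a b. closed_segment a b edge_of K \<and> closed_segment a b edge_of K' \<longrightarrow>
       Q K (midpoint a b) = Q K' (midpoint a b)) \<and>
    (\<forall>K\<in>\<T>. \<forall>a b. closed_segment a b edge_of K \<and> closed_segment a b \<subseteq> frontier \<Omega> \<longrightarrow>
       Q K (midpoint a b) = 0)"

lemma mwx_tracesD:
  assumes "mwx_traces P"
  shows mwx_traces_vertex: "K \<in> \<T> \<Longrightarrow> K' \<in> \<T> \<Longrightarrow> a extreme_point_of K \<Longrightarrow> a extreme_point_of K' \<Longrightarrow> P K a = P K' a"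
    and mwx_traces_normal: "K \<in> \<T> \<Longrightarrow> K' \<in> \<T> \<Longrightarrow> closed_segment a b edge_of K \<Longrightarrow> closed_segment a b edge_of K' \<Longrightarrow>
      unit_normal (closed_segment a b) n \<Longrightarrow> n \<bullet> grad (P K) (midpoint a b) = n \<bullet> grad (P K') (midpoint a b)"
    and mwx_traces_frontier: "K \<in> \<T> \<Longrightarrow> a extreme_point_of K \<Longrightarrow> a \<in> frontier \<Omega> \<Longrightarrow> P K a = 0"
proof -
  note c = assms[unfolded mwx_traces_def]
  note c1 = conjunct1[OF c] and c2 = conjunct1[OF conjunct2[OF c]] and c3 = conjunct2[OF conjunct2[OF c]]
  show "P K a = P K' a" if "K \<in> \<T>" "K' \<in> \<T>" "a extreme_point_of K" "a extreme_point_of K'"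
    by (rule c1[rule_format, OF that(1,2) conjI[OF that(3,4)]])
  show "n \<bullet> grad (P K) (midpoint a b) = n \<bullet> grad (P K') (midpoint a b)"
    if "K \<in> \<T>" "K' \<in> \<T>" "closed_segment a b edge_of K" "closed_segment a b edge_of K'"
      "unit_normal (closed_segment a b) n"
    by (rule c2[rule_format, OF that(1,2) conjI[OF that(3) conjI[OF that(4,5)]]])
  show "P K a = 0" if "K \<in> \<T>" "a extreme_point_of K" "a \<in> frontier \<Omega>"
    by (rule c3[rule_format, OF that(1) conjI[OF that(2,3)]])
qed

lemma zero_normal_tracesD:
  assumes "zero_normal_traces P" "K \<in> \<T>" "closed_segment a b edge_of K" "closed_segment a b \<subseteq> frontier \<Omega>"
    "outward_unit_normal \<Omega> (closed_segment a b) n"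
  shows "n \<bullet> grad (P K) (midpoint a b) = 0"
  by (rule assms(1)[unfolded zero_normal_traces_def, rule_format, OF assms(2) conjI[OF assms(3) conjI[OF assms(4,5)]]])

lemma cr0_tracesD:
  assumes "cr0_traces Q"
  shows cr0_traces_interior: "K \<in> \<T> \<Longrightarrow> K' \<in> \<T> \<Longrightarrow> closed_segment a b edge_of K \<Longrightarrow> closed_segment a b edge_of K' \<Longrightarrow>
      Q K (midpoint a b) = Q K' (midpoint a b)"
    and cr0_traces_frontier: "K \<in> \<T> \<Longrightarrow> closed_segment a b edge_of K \<Longrightarrow> closed_segment a b \<subseteq> frontier \<Omega> \<Longrightarrow>
      Q K (midpoint a b) = 0"
proof -
  note c = assms[unfolded cr0_traces_def]
  note c1 = conjunct1[OF c] and c2 = conjunct2[OF c]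
  show "Q K (midpoint a b) = Q K' (midpoint a b)"
    if "K \<in> \<T>" "K' \<in> \<T>" "closed_segment a b edge_of K" "closed_segment a b edge_of K'"
    by (rule c1[rule_format, OF that(1,2) conjI[OF that(3,4)]])
  show "Q K (midpoint a b) = 0"
    if "K \<in> \<T>" "closed_segment a b edge_of K" "closed_segment a b \<subseteq> frontier \<Omega>"
    by (rule c2[rule_format, OF that(1) conjI[OF that(2,3)]])
qed

lemma MWX_iff:
  assumes v: "agrees v P" and P: "\<And>K. K \<in> \<T> \<Longrightarrow> P K \<in> polys 2"
  shows "v \<in> MWX \<Omega> \<T> \<longleftrightarrow> mwx_traces P"
proof -
  have 1: "trace_from K v a = P K a" if "K \<in> \<T>" "a extreme_point_of K" for K a
    by (rule trace_from_polys[OF that(1) v P[OF that(1)]]) (use that in \<open>auto simp: extreme_point_of_def\<close>)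
  have 2: "trace_from K (\<lambda>x. n \<bullet> grad_h \<T> v x) (midpoint a b) = n \<bullet> grad (P K) (midpoint a b)"
    if "K \<in> \<T>" "closed_segment a b edge_of K" for K a b n
    by (rule trace_from_polys[OF that(1) normal_derivative_data(1)[OF v P] normal_derivative_data(2)[OF v P that(1)]])
      (use edge_properties[OF that(2)] in auto)
  have 3: "v \<in> pw_polys \<T> 2" by (rule pw_polysI[OF v P])
  show ?thesis unfolding MWX_def MWX_tilde_def mwx_traces_def mem_Collect_eq using 1 2 3
    by (smt (verit, ccfv_threshold))
qed

lemma MWX_pw_polys: "v \<in> MWX \<Omega> \<T> \<Longrightarrow> v \<in> pw_polys \<T> 2"
  by (simp add: MWX_def MWX_tilde_def)

lemma MWX0_MWX: "v \<in> MWX0 \<Omega> \<T> \<Longrightarrow> v \<in> MWX \<Omega> \<T>"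
  by (simp add: MWX0_def)

lemma MWX0_iff:
  assumes v: "agrees v P" and P: "\<And>K. K \<in> \<T> \<Longrightarrow> P K \<in> polys 2"
  shows "v \<in> MWX0 \<Omega> \<T> \<longleftrightarrow> v \<in> MWX \<Omega> \<T> \<and> zero_normal_traces P"
proof -
  have "edge_integral a b (trace_from K (\<lambda>x. n \<bullet> grad_h \<T> v x)) = 0 \<longleftrightarrow> n \<bullet> grad (P K) (midpoint a b) = 0"
    if "K \<in> \<T>" "closed_segment a b edge_of K" for K a b n
    using edge_integral_trace[OF that(1) normal_derivative_data(1)[OF v P] normal_derivative_data(2)[OF v P that(1)] that(2), of n]
      edge_properties(1)[OF that(2)] by simp
  then show ?thesis unfolding MWX0_def zero_normal_traces_def mem_Collect_eq by blast
qed

lemma MWX_comb: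
  assumes v: "v \<in> MWX \<Omega> \<T>" and w: "w \<in> MWX \<Omega> \<T>"
  shows "(\<lambda>x. s * v x + t * w x) \<in> MWX \<Omega> \<T>"
proof -
  obtain P where P: "agrees v P" "\<And>K. K \<in> \<T> \<Longrightarrow> P K \<in> polys 2" using pw_polysE[OF MWX_pw_polys[OF v]] by blast
  obtain R where R: "agrees w R" "\<And>K. K \<in> \<T> \<Longrightarrow> R K \<in> polys 2" using pw_polysE[OF MWX_pw_polys[OF w]] by blast
  let ?S = "\<lambda>K x. s * P K x + t * R K x"
  have S: "agrees (\<lambda>x. s * v x + t * w x) ?S" using agrees_comb[OF P(1) R(1), of s t] by simp
  have S2: "?S K \<in> polys 2" if "K \<in> \<T>" for K using polys_comb[OF P(2) R(2), OF that that, of s t] by simp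
  have g: "grad (?S K) x = s *\<^sub>R grad (P K) x + t *\<^sub>R grad (R K) x" if "K \<in> \<T>" for K x
    using partial_comb[OF polys_differentiable[OF P(2)[OF that] order_refl] polys_differentiable[OF R(2)[OF that] order_refl], where c = s and d = t]
    by (simp add: vec_eq_iff)
  have PR: "mwx_traces P" "mwx_traces R" using v w MWX_iff[OF P] MWX_iff[OF R] by auto
  have "mwx_traces ?S"
    unfolding mwx_traces_def
  proof (intro conjI ballI allI impI; (elim conjE)?)
    fix K K' a assume "K \<in> \<T>" "K' \<in> \<T>" "a extreme_point_of K" "a extreme_point_of K'"
    from mwx_traces_vertex[OF PR(1) this] mwx_traces_vertex[OF PR(2) this]
    show "s * P K a + t * R K a = s * P K' a + t * R K' a" by simp
  next
    fix K K' a b n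
    assume K: "K \<in> \<T>" "K' \<in> \<T>" "closed_segment a b edge_of K" "closed_segment a b edge_of K'"
       "unit_normal (closed_segment a b) n"
    show "n \<bullet> grad (?S K) (midpoint a b) = n \<bullet> grad (?S K') (midpoint a b)"
      by (simp only: g[OF K(1)] g[OF K(2)] inner_add_right inner_scaleR_right
          mwx_traces_normal[OF PR(1) K] mwx_traces_normal[OF PR(2) K])
  next
    fix K a assume "K \<in> \<T>" "a extreme_point_of K" "a \<in> frontier \<Omega>"
    from mwx_traces_frontier[OF PR(1) this] mwx_traces_frontier[OF PR(2) this]
    show "s * P K a + t * R K a = 0" by simp
  qed
  then show ?thesis using MWX_iff[OF S S2] by simp
qed

lemma MWX_zero: "(\<lambda>_. 0) \<in> MWX \<Omega> \<T>"
proof -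
  have a: "agrees (\<lambda>_. 0::real) (\<lambda>K _. 0)" by (simp add: agrees_def)
  have z: "(\<lambda>_. 0::real) \<in> polys 2" using polys_mono[of 0 2 "\<lambda>_. 0"] polys_0 by auto
  show ?thesis using MWX_iff[OF a z] by (simp add: mwx_traces_def)
qed

text \<open>The midpoint rule evaluates the jump and the boundary integral. The flux condition
  inherited from \<open>CR\<close> follows from the vanishing of the full boundary value at the
  midpoint.\<close>

lemma CR0_iff:
  assumes v: "agrees v Q" and Q: "\<And>K. K \<in> \<T> \<Longrightarrow> Q K \<in> polys 1"
  shows "v \<in> CR0 \<Omega> \<T> \<longleftrightarrow> cr0_traces Q"
proof -
  have 1: "edge_integral a b (\<lambda>x. trace_from K v x - trace_from K' v x) = 0 \<longleftrightarrow>
      Q K (midpoint a b) = Q K' (midpoint a b)"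
    if K: "K \<in> \<T>" "closed_segment a b edge_of K" and K': "K' \<in> \<T>" "closed_segment a b edge_of K'" for K K' a b
  proof -
    have "(\<lambda>x. Q K x - Q K' x) \<in> polys 1" using polys_comb[OF Q[OF K(1)] Q[OF K'(1)], of 1 "-1"] by simp
    then have "edge_integral a b (\<lambda>x. trace_from K v x - trace_from K' v x) =
        norm (b - a) *\<^sub>R (Q K (midpoint a b) - Q K' (midpoint a b))"
    proof (rule edge_integral_affine)
      fix x assume "x \<in> closed_segment a b"
      then have "x \<in> K" "x \<in> K'" using edge_properties(2)[OF K(2)] edge_properties(2)[OF K'(2)] by auto
      then show "trace_from K v x - trace_from K' v x = Q K x - Q K' x"
        using trace_from_polys[OF K(1) v Q[OF K(1)]] trace_from_polys[OF K'(1) v Q[OF K'(1)]] by simp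
    qed
    then show ?thesis using edge_properties(1)[OF K(2)] by simp
  qed
  have 2: "edge_integral a b (trace_from K v) = 0 \<longleftrightarrow> Q K (midpoint a b) = 0"
    if "K \<in> \<T>" "closed_segment a b edge_of K" for K a b
    using edge_integral_trace[OF that(1) v Q[OF that(1)] that(2)] edge_properties(1)[OF that(2)] by simp
  have 3: "edge_integral a b (\<lambda>x. trace_from K v x \<bullet> n) = 0"
    if K: "K \<in> \<T>" "closed_segment a b edge_of K" and z: "Q K (midpoint a b) = 0" for K a b n
  proof -
    have "(\<lambda>x. Q K x \<bullet> n) \<in> polys 1"
      by (rule polys_linear_image[OF _ Q[OF K(1)]]) (auto intro: bounded_linear.linear bounded_linear_inner_left)
    then have "edge_integral a b (\<lambda>x. trace_from K v x \<bullet> n) = norm (b - a) *\<^sub>R (Q K (midpoint a b) \<bullet> n)"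
      by (rule edge_integral_affine)
        (use trace_from_polys[OF K(1) v Q[OF K(1)]] edge_properties(2)[OF K(2)] in auto)
    then show ?thesis using z by simp
  qed
  have 4: "v \<in> pw_polys \<T> 1" by (rule pw_polysI[OF v Q])
  then have "v \<in> L2 \<Omega>" using pw_polys_L2[OF 4] by simp
  with 1 2 3 4 show ?thesis unfolding CR0_def CR_def cr0_traces_def mem_Collect_eq Int_iff
    by (intro iffI conjI) blast+
qed

lemma CR0_pw_polys: "v \<in> CR0 \<Omega> \<T> \<Longrightarrow> v \<in> pw_polys \<T> 1"
  by (simp add: CR0_def CR_def)

lemma CR0_comb:
  assumes v: "v \<in> CR0 \<Omega> \<T>" and w: "w \<in> CR0 \<Omega> \<T>"
  shows "(\<lambda>x. s *\<^sub>R v x + t *\<^sub>R w x) \<in> CR0 \<Omega> \<T>"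
proof -
  obtain P where P: "agrees v P" "\<And>K. K \<in> \<T> \<Longrightarrow> P K \<in> polys 1" using pw_polysE[OF CR0_pw_polys[OF v]] by blast
  obtain R where R: "agrees w R" "\<And>K. K \<in> \<T> \<Longrightarrow> R K \<in> polys 1" using pw_polysE[OF CR0_pw_polys[OF w]] by blast
  have S2: "(\<lambda>x. s *\<^sub>R P K x + t *\<^sub>R R K x) \<in> polys 1" if "K \<in> \<T>" for K
    using polys_comb[OF P(2) R(2), OF that that] .
  have PR: "cr0_traces P" "cr0_traces R" using v w CR0_iff[OF P] CR0_iff[OF R] by auto
  have "cr0_traces (\<lambda>K x. s *\<^sub>R P K x + t *\<^sub>R R K x)"
    unfolding cr0_traces_def
  proof (intro conjI ballI allI impI; elim conjE)
    fix K K' a b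
    assume "K \<in> \<T>" "K' \<in> \<T>" "closed_segment a b edge_of K" "closed_segment a b edge_of K'"
    from cr0_traces_interior[OF PR(1) this] cr0_traces_interior[OF PR(2) this]
    show "s *\<^sub>R P K (midpoint a b) + t *\<^sub>R R K (midpoint a b) = s *\<^sub>R P K' (midpoint a b) + t *\<^sub>R R K' (midpoint a b)"
      by simp
  next
    fix K a b
    assume "K \<in> \<T>" "closed_segment a b edge_of K" "closed_segment a b \<subseteq> frontier \<Omega>"
    from cr0_traces_frontier[OF PR(1) this] cr0_traces_frontier[OF PR(2) this]
    show "s *\<^sub>R P K (midpoint a b) + t *\<^sub>R R K (midpoint a b) = 0" by simp
  qed
  then show ?thesis using CR0_iff[OF agrees_comb[OF P(1) R(1)] S2] by simp
qed

lemma CR0_zero: "(\<lambda>_. 0) \<in> CR0 \<Omega> \<T>"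
proof -
  have a: "agrees (\<lambda>_. 0::real^2) (\<lambda>K _. 0)" by (simp add: agrees_def)
  have z: "(\<lambda>_. 0::real^2) \<in> polys 1" using polys_mono[of 0 1 "\<lambda>_. 0"] polys_0 by auto
  show ?thesis using CR0_iff[OF a z] by (simp add: cr0_traces_def)
qed

text \<open>At an edge midpoint the tangential part of the gradient is fixed by the vertex values,
  through the midpoint rule, and the normal part is controlled by the Morley conditions. Together
  they give continuity across interior edges and zero on boundary edges for the whole
  vector.\<close>

lemma curl_h_MWX0:
  assumes "v \<in> MWX0 \<Omega> \<T>"
  shows "curl_h \<T> v \<in> CR0 \<Omega> \<T>"
proof -
  obtain P where P: "agrees v P" "\<And>K. K \<in> \<T> \<Longrightarrow> P K \<in> polys 2"
    using pw_polysE[OF MWX_pw_polys[OF MWX0_MWX[OF assms]]] by blast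
  have v: "v \<in> MWX \<Omega> \<T>" using assms by (rule MWX0_MWX)
  have V: "mwx_traces P" using v MWX_iff[OF P] by simp
  have Z: "zero_normal_traces P" using assms MWX0_iff[OF P] by simp
  have Q: "(\<lambda>x. rot (grad (P K) x)) \<in> polys 1" if "K \<in> \<T>" for K
    by (rule polys_linear_image[OF linear_rot grad_polys_2[OF P(2)[OF that]]])
  have int: "grad (P K) (midpoint a b) = grad (P K') (midpoint a b)"
    if K: "K \<in> \<T>" "closed_segment a b edge_of K" and K': "K' \<in> \<T>" "closed_segment a b edge_of K'" for K K' a b
  proof -
    let ?d = "grad (P K) (midpoint a b) - grad (P K') (midpoint a b)"
    \<comment> \<open>An explicit unit normal of the edge; the jump \<open>?d\<close> will be
      orthogonal both to it and to the edge.\<close>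
    let ?n = "rot (b - a) /\<^sub>R norm (b - a)"
    have ab: "b - a \<noteq> 0" using edge_properties(1)[OF K(2)] by simp
    have "P K a = P K' a" "P K b = P K' b"
      using mwx_traces_vertex[OF V K(1) K'(1)] edge_properties(4,5)[OF K(2)] edge_properties(4,5)[OF K'(2)] by blast+
    then have "(b - a) \<bullet> ?d = 0"
      using midpoint_rule[OF P(2)[OF K(1)], of b a] midpoint_rule[OF P(2)[OF K'(1)], of b a]
      by (simp add: inner_diff_right inner_commute)
    moreover have "unit_normal (closed_segment a b) ?n"
      unfolding unit_normal_def
    proof (intro conjI ballI)
      show "norm ?n = 1" using ab by simp
      fix x y assume "x \<in> closed_segment a b" "y \<in> closed_segment a b"
      then obtain s t where "x = (1 - s) *\<^sub>R a + s *\<^sub>R b" "y = (1 - t) *\<^sub>R a + t *\<^sub>R b"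
        by (auto simp: in_segment)
      then have "y - x = (t - s) *\<^sub>R (b - a)"
        by (simp only: scaleR_left_diff_distrib scaleR_right_diff_distrib) simp
      then show "?n \<bullet> (y - x) = 0" by (simp only: inner_scaleR_left inner_scaleR_right rot_inner_self mult_zero_right)
    qed
    then have "?n \<bullet> grad (P K) (midpoint a b) = ?n \<bullet> grad (P K') (midpoint a b)"
      by (rule mwx_traces_normal[OF V K(1) K'(1) K(2) K'(2)])
    then have "?n \<bullet> ?d = 0" by (simp only: inner_diff_right)
    moreover have "?n \<noteq> 0" using ab by simp
    moreover have "(b - a) \<bullet> ?n = 0" by (simp add: inner_commute[of "b - a"])
    ultimately have "?d = 0" using orthogonal_pair_zero[OF ab] by blast
    then show ?thesis by simp
  qed
  have bd: "grad (P K) (midpoint a b) = 0"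
    if K: "K \<in> \<T>" "closed_segment a b edge_of K" "closed_segment a b \<subseteq> frontier \<Omega>" for K a b
  proof -
    have ab: "b - a \<noteq> 0" using edge_properties(1)[OF K(2)] by simp
    obtain n where n: "outward_unit_normal \<Omega> (closed_segment a b) n" using boundary_edge_normal[OF K] by blast
    have "n \<bullet> (b - a) = 0" by (rule outward_unit_normal_orthogonal[OF n _ _ K(3)]) auto
    moreover have "n \<bullet> grad (P K) (midpoint a b) = 0"
      by (rule zero_normal_tracesD[OF Z K n])
    moreover have "P K a = 0" "P K b = 0"
      using mwx_traces_frontier[OF V K(1)] edge_properties(4,5)[OF K(2)] K(3) by auto
    then have "(b - a) \<bullet> grad (P K) (midpoint a b) = 0"
      using midpoint_rule[OF P(2)[OF K(1)], of b a] by (simp add: inner_commute)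
    moreover have "n \<noteq> 0" using n by (auto simp: outward_unit_normal_def)
    ultimately show ?thesis using orthogonal_pair_zero[of n "b - a"] ab by blast
  qed
  have "cr0_traces (\<lambda>K x. rot (grad (P K) x))"
    unfolding cr0_traces_def
  proof (intro conjI ballI allI impI; elim conjE)
    fix K K' a b
    assume K: "K \<in> \<T>" "K' \<in> \<T>" "closed_segment a b edge_of K" "closed_segment a b edge_of K'"
    show "rot (grad (P K) (midpoint a b)) = rot (grad (P K') (midpoint a b))"
      by (simp only: int[OF K(1,3,2,4)])
  next
    fix K a b
    assume K: "K \<in> \<T>" "closed_segment a b edge_of K" "closed_segment a b \<subseteq> frontier \<Omega>"
    show "rot (grad (P K) (midpoint a b)) = 0" by (simp only: bd[OF K] linear_0[OF linear_rot])
  qed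
  then show ?thesis using CR0_iff[OF agrees_curl_h[OF P(1)] Q] by simp
qed

text \<open>The mixed second derivatives of a quadratic in either order are its coefficient
  \<open>c4\<close>, so they cancel.\<close>

lemma div_h_curl_h:
  assumes "v \<in> pw_polys \<T> 2"
  shows "K \<in> \<T> \<Longrightarrow> x \<in> interior K \<Longrightarrow> div_h \<T> (curl_h \<T> v) x = 0"
proof -
  assume K: "K \<in> \<T>" "x \<in> interior K"
  obtain P where P: "agrees v P" "\<And>K. K \<in> \<T> \<Longrightarrow> P K \<in> polys 2" using pw_polysE[OF assms] by blast
  have Q: "(\<lambda>x. rot (grad (P K) x)) \<in> polys 1" if "K \<in> \<T>" for K
    by (rule polys_linear_image[OF linear_rot grad_polys_2[OF P(2)[OF that]]])
  obtain c0 c1 c2 c3 c4 c5 where p: "P K = quadratic c0 c1 c2 c3 c4 c5" using P(2)[OF K(1)] polys_2 by blast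
  have "partial i (\<lambda>x. rot (grad (P K) x)) x $ j = partial i (\<lambda>y. rot (grad (P K) y) $ j) x" for i j
    by (rule partial_nth[symmetric]) (rule polys_differentiable[OF Q[OF K(1)]], simp)
  then have "div_h \<T> (curl_h \<T> v) x =
      partial 1 (\<lambda>y. partial 2 (P K) y) x + partial 2 (\<lambda>y. - partial 1 (P K) y) x"
    using agreesD[OF agrees_div_h[OF agrees_curl_h[OF P(1)] Q] K] by simp
  also have "\<dots> = c4 + - c4"
  proof -
    have e1: "partial 2 (P K) = (\<lambda>x. c2 + x $ 1 *\<^sub>R c4 + x $ 2 *\<^sub>R (2 *\<^sub>R c5))"
      unfolding p partial_quadratic by (rule refl)
    have e2: "(\<lambda>y. - partial 1 (P K) y) = (\<lambda>x. - c1 + x $ 1 *\<^sub>R (- (2 *\<^sub>R c3)) + x $ 2 *\<^sub>R (- c4))"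
      unfolding p partial_quadratic by simp
    show ?thesis unfolding e2 unfolding e1 partial_affine by (rule refl)
  qed
  finally show ?thesis by simp
qed

end

section \<open>Potentials on single cells and fields of constant divergence\<close>

lemma quadratic_potential:
  assumes "w \<in> polys 1" "\<And>x. partial 1 w x $ 2 = partial 2 w x $ (1::2)"
  obtains p :: "real^2 \<Rightarrow> real" where "p \<in> polys 2" "grad p = w"
proof -
  obtain a b c where w: "w = (\<lambda>x. a + x $ 1 *\<^sub>R b + x $ 2 *\<^sub>R c)" using assms(1) polys_1 by blast
  have bc: "b $ 2 = c $ 1" using assms(2)[of 0] unfolding w partial_affine .
  let ?p = "quadratic 0 (a $ 1) (a $ 2) (b $ 1 / 2) (b $ 2) (c $ 2 / 2)"
  have "grad ?p x = w x" for x
    by (simp add: vec_eq_iff forall_2 partial_quadratic w bc)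
  moreover have "?p \<in> polys 2" using polys_2 by blast
  ultimately show ?thesis using that by blast
qed

lemma cross2_midpoint: "cross2 (midpoint a b - p) (b - a) = cross2 (a - p) (b - p)"
  by (simp add: cross2_def midpoint_def field_simps)

context convex_mesh begin

text \<open>\<open>g\<close> is the gradient of the affine interpolant of \<open>f\<close> at the
  three vertices. Affine independence provides a linear functional with the prescribed differences,
  and its adjoint turns it into a vector.\<close>

lemma cell_vertex_interpolation:
  assumes K: "K \<in> \<T>"
  obtains g :: "real^2" where
    "\<And>a b. a extreme_point_of K \<Longrightarrow> b extreme_point_of K \<Longrightarrow> g \<bullet> (b - a) = f b - (f a :: real)"
proof -
  obtain C where C: "\<not> affine_dependent C" "K = convex hull C" "card C = 3"
    using cell_simplex[OF K] unfolding simplex by auto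
  then obtain c where c: "c \<in> C" by fastforce
  let ?S = "(\<lambda>x. - c + x) ` (C - {c})"
  have "independent ?S"
    using C(1) affine_dependent_iff_dependent[of c "C - {c}"] c by (simp add: insert_absorb)
  then obtain l where l: "linear l" "\<forall>x\<in>?S. l x = f (c + x) - f c"
    using linear_independent_extend[of ?S "\<lambda>x. f (c + x) - f c"] by blast
  have lc: "l (x - c) = f x - f c" if "x \<in> C" for x
  proof (cases "x = c")
    case True
    then show ?thesis using linear_0[OF l(1)] by simp
  next
    case False
    then have "- c + x \<in> ?S" using that by blast
    then show ?thesis using l(2) by fastforce
  qed
  have "adjoint l 1 \<bullet> (b - a) = f b - f a" if ab: "a extreme_point_of K" "b extreme_point_of K" for a b
  proof -
    have "a \<in> C" "b \<in> C" using ab C(2) extreme_point_of_convex_hull by blast+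
    then have "l (b - c) = f b - f c" "l (a - c) = f a - f c" using lc by blast+
    then have "l ((b - c) - (a - c)) = f b - f a"
      unfolding linear_diff[OF l(1), of "b - c" "a - c"] by linarith
    then have "l (b - a) = f b - f a" by simp
    then show ?thesis using adjoint_works[OF l(1), of "b - a" 1] by (simp add: inner_commute)
  qed
  then show ?thesis using that by blast
qed

text \<open>Subtracting the field \<open>(c / 2) (x - p)\<close>, whose tangential part on boundary edges is known,
  makes \<open>\<phi>\<close> divergence free; the vertex values of a potential of its rotation then force \<open>c = 0\<close>.\<close>

lemma CR0_const_div:
  assumes \<phi>: "\<phi> \<in> CR0 \<Omega> \<T>" and div: "\<And>K x. K \<in> \<T> \<Longrightarrow> x \<in> interior K \<Longrightarrow> div_h \<T> \<phi> x = c"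
  obtains v where "v \<in> MWX0 \<Omega> \<T>" "\<And>K x. K \<in> \<T> \<Longrightarrow> x \<in> interior K \<Longrightarrow> curl_h \<T> v x = \<phi> x"
proof -
  obtain Q where Q: "agrees \<phi> Q" "\<And>K. K \<in> \<T> \<Longrightarrow> Q K \<in> polys 1" using pw_polysE[OF CR0_pw_polys[OF \<phi>]] by blast
  have CR: "cr0_traces Q" using \<phi> CR0_iff[OF Q] by simp
  obtain p where p: "p \<in> \<Omega>" using nonempty_domain by blast
  \<comment> \<open>The gradient to be integrated: \<open>- rot\<close> inverts the rotation in the
    curl. The field \<open>(c / 2) (x - p)\<close> has divergence \<open>c\<close>, so after the
    correction \<open>w K\<close> has a symmetric Jacobian and hence a quadratic potential.\<close>
  define w where "w K x = - rot (Q K x) + (c / 2) *\<^sub>R rot (x - p)" for K x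
  have w1: "w K \<in> polys 1" if K: "K \<in> \<T>" for K
  proof -
    have "(\<lambda>x. rot (x - p)) = (\<lambda>x. rot (- p) + x $ 1 *\<^sub>R rot (axis 1 1) + x $ 2 *\<^sub>R rot (axis 2 1))"
      by (simp add: fun_eq_iff vec_eq_iff forall_2 axis_def)
    then have "(\<lambda>x. rot (x - p)) \<in> polys 1" using polys_1 by blast
    from polys_comb[OF polys_linear_image[OF linear_rot Q(2)[OF K]] this, of "-1" "c / 2"]
    show ?thesis by (simp add: w_def[abs_def])
  qed
  have "partial 1 (w K) x $ 2 = partial 2 (w K) x $ 1" if K: "K \<in> \<T>" for K x
  proof -
    obtain a b d where q: "Q K = (\<lambda>x. a + x $ 1 *\<^sub>R b + x $ 2 *\<^sub>R d)" using Q(2)[OF K] polys_1 by blast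
    obtain x0 where x0: "x0 \<in> interior K" using interior_cell_nonempty[OF K] by blast
    have bd: "b $ 1 + d $ 2 = c"
      using agreesD[OF agrees_div_h[OF Q] K x0] div[OF K x0] by (simp add: q partial_affine)
    have "w K = (\<lambda>x. (- rot a - (c / 2) *\<^sub>R rot p) + x $ 1 *\<^sub>R (- rot b + (c / 2) *\<^sub>R rot (axis 1 1))
        + x $ 2 *\<^sub>R (- rot d + (c / 2) *\<^sub>R rot (axis 2 1)))"
      by (simp add: w_def fun_eq_iff q vec_eq_iff forall_2 axis_def field_simps)
    then show ?thesis using bd by (simp only: partial_affine) (simp add: axis_def)
  qed
  then have "\<exists>P. P \<in> polys 2 \<and> grad P = w K" if "K \<in> \<T>" for K
    using quadratic_potential[OF w1[OF that]] that by metis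
  then obtain P :: "(real^2) set \<Rightarrow> real^2 \<Rightarrow> real" where
    P: "\<And>K. K \<in> \<T> \<Longrightarrow> P K \<in> polys 2" "\<And>K. K \<in> \<T> \<Longrightarrow> grad (P K) = w K" by metis
  \<comment> \<open>The cell potentials \<open>P K\<close> are not yet related across edges. Their
    affine interpolants have constant gradients \<open>g K\<close>, whose tangential components
    agree across an edge: by the midpoint rule they are those of \<open>w K\<close> at the midpoint,
    where \<open>Q\<close> is continuous.\<close>
  have "\<exists>g. \<forall>a b. a extreme_point_of K \<longrightarrow> b extreme_point_of K \<longrightarrow> g \<bullet> (b - a) = P K b - P K a"
    if "K \<in> \<T>" for K
    using cell_vertex_interpolation[OF that, of "P K"] by metis
  then obtain g where g: "\<And>K a b. K \<in> \<T> \<Longrightarrow> a extreme_point_of K \<Longrightarrow> b extreme_point_of K \<Longrightarrow>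
      g K \<bullet> (b - a) = P K b - P K a" by metis
  have ge: "g K \<bullet> (b - a) = w K (midpoint a b) \<bullet> (b - a)"
    if "K \<in> \<T>" "closed_segment a b edge_of K" for K a b
    using g[OF that(1) edge_properties(4,5)[OF that(2)]] midpoint_rule[OF P(1)[OF that(1)], of b a]
      P(2)[OF that(1)] by simp
  have tang: "g K \<bullet> (b - a) = g K' \<bullet> (b - a)"
    if K: "K \<in> \<T>" "K' \<in> \<T>" "closed_segment a b edge_of K" "closed_segment a b edge_of K'" for K K' a b
    using cr0_traces_interior[OF CR K] ge[OF K(1,3)] ge[OF K(2,4)] by (simp add: w_def)
  obtain u where u: "continuous_on (closure \<Omega>) u"
    "\<And>K x y. K \<in> \<T> \<Longrightarrow> x \<in> K \<Longrightarrow> y \<in> K \<Longrightarrow> u y - u x = g K \<bullet> (y - x)"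
    using exists_potential[of g, OF tang] by blast
  have uF: "continuous_on (frontier \<Omega>) u"
    by (rule continuous_on_subset[OF u(1)]) (auto simp: frontier_def)
  \<comment> \<open>On a boundary edge \<open>Q K\<close> vanishes at the midpoint, so only the
    radial correction contributes. This gives the form required by
    \<open>boundary_slope_zero\<close> with \<open>\<kappa> = - c / 2\<close>.\<close>
  have slope: "u y - u x = - c / 2 * cross2 (x - p) (y - p)"
    if K: "K \<in> \<T>" "closed_segment a b edge_of K" "closed_segment a b \<subseteq> frontier \<Omega>"
      and xy: "x \<in> closed_segment a b" "y \<in> closed_segment a b" for K a b x y
  proof -
    have "Q K (midpoint a b) = 0" by (rule cr0_traces_frontier[OF CR K])
    then have "w K (midpoint a b) = (c / 2) *\<^sub>R rot (midpoint a b - p)"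
      by (simp add: w_def linear_0[OF linear_rot])
    then have "g K \<bullet> (b - a) = (c / 2) * (rot (midpoint a b - p) \<bullet> (b - a))" using ge[OF K(1,2)] by simp
    also have "rot (midpoint a b - p) \<bullet> (b - a) = - cross2 (midpoint a b - p) (b - a)"
      by (simp add: cross2_def inner_vec_def sum_2 algebra_simps)
    finally have gab: "g K \<bullet> (b - a) = - c / 2 * cross2 (a - p) (b - p)" by (simp add: cross2_midpoint)
    obtain s t where st: "x = (1 - s) *\<^sub>R a + s *\<^sub>R b" "y = (1 - t) *\<^sub>R a + t *\<^sub>R b"
      using xy by (auto simp: in_segment)
    then have "y - x = (t - s) *\<^sub>R (b - a)"
      by (simp only: scaleR_left_diff_distrib scaleR_right_diff_distrib) simp
    moreover have "x \<in> K" "y \<in> K" using xy edge_properties(2)[OF K(2)] by auto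
    ultimately have "u y - u x = (t - s) * (g K \<bullet> (b - a))"
      using u(2)[OF K(1)] by (simp only: inner_scaleR_right)
    moreover have "cross2 (x - p) (y - p) = (t - s) * cross2 (a - p) (b - p)"
      unfolding st cross2_def by (simp add: algebra_simps)
    ultimately show ?thesis using gab by simp
  qed
  have "- c / 2 = 0" by (rule boundary_slope_zero[OF p uF slope])
  then have c0: "c = 0" by simp
  have w0: "w K x = - rot (Q K x)" for K x by (simp add: w_def c0)
  have "u y = u x"
    if "K \<in> \<T>" "closed_segment a b edge_of K" "closed_segment a b \<subseteq> frontier \<Omega>"
      "x \<in> closed_segment a b" "y \<in> closed_segment a b" for K a b x y
    using slope[OF that] c0 by simp
  then obtain m where m: "\<And>x. x \<in> frontier \<Omega> \<Longrightarrow> u x = m" using boundary_constant[OF uF] by metis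
  \<comment> \<open>One constant per cell moves the vertex values of \<open>P K\<close> to those of
    \<open>u - m\<close>. This yields continuity at shared vertices and zero at boundary vertices
    simultaneously.\<close>
  have "\<exists>d. \<forall>a. a extreme_point_of K \<longrightarrow> P K a + d = u a - m" if K: "K \<in> \<T>" for K
  proof (cases "\<exists>a. a extreme_point_of K")
    case True
    then obtain a where a: "a extreme_point_of K" by blast
    have "P K b + (u a - m - P K a) = u b - m" if b: "b extreme_point_of K" for b
      using g[OF K a b] u(2)[OF K, of a b] a b by (simp add: extreme_point_of_def)
    then show ?thesis by blast
  qed auto
  then obtain d where d: "\<And>K a. K \<in> \<T> \<Longrightarrow> a extreme_point_of K \<Longrightarrow> P K a + d K = u a - m" by metis
  define R where "R K x = P K x + d K" for K x
  have R2: "R K \<in> polys 2" if "K \<in> \<T>" for K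
  proof -
    have "(\<lambda>_. d K) \<in> polys 2" using polys_mono[of 0 2 "\<lambda>_. d K"] polys_0 by auto
    from polys_comb[OF P(1)[OF that] this, of 1 1] show ?thesis by (simp add: R_def[abs_def])
  qed
  have gR: "grad (R K) x = - rot (Q K x)" if K: "K \<in> \<T>" for K x
  proof -
    have "partial i (R K) x = partial i (P K) x" for i
      using partial_comb[OF polys_differentiable[OF P(1)[OF K] order_refl] differentiable_const[of "d K"], where c = 1 and d = 1]
        partial_eqI[OF has_derivative_const[of "d K"]]
      by (simp add: R_def[abs_def])
    then have "grad (R K) x = grad (P K) x" by (simp add: vec_eq_iff)
    then show ?thesis using P(2)[OF K] w0 by simp
  qed
  \<comment> \<open>At most one open cell contains \<open>x\<close>; on the skeleton the value is
    arbitrary.\<close>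
  define v where "v x = R (SOME K. K \<in> \<T> \<and> x \<in> interior K) x" for x
  have v: "agrees v R"
    unfolding agrees_def
  proof (intro ballI)
    fix K x assume K: "K \<in> \<T>" "x \<in> interior K"
    have "(SOME K. K \<in> \<T> \<and> x \<in> interior K) = K"
      by (rule some_equality) (use K disjoint_interiors in auto)
    then show "v x = R K x" by (simp add: v_def)
  qed
  have "mwx_traces R"
    unfolding mwx_traces_def
  proof (intro conjI ballI allI impI; (elim conjE)?)
    fix K K' a assume "K \<in> \<T>" "K' \<in> \<T>" "a extreme_point_of K" "a extreme_point_of K'"
    then show "R K a = R K' a" using d by (simp add: R_def)
  next
    fix K K' a b n
    assume K: "K \<in> \<T>" "K' \<in> \<T>" "closed_segment a b edge_of K" "closed_segment a b edge_of K'"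
    show "n \<bullet> grad (R K) (midpoint a b) = n \<bullet> grad (R K') (midpoint a b)"
      by (simp only: gR[OF K(1)] gR[OF K(2)] cr0_traces_interior[OF CR K])
  next
    fix K a assume "K \<in> \<T>" "a extreme_point_of K" "a \<in> frontier \<Omega>"
    then show "R K a = 0" using d m by (simp add: R_def)
  qed
  then have vM: "v \<in> MWX \<Omega> \<T>" using MWX_iff[OF v R2] by simp
  have "zero_normal_traces R"
    unfolding zero_normal_traces_def
  proof (intro ballI allI impI; elim conjE)
    fix K a b n
    assume K: "K \<in> \<T>" "closed_segment a b edge_of K" "closed_segment a b \<subseteq> frontier \<Omega>"
    show "n \<bullet> grad (R K) (midpoint a b) = 0"
      by (simp add: gR[OF K(1)] cr0_traces_frontier[OF CR K] linear_0[OF linear_rot])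
  qed
  then have "v \<in> MWX0 \<Omega> \<T>" using MWX0_iff[OF v R2] vM by simp
  moreover have "curl_h \<T> v x = \<phi> x" if K: "K \<in> \<T>" "x \<in> interior K" for K x
    using agreesD[OF agrees_curl_h[OF v] K] gR[OF K(1)] agreesD[OF Q(1) K]
    by (simp add: linear_neg[OF linear_rot])
  ultimately show ?thesis using that by blast
qed

end

section \<open>Decoupling\<close>

lemma smooth_zero: "smooth (\<lambda>_. 0)"
  using smooth_comb[OF smooth_coordinate smooth_coordinate, of 0 1 0 1] by simp

text \<open>The common frame of the existence results, with \<open>D\<close> the weak gradient, the
  elementwise curl or the mean-free divergence. Linearity of \<open>D\<close> is asked almost
  everywhere only, since \<open>weak_grad\<close> is a separate choice for each function.\<close>

lemma riesz_L2:
  fixes V :: "(real^2 \<Rightarrow> 'b::real_vector) set"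
    and D :: "(real^2 \<Rightarrow> 'b) \<Rightarrow> real^2 \<Rightarrow> 'c::euclidean_space"
    and F :: "(real^2 \<Rightarrow> 'b) \<Rightarrow> real" and lf :: "'i \<Rightarrow> (real^2 \<Rightarrow> 'b) \<Rightarrow> real"
  assumes \<Omega>: "\<Omega> \<in> sets lebesgue" and X: "finite X" and V: "V \<noteq> {}"
    and comb: "\<And>c d v w. v \<in> V \<Longrightarrow> w \<in> V \<Longrightarrow> (\<lambda>x. c *\<^sub>R v x + d *\<^sub>R w x) \<in> V"
    and DL: "\<And>v. v \<in> V \<Longrightarrow> D v \<in> L2 \<Omega>"
    and Dcomb: "\<And>c d v w. v \<in> V \<Longrightarrow> w \<in> V \<Longrightarrow>
      AE x in lebesgue_on \<Omega>. D (\<lambda>x. c *\<^sub>R v x + d *\<^sub>R w x) x = c *\<^sub>R D v x + d *\<^sub>R D w x"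
    and lcomb: "\<And>x c d v w. x \<in> X \<Longrightarrow> v \<in> V \<Longrightarrow> w \<in> V \<Longrightarrow>
      lf x (\<lambda>x. c *\<^sub>R v x + d *\<^sub>R w x) = c * lf x v + d * lf x w"
    and sep: "\<And>v. v \<in> V \<Longrightarrow> (\<And>x. x \<in> X \<Longrightarrow> lf x v = 0) \<Longrightarrow> AE x in lebesgue_on \<Omega>. D v x = 0"
    and Fcomb: "\<And>c d v w. v \<in> V \<Longrightarrow> w \<in> V \<Longrightarrow> F (\<lambda>x. c *\<^sub>R v x + d *\<^sub>R w x) = c * F v + d * F w"
    and F0: "\<And>v. v \<in> V \<Longrightarrow> AE x in lebesgue_on \<Omega>. D v x = 0 \<Longrightarrow> F v = 0"
  shows "\<exists>w\<in>V. \<forall>v\<in>V. L2_inner \<Omega> (D w) (D v) = F v"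
proof (rule riesz_finite[where comb = "\<lambda>c v d w x. c *\<^sub>R v x + d *\<^sub>R w x" and lf = lf, OF X V])
  show "L2_inner \<Omega> (D (\<lambda>x. c *\<^sub>R v x + d *\<^sub>R w x)) (D z) = c * L2_inner \<Omega> (D v) (D z) + d * L2_inner \<Omega> (D w) (D z)"
    if "v \<in> V" "w \<in> V" "z \<in> V" for c d v w z
  proof -
    have "L2_inner \<Omega> (D (\<lambda>x. c *\<^sub>R v x + d *\<^sub>R w x)) (D z) = L2_inner \<Omega> (\<lambda>x. c *\<^sub>R D v x + d *\<^sub>R D w x) (D z)"
      by (rule L2_inner_cong_AE[OF \<Omega> DL[OF comb[OF that(1,2)]] DL[OF that(3)]
            L2_comb[OF DL[OF that(1)] DL[OF that(2)]] DL[OF that(3)] Dcomb[OF that(1,2)]]) simp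
    then show ?thesis using L2_inner_comb_left[OF DL DL DL, OF that] by simp
  qed
  show "L2_inner \<Omega> (D v) (D v) = 0" if "v \<in> V" "\<And>x. x \<in> X \<Longrightarrow> lf x v = 0" for v
    by (rule L2_inner_eq_0_AE[OF sep[OF that]])
  show "F v = 0" if "v \<in> V" "L2_inner \<Omega> (D v) (D v) = 0" for v
    by (rule F0[OF that(1) L2_inner_self_eq_0[OF DL[OF that(1)] that(2)]])
qed (use comb lcomb Fcomb L2_inner_commute L2_inner_nonneg in auto)

lemma H10_zero:
  assumes \<Omega>: "open \<Omega>" "bounded \<Omega>"
  shows "(\<lambda>_. 0) \<in> H10 \<Omega>"
proof -
  have L: "(\<lambda>_. 0::real) \<in> L2 \<Omega>" "(\<lambda>_. 0::real^2) \<in> L2 \<Omega>"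
    by (intro L2_continuous_bounded[OF \<Omega>] continuous_on_const)+
  then have "is_weak_grad \<Omega> (\<lambda>_. 0) (\<lambda>_. 0)" by (simp add: is_weak_grad_def L2_inner_def)
  then have H1: "(\<lambda>_. 0) \<in> H1 \<Omega>" using L by (auto simp: H1_def)
  have t: "(\<lambda>_. 0) \<in> test_functions \<Omega>" using smooth_zero by (simp add: test_functions_def)
  have "AE x in lebesgue_on \<Omega>. weak_grad \<Omega> (\<lambda>_. 0) x - grad (\<lambda>_. 0) x = 0"
  proof -
    have "grad (\<lambda>_. 0::real) x = 0" for x
      using partial_eqI[OF has_derivative_const[of "0::real"]] by (simp add: vec_eq_iff grad_def)
    then show ?thesis using is_weak_grad_zero[OF \<Omega> weak_grad[OF \<Omega> H1]] by simp
  qed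
  then have "L2_inner \<Omega> (\<lambda>x. weak_grad \<Omega> (\<lambda>_. 0) x - grad (\<lambda>_. 0) x)
      (\<lambda>x. weak_grad \<Omega> (\<lambda>_. 0) x - grad (\<lambda>_. 0) x) = 0" by (rule L2_inner_eq_0_AE)
  then show ?thesis
    unfolding H10_def using H1 t by (intro CollectI conjI exI[of _ "\<lambda>_ _. 0"] allI) (auto simp: L2_inner_def)
qed

section \<open>Linearity of the elementwise operators and rotated forms\<close>

context convex_mesh begin

lemmas domain = open_domain bounded_domain

lemma partial_h_comb:
  fixes v w :: "real^2 \<Rightarrow> 'b::real_normed_vector"
  assumes v: "v \<in> pw_polys \<T> k" and w: "w \<in> pw_polys \<T> k" and k: "k \<le> 2"
  shows "partial_h \<T> i (\<lambda>x. c *\<^sub>R v x + d *\<^sub>R w x) x = c *\<^sub>R partial_h \<T> i v x + d *\<^sub>R partial_h \<T> i w x"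
proof (cases "\<exists>K\<in>\<T>. x \<in> interior K")
  case True
  then obtain K where K: "K \<in> \<T>" "x \<in> interior K" by blast
  have diff: "f differentiable (at x)" if f: "f \<in> pw_polys \<T> k" for f :: "real^2 \<Rightarrow> 'b"
  proof -
    obtain P where P: "agrees f P" "\<And>K. K \<in> \<T> \<Longrightarrow> P K \<in> polys k" using pw_polysE[OF f] by blast
    have "P K differentiable (at x)" by (rule polys_differentiable[OF P(2)[OF K(1)] k])
    then obtain L where "(P K has_derivative L) (at x)" by (auto simp: differentiable_def)
    then have "(f has_derivative L) (at x)"
      by (rule has_derivative_transform_within_open[OF _ open_interior K(2)]) (use agreesD[OF P(1) K(1)] in simp)
    then show ?thesis by (rule differentiableI)
  qed
  show ?thesis using partial_comb[OF diff[OF v] diff[OF w], where i = i and c = c and d = d] True by (simp add: partial_h_def)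
next
  case False
  then show ?thesis by (simp add: partial_h_def)
qed

lemma grad_h_comb:
  fixes v w :: "real^2 \<Rightarrow> 'b::real_normed_vector"
  assumes "v \<in> pw_polys \<T> k" "w \<in> pw_polys \<T> k" "k \<le> 2"
  shows "grad_h \<T> (\<lambda>x. c *\<^sub>R v x + d *\<^sub>R w x) = (\<lambda>x. c *\<^sub>R grad_h \<T> v x + d *\<^sub>R grad_h \<T> w x)"
  by (simp add: fun_eq_iff vec_eq_iff grad_h_def partial_h_comb[OF assms])

lemma curl_h_comb:
  assumes "v \<in> pw_polys \<T> 2" "w \<in> pw_polys \<T> 2"
  shows "curl_h \<T> (\<lambda>x. c *\<^sub>R v x + d *\<^sub>R w x) = (\<lambda>x. c *\<^sub>R curl_h \<T> v x + d *\<^sub>R curl_h \<T> w x)"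
  unfolding curl_h_eq_rot[abs_def] grad_h_comb[OF assms order_refl]
  by (simp add: linear_add[OF linear_rot] linear_scale[OF linear_rot])

lemma div_h_comb:
  assumes v: "v \<in> pw_polys \<T> 1" and w: "w \<in> pw_polys \<T> 1"
  shows "div_h \<T> (\<lambda>x. c *\<^sub>R v x + d *\<^sub>R w x) x = c * div_h \<T> v x + d * div_h \<T> w x"
proof -
  have n: "(\<lambda>x. f x $ j) \<in> pw_polys \<T> 1" if f: "f \<in> pw_polys \<T> 1" for f :: "real^2 \<Rightarrow> real^2" and j
  proof -
    obtain P where P: "agrees f P" "\<And>K. K \<in> \<T> \<Longrightarrow> P K \<in> polys 1" using pw_polysE[OF f] by blast
    show ?thesis
      by (rule pw_polysI[OF agrees_linear[OF P(1)]])
        (rule polys_linear_image[OF bounded_linear.linear[OF bounded_linear_vec_nth] P(2)])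
  qed
  show ?thesis
    using partial_h_comb[OF n[OF v, of 1] n[OF w, of 1], of 1 c d x]
      partial_h_comb[OF n[OF v, of 2] n[OF w, of 2], of 2 c d x]
    by (simp add: div_h_def algebra_simps)
qed

lemma L2_inner_cong_cells:
  fixes v w v' w' :: "real^2 \<Rightarrow> 'b::euclidean_space"
  assumes "v \<in> L2 \<Omega>" "w \<in> L2 \<Omega>" "v' \<in> L2 \<Omega>" "w' \<in> L2 \<Omega>"
    and "\<And>K x. K \<in> \<T> \<Longrightarrow> x \<in> interior K \<Longrightarrow> v x = v' x"
    and "\<And>K x. K \<in> \<T> \<Longrightarrow> x \<in> interior K \<Longrightarrow> w x = w' x"
  shows "L2_inner \<Omega> v w = L2_inner \<Omega> v' w'"
  by (rule L2_inner_cong_AE[OF domain_lebesgue assms(1-4)]) (use assms(5,6) in \<open>auto intro!: AE_domain\<close>)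

lemma curl_h_L2: "v \<in> pw_polys \<T> 2 \<Longrightarrow> curl_h \<T> v \<in> L2 \<Omega>"
  using pw_polys_L2[OF curl_h_pw_polys] by simp

lemma grad_h_L2: "v \<in> pw_polys \<T> 2 \<Longrightarrow> grad_h \<T> v \<in> L2 \<Omega>"
  for v :: "real^2 \<Rightarrow> 'b::euclidean_space"
  using pw_polys_L2[OF grad_h_pw_polys_2] by simp

lemma CR0_L2: "\<psi> \<in> CR0 \<Omega> \<T> \<Longrightarrow> \<psi> \<in> L2 \<Omega>"
  by (simp add: CR0_def CR_def)

lemma grad_h_CR0_L2: "\<psi> \<in> CR0 \<Omega> \<T> \<Longrightarrow> grad_h \<T> \<psi> \<in> L2 \<Omega>"
  using pw_polys_L2[OF grad_h_pw_polys_1[OF CR0_pw_polys]] by simp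

lemma L2_inner_curl_h: "L2_inner \<Omega> (curl_h \<T> v) (curl_h \<T> w) = b_h \<Omega> \<T> v w"
  by (simp add: L2_inner_def b_h_def curl_h_eq_rot rot_inner_rot)

lemma grad_h_cong_cells:
  assumes "\<And>K x. K \<in> \<T> \<Longrightarrow> x \<in> interior K \<Longrightarrow> v x = w x" "K \<in> \<T>" "x \<in> interior K"
  shows "grad_h \<T> v x = grad_h \<T> w x"
proof -
  have "eventually (\<lambda>y. y \<in> interior K) (nhds x)"
    by (rule eventually_nhds_in_open) (use assms in auto)
  then have "eventually (\<lambda>y. v y = w y) (nhds x)"
    by eventually_elim (use assms in blast)
  then show ?thesis by (simp add: grad_h_def partial_h_def vec_eq_iff partial_local)
qed

lemma partial_h_curl_h:
  assumes "v \<in> pw_polys \<T> 2"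
  shows "partial_h \<T> i (curl_h \<T> v) x = rot (partial_h \<T> i (grad_h \<T> v) x)"
proof (cases "\<exists>K\<in>\<T>. x \<in> interior K")
  case True
  then obtain K where K: "K \<in> \<T>" "x \<in> interior K" by blast
  obtain P where P: "agrees v P" "\<And>K. K \<in> \<T> \<Longrightarrow> P K \<in> polys 2" using pw_polysE[OF assms] by blast
  have "partial i (\<lambda>x. rot (grad (P K) x)) x = rot (partial i (grad (P K)) x)"
    by (rule partial_linear_image[OF linear_rot polys_differentiable[OF grad_polys_2[OF P(2)[OF K(1)]]]]) simp
  then show ?thesis
    using agreesD[OF agrees_partial_h[OF agrees_curl_h[OF P(1)]] K]
      agreesD[OF agrees_partial_h[OF agrees_grad_h[OF P(1)]] K] by simp
next
  case False
  then show ?thesis by (simp add: partial_h_def)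
qed

text \<open>The quarter turn acts on each row of the Hessian and preserves the Euclidean product of
  rows, hence the Frobenius product.\<close>

lemma L2_inner_grad_h_curl_h:
  assumes "v \<in> pw_polys \<T> 2" "w \<in> pw_polys \<T> 2"
  shows "L2_inner \<Omega> (grad_h \<T> (curl_h \<T> v)) (grad_h \<T> (curl_h \<T> w)) = a_h \<Omega> \<T> v w"
proof -
  have "grad_h \<T> (curl_h \<T> v) x \<bullet> grad_h \<T> (curl_h \<T> w) x = hess_h \<T> v x \<bullet> hess_h \<T> w x" for x
    unfolding hess_h_def inner_vec_def[of "grad_h _ _ _"]
    by (simp add: grad_h_def[of _ "curl_h _ _"] grad_h_def[of _ "grad_h _ _"] partial_h_curl_h[OF assms(1)]
        partial_h_curl_h[OF assms(2)] rot_inner_rot)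
  then show ?thesis by (simp add: L2_inner_def a_h_def)
qed

section \<open>Discrete Poisson and Morley problems\<close>

lemma Lagrange_H10: "v \<in> Lagrange \<Omega> \<T> l \<Longrightarrow> v \<in> H10 \<Omega>"
  and Lagrange_pw_polys: "v \<in> Lagrange \<Omega> \<T> l \<Longrightarrow> v \<in> pw_polys \<T> l"
  by (auto simp: Lagrange_def)

lemma Lagrange_H1: "v \<in> Lagrange \<Omega> \<T> l \<Longrightarrow> v \<in> H1 \<Omega>"
  using H10_H1[OF domain] Lagrange_H10 by blast

text \<open>By Friedrichs the kernel of the Dirichlet form consists of functions that vanish almost
  everywhere. Hence \<open>F\<close> may depend on the class of \<open>v\<close>, as in the Poisson
  problem, or on its weak gradient, as in the definition of \<open>P_h\<close>.\<close>

lemma Lagrange_riesz: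
  assumes l: "l \<le> 2"
    and Fcomb: "\<And>c d v w. v \<in> Lagrange \<Omega> \<T> l \<Longrightarrow> w \<in> Lagrange \<Omega> \<T> l \<Longrightarrow>
      F (\<lambda>x. c *\<^sub>R v x + d *\<^sub>R w x) = c * F v + d * F w"
    and F0: "\<And>v. v \<in> Lagrange \<Omega> \<T> l \<Longrightarrow> AE x in lebesgue_on \<Omega>. v x = 0 \<Longrightarrow>
      AE x in lebesgue_on \<Omega>. weak_grad \<Omega> v x = 0 \<Longrightarrow> F v = 0"
  shows "\<exists>w\<in>Lagrange \<Omega> \<T> l. \<forall>v\<in>Lagrange \<Omega> \<T> l. L2_inner \<Omega> (weak_grad \<Omega> w) (weak_grad \<Omega> v) = F v"
proof -
  let ?V = "Lagrange \<Omega> \<T> l"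
  obtain X where X: "finite X" "\<And>v K x. v \<in> pw_polys \<T> 2 \<Longrightarrow> (\<And>x. x \<in> X \<Longrightarrow> v x = (0::real)) \<Longrightarrow>
    K \<in> \<T> \<Longrightarrow> x \<in> interior K \<Longrightarrow> v x = 0" using pw_polys_separating by blast
  show ?thesis
  proof (rule riesz_L2[where X = X and lf = "\<lambda>x v. v x", OF domain_lebesgue X(1)])
    have "agrees (\<lambda>_. 0::real) (\<lambda>_ _. 0)" by (simp add: agrees_def)
    moreover have "(\<lambda>_. 0::real) \<in> polys l" using polys_mono[of 0 l "\<lambda>_. 0"] polys_0 l by auto
    ultimately have "(\<lambda>_. 0::real) \<in> pw_polys \<T> l" by (rule pw_polysI)
    then show "?V \<noteq> {}" using H10_zero[OF domain] by (auto simp: Lagrange_def)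
    show "(\<lambda>x. c *\<^sub>R v x + d *\<^sub>R w x) \<in> ?V" if "v \<in> ?V" "w \<in> ?V" for c d v w
      using that H10_comb[OF domain, of v w c d] pw_polys_comb[of v l w c d] by (simp add: Lagrange_def)
    show "weak_grad \<Omega> v \<in> L2 \<Omega>" if "v \<in> ?V" for v
      using weak_grad_L2[OF domain Lagrange_H1[OF that]] .
    show "AE x in lebesgue_on \<Omega>. weak_grad \<Omega> (\<lambda>x. c *\<^sub>R v x + d *\<^sub>R w x) x = c *\<^sub>R weak_grad \<Omega> v x + d *\<^sub>R weak_grad \<Omega> w x"
      if "v \<in> ?V" "w \<in> ?V" for c d v w
      using weak_grad_comb[OF domain Lagrange_H1[OF that(1)] Lagrange_H1[OF that(2)], of c d] by simp
    show "AE x in lebesgue_on \<Omega>. weak_grad \<Omega> v x = 0" if v: "v \<in> ?V" "\<And>x. x \<in> X \<Longrightarrow> v x = 0" for v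
    proof -
      have "v \<in> pw_polys \<T> 2" by (rule pw_polys_mono[OF l order_refl Lagrange_pw_polys[OF v(1)]])
      then have "AE x in lebesgue_on \<Omega>. v x = 0" using X(2) v(2) by (intro AE_domain) blast
      then show ?thesis by (rule is_weak_grad_zero[OF domain weak_grad[OF domain Lagrange_H1[OF v(1)]]])
    qed
    show "F v = 0" if v: "v \<in> ?V" "AE x in lebesgue_on \<Omega>. weak_grad \<Omega> v x = 0" for v
      using F0[OF v(1) H10_gradient_zero[OF domain Lagrange_H10[OF v(1)] L2_inner_eq_0_AE[OF v(2)]] v(2)] .
  qed (use Fcomb in auto)
qed

lemma discrete_Poisson:
  assumes "l \<le> 2" "f \<in> L2 \<Omega>"
  shows "\<exists>w\<in>Lagrange \<Omega> \<T> l. \<forall>v\<in>Lagrange \<Omega> \<T> l. L2_inner \<Omega> (weak_grad \<Omega> w) (weak_grad \<Omega> v) = L2_inner \<Omega> f v"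
proof (rule Lagrange_riesz[OF assms(1)])
  fix c d :: real and v w :: "real^2 \<Rightarrow> real" assume v: "v \<in> Lagrange \<Omega> \<T> l" "w \<in> Lagrange \<Omega> \<T> l"
  show "L2_inner \<Omega> f (\<lambda>x. c *\<^sub>R v x + d *\<^sub>R w x) = c * L2_inner \<Omega> f v + d * L2_inner \<Omega> f w"
    by (rule L2_inner_comb_right) (use v assms Lagrange_H1 H1_L2[OF domain] in auto)
next
  fix v :: "real^2 \<Rightarrow> real" assume "AE x in lebesgue_on \<Omega>. v x = 0"
  then show "L2_inner \<Omega> f v = 0" using L2_inner_eq_0_AE L2_inner_commute by metis
qed

text \<open>The functional depends on \<open>\<eta>\<close> through its weak gradient only, so a
  representing function exists and the choice in the definition of \<open>P_h\<close> is
  justified.\<close>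

lemma P_h:
  assumes l: "l \<le> 2" and v: "v \<in> pw_polys \<T> 2"
  shows "P_h \<Omega> \<T> l v \<in> Lagrange \<Omega> \<T> l"
    "\<eta> \<in> Lagrange \<Omega> \<T> l \<Longrightarrow> L2_inner \<Omega> (weak_grad \<Omega> (P_h \<Omega> \<T> l v)) (weak_grad \<Omega> \<eta>) =
       L2_inner \<Omega> (grad_h \<T> v) (weak_grad \<Omega> \<eta>)"
proof -
  have g: "grad_h \<T> v \<in> L2 \<Omega>" by (rule grad_h_L2[OF v])
  have wL: "weak_grad \<Omega> \<eta> \<in> L2 \<Omega>" if "\<eta> \<in> Lagrange \<Omega> \<T> l" for \<eta>
    using weak_grad_L2[OF domain Lagrange_H1[OF that]] .
  have "\<exists>w\<in>Lagrange \<Omega> \<T> l. \<forall>\<eta>\<in>Lagrange \<Omega> \<T> l. L2_inner \<Omega> (weak_grad \<Omega> w) (weak_grad \<Omega> \<eta>) =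
      L2_inner \<Omega> (grad_h \<T> v) (weak_grad \<Omega> \<eta>)"
  proof (rule Lagrange_riesz[OF l])
    fix c d :: real and \<eta> \<zeta> :: "real^2 \<Rightarrow> real" assume e: "\<eta> \<in> Lagrange \<Omega> \<T> l" "\<zeta> \<in> Lagrange \<Omega> \<T> l"
    have c: "weak_grad \<Omega> (\<lambda>x. c *\<^sub>R \<eta> x + d *\<^sub>R \<zeta> x) \<in> L2 \<Omega>"
      using weak_grad_L2[OF domain H1_comb[OF domain Lagrange_H1[OF e(1)] Lagrange_H1[OF e(2)]], of c d] by simp
    have "L2_inner \<Omega> (grad_h \<T> v) (weak_grad \<Omega> (\<lambda>x. c *\<^sub>R \<eta> x + d *\<^sub>R \<zeta> x)) =
        L2_inner \<Omega> (grad_h \<T> v) (\<lambda>x. c *\<^sub>R weak_grad \<Omega> \<eta> x + d *\<^sub>R weak_grad \<Omega> \<zeta> x)"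
      by (rule L2_inner_cong_AE[OF domain_lebesgue g c g L2_comb[OF wL[OF e(1)] wL[OF e(2)]]])
        (use weak_grad_comb[OF domain Lagrange_H1[OF e(1)] Lagrange_H1[OF e(2)], of c d] in auto)
    then show "L2_inner \<Omega> (grad_h \<T> v) (weak_grad \<Omega> (\<lambda>x. c *\<^sub>R \<eta> x + d *\<^sub>R \<zeta> x)) =
        c * L2_inner \<Omega> (grad_h \<T> v) (weak_grad \<Omega> \<eta>) + d * L2_inner \<Omega> (grad_h \<T> v) (weak_grad \<Omega> \<zeta>)"
      using L2_inner_comb_right[OF wL[OF e(1)] wL[OF e(2)] g] by simp
  next
    fix \<eta> :: "real^2 \<Rightarrow> real" assume "AE x in lebesgue_on \<Omega>. weak_grad \<Omega> \<eta> x = 0"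
    then show "L2_inner \<Omega> (grad_h \<T> v) (weak_grad \<Omega> \<eta>) = 0" using L2_inner_eq_0_AE L2_inner_commute by metis
  qed
  then have "\<exists>w. w \<in> Lagrange \<Omega> \<T> l \<and> (\<forall>\<eta>\<in>Lagrange \<Omega> \<T> l. L2_inner \<Omega> (weak_grad \<Omega> w) (weak_grad \<Omega> \<eta>) =
      L2_inner \<Omega> (grad_h \<T> v) (weak_grad \<Omega> \<eta>))" by blast
  from someI_ex[OF this, folded P_h_def]
  show "P_h \<Omega> \<T> l v \<in> Lagrange \<Omega> \<T> l"
    "\<eta> \<in> Lagrange \<Omega> \<T> l \<Longrightarrow> L2_inner \<Omega> (weak_grad \<Omega> (P_h \<Omega> \<T> l v)) (weak_grad \<Omega> \<eta>) =
       L2_inner \<Omega> (grad_h \<T> v) (weak_grad \<Omega> \<eta>)" by blast+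
qed

text \<open>\<open>P_h \<Omega> \<T> l v\<close> is an admissible test function in the Poisson
  problem for \<open>w\<close>, and \<open>w\<close> is one in the equation defining the projection.
  The two equations meet in the same symmetric form.\<close>

lemma L2_inner_P_h:
  assumes l: "l \<le> 2" and v: "v \<in> pw_polys \<T> 2" and w: "w \<in> Lagrange \<Omega> \<T> l"
    and eq: "\<And>\<eta>. \<eta> \<in> Lagrange \<Omega> \<T> l \<Longrightarrow> L2_inner \<Omega> (weak_grad \<Omega> w) (weak_grad \<Omega> \<eta>) = L2_inner \<Omega> f \<eta>"
  shows "L2_inner \<Omega> f (P_h \<Omega> \<T> l v) = L2_inner \<Omega> (weak_grad \<Omega> w) (grad_h \<T> v)"
  using eq[OF P_h(1)[OF l v]] P_h(2)[OF l v w] by (metis L2_inner_commute)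

text \<open>Where the curl vanishes, so does the elementwise gradient. The right-hand side is
  therefore zero on the kernel of the form and can be represented.\<close>

lemma discrete_curl_problem:
  assumes G: "G \<in> L2 \<Omega>"
  shows "\<exists>z\<in>MWX \<Omega> \<T>. \<forall>v\<in>MWX \<Omega> \<T>. L2_inner \<Omega> (curl_h \<T> z) (curl_h \<T> v) = L2_inner \<Omega> G (grad_h \<T> v)"
proof -
  obtain X where X: "finite X" "\<And>v K x. v \<in> pw_polys \<T> 2 \<Longrightarrow> (\<And>x. x \<in> X \<Longrightarrow> v x = (0::real)) \<Longrightarrow>
    K \<in> \<T> \<Longrightarrow> x \<in> interior K \<Longrightarrow> v x = 0" using pw_polys_separating by blast
  show ?thesis
  proof (rule riesz_L2[where X = X and lf = "\<lambda>x v. v x", OF domain_lebesgue X(1)])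
    show "MWX \<Omega> \<T> \<noteq> {}" using MWX_zero by blast
    show "(\<lambda>x. c *\<^sub>R v x + d *\<^sub>R w x) \<in> MWX \<Omega> \<T>" if "v \<in> MWX \<Omega> \<T>" "w \<in> MWX \<Omega> \<T>" for c d v w
      using MWX_comb[OF that, of c d] by simp
    show "curl_h \<T> v \<in> L2 \<Omega>" if "v \<in> MWX \<Omega> \<T>" for v by (rule curl_h_L2[OF MWX_pw_polys[OF that]])
    show "AE x in lebesgue_on \<Omega>. curl_h \<T> (\<lambda>x. c *\<^sub>R v x + d *\<^sub>R w x) x = c *\<^sub>R curl_h \<T> v x + d *\<^sub>R curl_h \<T> w x"
      if "v \<in> MWX \<Omega> \<T>" "w \<in> MWX \<Omega> \<T>" for c d v w
      by (simp only: curl_h_comb[OF that[THEN MWX_pw_polys]]) simp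
    show "AE x in lebesgue_on \<Omega>. curl_h \<T> v x = 0"
      if v: "v \<in> MWX \<Omega> \<T>" "\<And>x. x \<in> X \<Longrightarrow> v x = 0" for v
    proof (rule AE_domain)
      fix K x assume K: "K \<in> \<T>" "x \<in> interior K"
      have "v y = 0" if "K \<in> \<T>" "y \<in> interior K" for K y using X(2)[OF MWX_pw_polys[OF v(1)] v(2) that] .
      then have "grad_h \<T> v x = grad_h \<T> (\<lambda>_. 0) x" by (intro grad_h_cong_cells[OF _ K])
      also have "\<dots> = 0" using partial_eqI[OF has_derivative_const[of "0::real"]]
        by (simp add: grad_h_def partial_h_def vec_eq_iff)
      finally show "curl_h \<T> v x = 0" by (simp add: curl_h_eq_rot)
    qed
    show "L2_inner \<Omega> G (grad_h \<T> (\<lambda>x. c *\<^sub>R v x + d *\<^sub>R w x)) = c * L2_inner \<Omega> G (grad_h \<T> v) + d * L2_inner \<Omega> G (grad_h \<T> w)"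
      if "v \<in> MWX \<Omega> \<T>" "w \<in> MWX \<Omega> \<T>" for c d v w
      unfolding grad_h_comb[OF that[THEN MWX_pw_polys] order_refl]
      by (rule L2_inner_comb_right) (use that G grad_h_L2 MWX_pw_polys in auto)
    show "L2_inner \<Omega> G (grad_h \<T> v) = 0" if "AE x in lebesgue_on \<Omega>. curl_h \<T> v x = 0" for v
    proof -
      have "AE x in lebesgue_on \<Omega>. grad_h \<T> v x = 0" using that by (simp add: curl_h_eq_rot)
      then show ?thesis using L2_inner_eq_0_AE L2_inner_commute by metis
    qed
  qed auto
qed

text \<open>The orthogonal projection onto mean-free functions. Testing a divergence with
  \<open>PW_const0\<close> controls this part of it only, which is why it serves as the operator
  \<open>D\<close> for the pressure.\<close>

definition mean_free :: "(real^2 \<Rightarrow> real) \<Rightarrow> real^2 \<Rightarrow> real" where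
  "mean_free q x = q x - L2_inner \<Omega> q (\<lambda>_. 1) / L2_inner \<Omega> (\<lambda>_. 1) (\<lambda>_. 1::real)"

lemma const_pw_polys: "(\<lambda>_. c) \<in> pw_polys \<T> 0"
  by (rule pw_polysI[of _ "\<lambda>_ _. c"]) (auto simp: agrees_def polys_0)

lemma const_L2: "(\<lambda>_. c::'b::euclidean_space) \<in> L2 \<Omega>"
  by (rule pw_polys_L2[OF const_pw_polys]) simp

lemma area_nonzero: "L2_inner \<Omega> (\<lambda>_. 1) (\<lambda>_. 1::real) \<noteq> 0"
proof
  assume "L2_inner \<Omega> (\<lambda>_. 1) (\<lambda>_. 1::real) = 0"
  then have ae: "AE x in lebesgue_on \<Omega>. (1::real) = 0" by (rule L2_inner_self_eq_0[OF const_L2])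
  obtain K where K: "K \<in> \<T>" using cells_cover nonempty_domain closure_subset by blast
  then obtain x where "x \<in> interior K" using interior_cell_nonempty by blast
  from pw_polys_AE_zero[OF const_pw_polys _ ae K this] show False by simp
qed

lemma mean_free_pw_polys: "q \<in> pw_polys \<T> 0 \<Longrightarrow> mean_free q \<in> pw_polys \<T> 0"
  using pw_polys_comb[OF _ const_pw_polys, of q 1 "-1"] by (simp add: mean_free_def[abs_def])

lemma L2_inner_mean_free_one:
  assumes "q \<in> L2 \<Omega>"
  shows "L2_inner \<Omega> (mean_free q) (\<lambda>_. 1) = 0"
proof -
  let ?m = "L2_inner \<Omega> q (\<lambda>_. 1) / L2_inner \<Omega> (\<lambda>_. 1) (\<lambda>_. 1::real)"
  have "L2_inner \<Omega> (mean_free q) (\<lambda>_. 1) = L2_inner \<Omega> (\<lambda>x. 1 *\<^sub>R q x + (- ?m) *\<^sub>R 1) (\<lambda>_. 1)"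
    by (simp add: mean_free_def[abs_def])
  also have "\<dots> = 1 * L2_inner \<Omega> q (\<lambda>_. 1) + (- ?m) * L2_inner \<Omega> (\<lambda>_. 1) (\<lambda>_. 1::real)"
    by (rule L2_inner_comb_left[OF assms const_L2 const_L2])
  finally show ?thesis using area_nonzero by simp
qed

lemma mean_free_PW_const0: "q \<in> pw_polys \<T> 0 \<Longrightarrow> mean_free q \<in> PW_const0 \<Omega> \<T>"
  using mean_free_pw_polys L2_inner_mean_free_one[OF pw_polys_L2[of q 0]]
  by (simp add: PW_const0_def L2_inner_def)

lemma L2_inner_mean_free:
  assumes q: "q \<in> L2 \<Omega>" and r: "r \<in> L2 \<Omega>" "L2_inner \<Omega> r (\<lambda>_. 1) = 0"
  shows "L2_inner \<Omega> (mean_free q) r = L2_inner \<Omega> q r"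
proof -
  let ?m = "L2_inner \<Omega> q (\<lambda>_. 1) / L2_inner \<Omega> (\<lambda>_. 1) (\<lambda>_. 1::real)"
  have "L2_inner \<Omega> (mean_free q) r = L2_inner \<Omega> (\<lambda>x. 1 *\<^sub>R q x + (- ?m) *\<^sub>R 1) r"
    by (simp add: mean_free_def[abs_def])
  also have "\<dots> = 1 * L2_inner \<Omega> q r + (- ?m) * L2_inner \<Omega> (\<lambda>_. 1) r"
    by (rule L2_inner_comb_left[OF q const_L2 r(1)])
  finally show ?thesis using r(2) by (simp add: L2_inner_commute)
qed

lemma div_h_L2: "\<psi> \<in> CR0 \<Omega> \<T> \<Longrightarrow> div_h \<T> \<psi> \<in> L2 \<Omega>"
  using pw_polys_L2[OF div_h_pw_polys[OF CR0_pw_polys]] by simp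

text \<open>A vanishing mean-free part says that the divergence is the same constant on all cells;
  \<open>CR0_const_div\<close> then supplies the stream function.\<close>

lemma CR0_mean_free_div:
  assumes \<psi>: "\<psi> \<in> CR0 \<Omega> \<T>" and ae: "AE x in lebesgue_on \<Omega>. mean_free (div_h \<T> \<psi>) x = 0"
  obtains v where "v \<in> MWX0 \<Omega> \<T>" "\<And>K x. K \<in> \<T> \<Longrightarrow> x \<in> interior K \<Longrightarrow> curl_h \<T> v x = \<psi> x"
proof -
  let ?m = "L2_inner \<Omega> (div_h \<T> \<psi>) (\<lambda>_. 1) / L2_inner \<Omega> (\<lambda>_. 1) (\<lambda>_. 1::real)"
  have "div_h \<T> \<psi> x = ?m" if "K \<in> \<T>" "x \<in> interior K" for K x
    using pw_polys_AE_zero[OF mean_free_pw_polys[OF div_h_pw_polys[OF CR0_pw_polys[OF \<psi>]]] _ ae that]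
    by (simp add: mean_free_def)
  then show ?thesis using CR0_const_div[OF \<psi>] that by metis
qed

text \<open>The pressure is sought as the mean-free divergence of a field in \<open>CR0\<close>.
  Fields whose mean-free divergence vanishes are, on the open cells, curls of functions in
  \<open>MWX0\<close>, and \<open>F\<close> vanishes on these.\<close>

lemma discrete_pressure:
  assumes Fcomb: "\<And>c d \<psi> \<xi>. \<psi> \<in> CR0 \<Omega> \<T> \<Longrightarrow> \<xi> \<in> CR0 \<Omega> \<T> \<Longrightarrow>
      F (\<lambda>x. c *\<^sub>R \<psi> x + d *\<^sub>R \<xi> x) = c * F \<psi> + d * F \<xi>"
    and F0: "\<And>\<psi> v. \<psi> \<in> CR0 \<Omega> \<T> \<Longrightarrow> v \<in> MWX0 \<Omega> \<T> \<Longrightarrow>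
      (\<And>K x. K \<in> \<T> \<Longrightarrow> x \<in> interior K \<Longrightarrow> curl_h \<T> v x = \<psi> x) \<Longrightarrow> F \<psi> = 0"
  shows "\<exists>p\<in>PW_const0 \<Omega> \<T>. \<forall>\<psi>\<in>CR0 \<Omega> \<T>. L2_inner \<Omega> (div_h \<T> \<psi>) p = F \<psi>"
proof -
  let ?D = "\<lambda>\<psi>. mean_free (div_h \<T> \<psi>)"
  obtain X where X: "finite X" "\<And>v K x. v \<in> pw_polys \<T> 2 \<Longrightarrow> (\<And>x. x \<in> X \<Longrightarrow> v x = (0::real)) \<Longrightarrow>
    K \<in> \<T> \<Longrightarrow> x \<in> interior K \<Longrightarrow> v x = 0" using pw_polys_separating by blast
  have dp: "div_h \<T> \<psi> \<in> pw_polys \<T> 0" if "\<psi> \<in> CR0 \<Omega> \<T>" for \<psi>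
    using div_h_pw_polys[OF CR0_pw_polys[OF that]] .
  have DL: "?D \<psi> \<in> L2 \<Omega>" if "\<psi> \<in> CR0 \<Omega> \<T>" for \<psi>
    using pw_polys_L2[OF mean_free_pw_polys[OF dp[OF that]]] by simp
  have "\<exists>\<psi>\<in>CR0 \<Omega> \<T>. \<forall>\<xi>\<in>CR0 \<Omega> \<T>. L2_inner \<Omega> (?D \<psi>) (?D \<xi>) = F \<xi>"
  proof (rule riesz_L2[where X = X and lf = "\<lambda>x \<psi>. div_h \<T> \<psi> x" and D = ?D, OF domain_lebesgue X(1)])
    show "CR0 \<Omega> \<T> \<noteq> {}" using CR0_zero by blast
    show "AE x in lebesgue_on \<Omega>. ?D (\<lambda>x. c *\<^sub>R \<psi> x + d *\<^sub>R \<xi> x) x = c *\<^sub>R ?D \<psi> x + d *\<^sub>R ?D \<xi> x"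
      if "\<psi> \<in> CR0 \<Omega> \<T>" "\<xi> \<in> CR0 \<Omega> \<T>" for c d \<psi> \<xi>
    proof -
      have e: "div_h \<T> (\<lambda>x. c *\<^sub>R \<psi> x + d *\<^sub>R \<xi> x) = (\<lambda>x. c *\<^sub>R div_h \<T> \<psi> x + d *\<^sub>R div_h \<T> \<xi> x)"
        using div_h_comb[OF that[THEN CR0_pw_polys]] by (simp add: fun_eq_iff)
      show ?thesis
        unfolding e mean_free_def L2_inner_comb_left[OF that[THEN div_h_L2] const_L2]
        by (simp add: algebra_simps add_divide_distrib)
    qed
    show "div_h \<T> (\<lambda>x. c *\<^sub>R \<psi> x + d *\<^sub>R \<xi> x) x = c * div_h \<T> \<psi> x + d * div_h \<T> \<xi> x"
      if "\<psi> \<in> CR0 \<Omega> \<T>" "\<xi> \<in> CR0 \<Omega> \<T>" for x c d \<psi> \<xi>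
      by (rule div_h_comb[OF that[THEN CR0_pw_polys]])
    show "AE x in lebesgue_on \<Omega>. ?D \<psi> x = 0"
      if \<psi>: "\<psi> \<in> CR0 \<Omega> \<T>" "\<And>x. x \<in> X \<Longrightarrow> div_h \<T> \<psi> x = 0" for \<psi>
    proof -
      have d2: "div_h \<T> \<psi> \<in> pw_polys \<T> 2" by (rule pw_polys_mono[OF _ _ dp[OF \<psi>(1)]]) auto
      \<comment> \<open>The point functionals sample the divergence itself rather than its mean-free
        part. If they vanish, so do the divergence on all open cells and with it the subtracted
        mean.\<close>
      have z: "div_h \<T> \<psi> x = 0" if "K \<in> \<T>" "x \<in> interior K" for K x
        using X(2)[of "div_h \<T> \<psi>", OF d2 \<psi>(2) that] .
      then have "L2_inner \<Omega> (div_h \<T> \<psi>) (\<lambda>_. 1) = 0" by (intro L2_inner_eq_0_AE AE_domain)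
      then have D: "?D \<psi> = div_h \<T> \<psi>" by (simp add: mean_free_def[abs_def])
      show ?thesis unfolding D by (rule AE_domain) (rule z)
    qed
    show "F \<psi> = 0" if \<psi>: "\<psi> \<in> CR0 \<Omega> \<T>" "AE x in lebesgue_on \<Omega>. ?D \<psi> x = 0" for \<psi>
      using CR0_mean_free_div[OF \<psi>] F0[OF \<psi>(1)] by metis
  qed (use CR0_comb DL Fcomb in auto)
  then obtain \<psi> where \<psi>: "\<psi> \<in> CR0 \<Omega> \<T>" "\<And>\<xi>. \<xi> \<in> CR0 \<Omega> \<T> \<Longrightarrow> L2_inner \<Omega> (?D \<psi>) (?D \<xi>) = F \<xi>"
    by blast
  have "L2_inner \<Omega> (div_h \<T> \<xi>) (?D \<psi>) = F \<xi>" if \<xi>: "\<xi> \<in> CR0 \<Omega> \<T>" for \<xi>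
    using L2_inner_mean_free[OF div_h_L2[OF \<xi>] DL[OF \<psi>(1)] L2_inner_mean_free_one[OF div_h_L2[OF \<psi>(1)]]]
      \<psi>(2)[OF \<xi>] by (simp add: L2_inner_commute[of _ "?D \<psi>"])
  then show ?thesis using mean_free_PW_const0[OF dp[OF \<psi>(1)]] by blast
qed

text \<open>The conditions that distinguish \<open>MWX0\<close> within \<open>MWX\<close> involve
  the elementwise gradient on open cells only. This recovers the boundary condition for the last
  component of a decoupled solution.\<close>

lemma MWX0_cong_grad:
  assumes u: "u \<in> MWX \<Omega> \<T>" and v: "v \<in> MWX0 \<Omega> \<T>"
    and eq: "\<And>K x. K \<in> \<T> \<Longrightarrow> x \<in> interior K \<Longrightarrow> grad_h \<T> u x = grad_h \<T> v x"
  shows "u \<in> MWX0 \<Omega> \<T>"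
proof -
  obtain R where R: "agrees v R" "\<And>K. K \<in> \<T> \<Longrightarrow> R K \<in> polys 2"
    using pw_polysE[OF MWX_pw_polys[OF MWX0_MWX[OF v]]] by blast
  have Z: "zero_normal_traces R" using v MWX0_iff[OF R] by simp
  have a: "agrees (\<lambda>x. n \<bullet> grad_h \<T> u x) (\<lambda>K x. n \<bullet> grad (R K) x)" for n
    using normal_derivative_data(1)[OF R, of n] eq by (auto simp: agrees_def)
  have "edge_integral a b (trace_from K (\<lambda>x. n \<bullet> grad_h \<T> u x)) = 0"
    if K: "K \<in> \<T>" "closed_segment a b edge_of K" "closed_segment a b \<subseteq> frontier \<Omega>"
      "outward_unit_normal \<Omega> (closed_segment a b) n" for K a b n
  proof -
    have "n \<bullet> grad (R K) (midpoint a b) = 0" by (rule zero_normal_tracesD[OF Z K])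
    then show ?thesis
      using edge_integral_trace[OF K(1) a normal_derivative_data(2)[OF R K(1)] K(2), of n] by simp
  qed
  then show ?thesis using u unfolding MWX0_def by blast
qed

lemma decoupling:
  assumes l: "l \<le> 2" and f: "f \<in> L2 \<Omega>"
  shows "(u \<in> MWX0 \<Omega> \<T> \<and>
      (\<forall>v\<in>MWX0 \<Omega> \<T>. \<epsilon>\<^sup>2 * a_h \<Omega> \<T> u v + b_h \<Omega> \<T> u v = L2_inner \<Omega> f (P_h \<Omega> \<T> l v))) \<longleftrightarrow>
     (\<exists>w\<in>Lagrange \<Omega> \<T> l.
        (\<forall>\<eta>\<in>Lagrange \<Omega> \<T> l.
           L2_inner \<Omega> (weak_grad \<Omega> w) (weak_grad \<Omega> \<eta>) = L2_inner \<Omega> f \<eta>) \<and>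
        (\<exists>z\<in>MWX \<Omega> \<T>. \<exists>\<phi>\<in>CR0 \<Omega> \<T>. \<exists>p\<in>PW_const0 \<Omega> \<T>. u \<in> MWX \<Omega> \<T> \<and>
           (\<forall>v\<in>MWX \<Omega> \<T>.
              L2_inner \<Omega> (curl_h \<T> z) (curl_h \<T> v) = L2_inner \<Omega> (weak_grad \<Omega> w) (grad_h \<T> v)) \<and>
           (\<forall>\<psi>\<in>CR0 \<Omega> \<T>.
              L2_inner \<Omega> \<phi> \<psi> + \<epsilon>\<^sup>2 * L2_inner \<Omega> (grad_h \<T> \<phi>) (grad_h \<T> \<psi>)
                + L2_inner \<Omega> (div_h \<T> \<psi>) p = L2_inner \<Omega> (curl_h \<T> z) \<psi>) \<and>
           (\<forall>q\<in>PW_const0 \<Omega> \<T>. L2_inner \<Omega> (div_h \<T> \<phi>) q = 0) \<and>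
           (\<forall>\<eta>\<in>MWX \<Omega> \<T>.
              L2_inner \<Omega> (curl_h \<T> u) (curl_h \<T> \<eta>) = L2_inner \<Omega> \<phi> (curl_h \<T> \<eta>))))"
    (is "?M \<longleftrightarrow> ?S")
proof
  assume M: ?M
  then have u: "u \<in> MWX0 \<Omega> \<T>" "u \<in> MWX \<Omega> \<T>" "u \<in> pw_polys \<T> 2"
    using MWX0_MWX MWX_pw_polys by blast+
  obtain w where w: "w \<in> Lagrange \<Omega> \<T> l" "\<And>\<eta>. \<eta> \<in> Lagrange \<Omega> \<T> l \<Longrightarrow>
      L2_inner \<Omega> (weak_grad \<Omega> w) (weak_grad \<Omega> \<eta>) = L2_inner \<Omega> f \<eta>"
    using discrete_Poisson[OF l f] by blast
  obtain z where z: "z \<in> MWX \<Omega> \<T>" "\<And>v. v \<in> MWX \<Omega> \<T> \<Longrightarrow>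
      L2_inner \<Omega> (curl_h \<T> z) (curl_h \<T> v) = L2_inner \<Omega> (weak_grad \<Omega> w) (grad_h \<T> v)"
    using discrete_curl_problem[OF weak_grad_L2[OF domain Lagrange_H1[OF w(1)]]] by blast
  let ?\<phi> = "curl_h \<T> u"
  have \<phi>: "?\<phi> \<in> CR0 \<Omega> \<T>" by (rule curl_h_MWX0[OF u(1)])
  note L = CR0_L2[OF \<phi>] grad_h_CR0_L2[OF \<phi>] curl_h_L2[OF MWX_pw_polys[OF z(1)]]
  \<comment> \<open>The residual of the Brinkman equation that the pressure has to balance.\<close>
  let ?F = "\<lambda>\<psi>. L2_inner \<Omega> (curl_h \<T> z) \<psi> - L2_inner \<Omega> ?\<phi> \<psi> - \<epsilon>\<^sup>2 * L2_inner \<Omega> (grad_h \<T> ?\<phi>) (grad_h \<T> \<psi>)"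
  have "\<exists>p\<in>PW_const0 \<Omega> \<T>. \<forall>\<psi>\<in>CR0 \<Omega> \<T>. L2_inner \<Omega> (div_h \<T> \<psi>) p = ?F \<psi>"
  proof (rule discrete_pressure)
    fix c d :: real and \<psi> \<xi> :: "real^2 \<Rightarrow> real^2" assume c: "\<psi> \<in> CR0 \<Omega> \<T>" "\<xi> \<in> CR0 \<Omega> \<T>"
    have "grad_h \<T> (\<lambda>x. c *\<^sub>R \<psi> x + d *\<^sub>R \<xi> x) = (\<lambda>x. c *\<^sub>R grad_h \<T> \<psi> x + d *\<^sub>R grad_h \<T> \<xi> x)"
      by (rule grad_h_comb[OF c[THEN CR0_pw_polys]]) simp
    then show "?F (\<lambda>x. c *\<^sub>R \<psi> x + d *\<^sub>R \<xi> x) = c * ?F \<psi> + d * ?F \<xi>"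
      by (simp only: L2_inner_comb_right[OF c[THEN CR0_L2] L(3)] L2_inner_comb_right[OF c[THEN CR0_L2] L(1)]
          L2_inner_comb_right[OF c[THEN grad_h_CR0_L2] L(2)]) (simp add: algebra_simps)
  next
    \<comment> \<open>On the open cells \<open>\<psi>\<close> is the curl of \<open>v\<close>, so
      the residual at \<open>\<psi>\<close> is that of the MWX equation tested with
      \<open>v\<close>.\<close>
    fix \<psi> v assume \<psi>: "\<psi> \<in> CR0 \<Omega> \<T>" and v: "v \<in> MWX0 \<Omega> \<T>"
      and eq: "\<And>K x. K \<in> \<T> \<Longrightarrow> x \<in> interior K \<Longrightarrow> curl_h \<T> v x = \<psi> x"
    have v': "v \<in> MWX \<Omega> \<T>" "v \<in> pw_polys \<T> 2" using v MWX0_MWX MWX_pw_polys by blast+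
    have c: "curl_h \<T> v \<in> CR0 \<Omega> \<T>" by (rule curl_h_MWX0[OF v])
    have "L2_inner \<Omega> (curl_h \<T> z) \<psi> = L2_inner \<Omega> (curl_h \<T> z) (curl_h \<T> v)"
      by (rule L2_inner_cong_cells[OF L(3) CR0_L2[OF \<psi>] L(3) CR0_L2[OF c]]) (simp_all add: eq)
    also have "\<dots> = L2_inner \<Omega> f (P_h \<Omega> \<T> l v)"
      using z(2)[OF v'(1)] L2_inner_P_h[OF l v'(2) w] by simp
    finally have 1: "L2_inner \<Omega> (curl_h \<T> z) \<psi> = \<epsilon>\<^sup>2 * a_h \<Omega> \<T> u v + b_h \<Omega> \<T> u v" using M v by simp
    have "L2_inner \<Omega> ?\<phi> \<psi> = L2_inner \<Omega> ?\<phi> (curl_h \<T> v)"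
      by (rule L2_inner_cong_cells[OF L(1) CR0_L2[OF \<psi>] L(1) CR0_L2[OF c]]) (simp_all add: eq)
    then have 2: "L2_inner \<Omega> ?\<phi> \<psi> = b_h \<Omega> \<T> u v" by (simp add: L2_inner_curl_h)
    have "L2_inner \<Omega> (grad_h \<T> ?\<phi>) (grad_h \<T> \<psi>) = L2_inner \<Omega> (grad_h \<T> ?\<phi>) (grad_h \<T> (curl_h \<T> v))"
      by (rule L2_inner_cong_cells[OF L(2) grad_h_CR0_L2[OF \<psi>] L(2) grad_h_CR0_L2[OF c]])
        (simp, rule grad_h_cong_cells[OF eq[symmetric]])
    then have 3: "L2_inner \<Omega> (grad_h \<T> ?\<phi>) (grad_h \<T> \<psi>) = a_h \<Omega> \<T> u v"
      by (simp add: L2_inner_grad_h_curl_h[OF u(3) v'(2)])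
    show "?F \<psi> = 0" using 1 2 3 by simp
  qed
  then obtain p where p: "p \<in> PW_const0 \<Omega> \<T>" "\<And>\<psi>. \<psi> \<in> CR0 \<Omega> \<T> \<Longrightarrow> L2_inner \<Omega> (div_h \<T> \<psi>) p = ?F \<psi>" by blast
  have "L2_inner \<Omega> (div_h \<T> ?\<phi>) q = 0" for q
    by (rule L2_inner_eq_0_AE[OF AE_domain]) (rule div_h_curl_h[OF u(3)])
  then show ?S
    by (intro bexI[OF _ w(1)] bexI[OF _ z(1)] bexI[OF _ \<phi>] bexI[OF _ p(1)] conjI ballI u(2) w(2) z(2))
      (simp_all add: p(2))
next
  assume ?S
  then obtain w z \<phi> p where w: "w \<in> Lagrange \<Omega> \<T> l"
    and Pois: "\<And>\<eta>. \<eta> \<in> Lagrange \<Omega> \<T> l \<Longrightarrow> L2_inner \<Omega> (weak_grad \<Omega> w) (weak_grad \<Omega> \<eta>) = L2_inner \<Omega> f \<eta>"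
    and z: "z \<in> MWX \<Omega> \<T>" and \<phi>: "\<phi> \<in> CR0 \<Omega> \<T>" and p: "p \<in> PW_const0 \<Omega> \<T>" and u: "u \<in> MWX \<Omega> \<T>"
    and zeq: "\<And>v. v \<in> MWX \<Omega> \<T> \<Longrightarrow>
      L2_inner \<Omega> (curl_h \<T> z) (curl_h \<T> v) = L2_inner \<Omega> (weak_grad \<Omega> w) (grad_h \<T> v)"
    and Brink: "\<And>\<psi>. \<psi> \<in> CR0 \<Omega> \<T> \<Longrightarrow>
      L2_inner \<Omega> \<phi> \<psi> + \<epsilon>\<^sup>2 * L2_inner \<Omega> (grad_h \<T> \<phi>) (grad_h \<T> \<psi>) + L2_inner \<Omega> (div_h \<T> \<psi>) p =
      L2_inner \<Omega> (curl_h \<T> z) \<psi>"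
    and div0: "\<And>q. q \<in> PW_const0 \<Omega> \<T> \<Longrightarrow> L2_inner \<Omega> (div_h \<T> \<phi>) q = 0"
    and ueq: "\<And>\<eta>. \<eta> \<in> MWX \<Omega> \<T> \<Longrightarrow>
      L2_inner \<Omega> (curl_h \<T> u) (curl_h \<T> \<eta>) = L2_inner \<Omega> \<phi> (curl_h \<T> \<eta>)"
    by blast
  note up = MWX_pw_polys[OF u]
  have dp: "div_h \<T> \<phi> \<in> pw_polys \<T> 0" by (rule div_h_pw_polys[OF CR0_pw_polys[OF \<phi>]])
  let ?d = "mean_free (div_h \<T> \<phi>)"
  have dL: "?d \<in> L2 \<Omega>" using pw_polys_L2[OF mean_free_pw_polys[OF dp]] by simp
  \<comment> \<open>\<open>?d\<close> is itself an admissible \<open>q\<close> in the continuity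
    equation; testing with it gives its own squared norm.\<close>
  have "L2_inner \<Omega> ?d ?d = 0"
    using L2_inner_mean_free[OF div_h_L2[OF \<phi>] dL L2_inner_mean_free_one[OF div_h_L2[OF \<phi>]]]
      div0[OF mean_free_PW_const0[OF dp]] by simp
  then have "AE x in lebesgue_on \<Omega>. ?d x = 0" by (rule L2_inner_self_eq_0[OF dL])
  then obtain v0 where v0: "v0 \<in> MWX0 \<Omega> \<T>" "\<And>K x. K \<in> \<T> \<Longrightarrow> x \<in> interior K \<Longrightarrow> curl_h \<T> v0 x = \<phi> x"
    using CR0_mean_free_div[OF \<phi>] by blast
  note v0M = MWX0_MWX[OF v0(1)]
  note v0p = MWX_pw_polys[OF v0M]
  \<comment> \<open>Testing the last equation with this difference shows that \<open>u\<close> and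
    \<open>v0\<close> have the same curl. The coefficients 1 and -1 are kept explicit to fit the
    linearity lemmas.\<close>
  let ?e = "\<lambda>x. 1 *\<^sub>R u x + (-1) *\<^sub>R v0 x"
  have e: "?e \<in> MWX \<Omega> \<T>" using MWX_comb[OF u v0M, of 1 "-1"] by simp
  have ce: "curl_h \<T> ?e = (\<lambda>x. 1 *\<^sub>R curl_h \<T> u x + (-1) *\<^sub>R curl_h \<T> v0 x)" by (rule curl_h_comb[OF up v0p])
  have eL: "curl_h \<T> ?e \<in> L2 \<Omega>" by (rule curl_h_L2[OF MWX_pw_polys[OF e]])
  have "L2_inner \<Omega> (curl_h \<T> v0) (curl_h \<T> ?e) = L2_inner \<Omega> \<phi> (curl_h \<T> ?e)"
    by (rule L2_inner_cong_cells[OF curl_h_L2[OF v0p] eL CR0_L2[OF \<phi>] eL]) (simp_all add: v0(2))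
  then have "L2_inner \<Omega> (\<lambda>x. 1 *\<^sub>R curl_h \<T> u x + (-1) *\<^sub>R curl_h \<T> v0 x) (curl_h \<T> ?e) = 0"
    unfolding L2_inner_comb_left[OF curl_h_L2[OF up] curl_h_L2[OF v0p] eL] using ueq[OF e] by simp
  then have "L2_inner \<Omega> (curl_h \<T> ?e) (curl_h \<T> ?e) = 0" unfolding ce .
  then have ae: "AE x in lebesgue_on \<Omega>. curl_h \<T> ?e x = 0" by (rule L2_inner_self_eq_0[OF eL])
  have "curl_h \<T> ?e x = 0" if "K \<in> \<T>" "x \<in> interior K" for K x
    by (rule pw_polys_AE_zero[OF curl_h_pw_polys[OF MWX_pw_polys[OF e]] _ ae that]) simp
  then have cuv: "curl_h \<T> u x = curl_h \<T> v0 x" if "K \<in> \<T>" "x \<in> interior K" for K x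
    using that unfolding ce by fastforce
  \<comment> \<open>Rotating twice is negation, so equal curls give equal gradients.\<close>
  have guv: "grad_h \<T> u x = grad_h \<T> v0 x" if "K \<in> \<T>" "x \<in> interior K" for K x
  proof -
    have "rot (rot (grad_h \<T> u x)) = rot (rot (grad_h \<T> v0 x))" using cuv[OF that] by (simp only: curl_h_eq_rot)
    then show ?thesis by simp
  qed
  have u0: "u \<in> MWX0 \<Omega> \<T>" by (rule MWX0_cong_grad[OF u v0(1) guv])
  have cu: "curl_h \<T> u x = \<phi> x" if "K \<in> \<T>" "x \<in> interior K" for K x using cuv[OF that] v0(2)[OF that] by simp
  have "\<epsilon>\<^sup>2 * a_h \<Omega> \<T> u v + b_h \<Omega> \<T> u v = L2_inner \<Omega> f (P_h \<Omega> \<T> l v)" if v: "v \<in> MWX0 \<Omega> \<T>" for v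
  proof -
    have v': "v \<in> MWX \<Omega> \<T>" "v \<in> pw_polys \<T> 2" using v MWX0_MWX MWX_pw_polys by blast+
    have c: "curl_h \<T> v \<in> CR0 \<Omega> \<T>" by (rule curl_h_MWX0[OF v])
    have cuC: "curl_h \<T> u \<in> CR0 \<Omega> \<T>" by (rule curl_h_MWX0[OF u0])
    have 1: "L2_inner \<Omega> (div_h \<T> (curl_h \<T> v)) p = 0"
      by (rule L2_inner_eq_0_AE[OF AE_domain]) (rule div_h_curl_h[OF v'(2)])
    have "L2_inner \<Omega> (curl_h \<T> u) (curl_h \<T> v) = L2_inner \<Omega> \<phi> (curl_h \<T> v)"
      by (rule L2_inner_cong_cells[OF CR0_L2[OF cuC] CR0_L2[OF c] CR0_L2[OF \<phi>] CR0_L2[OF c]]) (simp_all add: cu)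
    then have 2: "L2_inner \<Omega> \<phi> (curl_h \<T> v) = b_h \<Omega> \<T> u v" by (simp add: L2_inner_curl_h)
    have "L2_inner \<Omega> (grad_h \<T> (curl_h \<T> u)) (grad_h \<T> (curl_h \<T> v)) =
        L2_inner \<Omega> (grad_h \<T> \<phi>) (grad_h \<T> (curl_h \<T> v))"
      by (rule L2_inner_cong_cells[OF grad_h_CR0_L2[OF cuC] grad_h_CR0_L2[OF c] grad_h_CR0_L2[OF \<phi>] grad_h_CR0_L2[OF c]])
        (rule grad_h_cong_cells[OF cu], simp_all)
    then have 3: "L2_inner \<Omega> (grad_h \<T> \<phi>) (grad_h \<T> (curl_h \<T> v)) = a_h \<Omega> \<T> u v"
      by (simp add: L2_inner_grad_h_curl_h[OF up v'(2)])
    show ?thesis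
      using Brink[OF c] zeq[OF v'(1)] L2_inner_P_h[OF l v'(2) w Pois] 1 2 3 by simp
  qed
  then show ?M using u0 by blast
qed

end

theorem theorem5p5:
  fixes \<Omega> :: "(real^2) set" and \<T> :: "(real^2) set set"
    and f u\<^sub>h\<^sub>0 :: "real^2 \<Rightarrow> real" and \<epsilon> \<sigma> :: real and l :: nat
  assumes "convex_polygon \<Omega>"
    and "mesh \<Omega> \<T>"
    and "shape_regular \<sigma> \<T>"
    and "f \<in> L2 \<Omega>"
    and "\<epsilon> > 0"
    and "l \<in> {1, 2}"
  shows
    "(u\<^sub>h\<^sub>0 \<in> MWX0 \<Omega> \<T> \<and>
      (\<forall>v\<in>MWX0 \<Omega> \<T>.
         \<epsilon>\<^sup>2 * a_h \<Omega> \<T> u\<^sub>h\<^sub>0 v + b_h \<Omega> \<T> u\<^sub>h\<^sub>0 v = L2_inner \<Omega> f (P_h \<Omega> \<T> l v)))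
     \<longleftrightarrow>
     (\<exists>w\<in>Lagrange \<Omega> \<T> l.
        (\<forall>\<eta>\<in>Lagrange \<Omega> \<T> l.
           L2_inner \<Omega> (weak_grad \<Omega> w) (weak_grad \<Omega> \<eta>) = L2_inner \<Omega> f \<eta>) \<and>
        (\<exists>z\<in>MWX \<Omega> \<T>. \<exists>\<phi>\<in>CR0 \<Omega> \<T>. \<exists>p\<in>PW_const0 \<Omega> \<T>. u\<^sub>h\<^sub>0 \<in> MWX \<Omega> \<T> \<and>
           (\<forall>v\<in>MWX \<Omega> \<T>.
              L2_inner \<Omega> (curl_h \<T> z) (curl_h \<T> v) =
              L2_inner \<Omega> (weak_grad \<Omega> w) (grad_h \<T> v)) \<and>
           (\<forall>\<psi>\<in>CR0 \<Omega> \<T>.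
              L2_inner \<Omega> \<phi> \<psi> + \<epsilon>\<^sup>2 * L2_inner \<Omega> (grad_h \<T> \<phi>) (grad_h \<T> \<psi>)
                + L2_inner \<Omega> (div_h \<T> \<psi>) p = L2_inner \<Omega> (curl_h \<T> z) \<psi>) \<and>
           (\<forall>q\<in>PW_const0 \<Omega> \<T>. L2_inner \<Omega> (div_h \<T> \<phi>) q = 0) \<and>
           (\<forall>\<eta>\<in>MWX \<Omega> \<T>.
              L2_inner \<Omega> (curl_h \<T> u\<^sub>h\<^sub>0) (curl_h \<T> \<eta>) = L2_inner \<Omega> \<phi> (curl_h \<T> \<eta>))))"
proof -
  interpret convex_mesh \<Omega> \<T> by (rule convex_mesh.intro[OF assms(1,2)])
  show ?thesis by (rule decoupling) (use assms in auto)
qed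

end
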